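(* Let $M$ be a compact smooth manifold equipped with a Riemannian metric (with induced distance $d$), and let $\mathcal{F}$ be a topological space consisting of Lipschitz self-maps of $M$. If $f\in\mathcal{F}$ is $\mathcal{F}$-stably hyperbolic, and $\mathcal{O}$ is an $f$-periodic orbit, then there exist a neighbourhood $U$ of $f$ in $\mathcal{F}$, and $C>0$, such that for all $g\in U$ the following hold: (i) The maps $h_g\colon\Omega(f)\to\Omega(g)$ and $i_g\colon\Omega(g)\to\Omega(f)$ of condition (IS) exist; that is, $h_g\circ f=g\circ h_g$, $i_g\circ g=f\circ i_g$, and the family is such that for every $\varepsilon>0$ one has $d_\infty(h_g,\mathrm{id})<\varepsilon$ and $d_\infty(i_g,\mathrm{id})<\varepsilon$ for all $g$ in some neighbourhood of $f$. (ii) Put $\mathcal{O}_g=h_g(\mathcal{O})$ and $d_g=\max\{d_\infty(h_g,\mathrm{id}),d_\infty(i_g,\mathrm{id})\}$. There exists $v_g\in C^1(M,\mathbb{R})$ such that $$\|\mathrm{D}v_g\|_\infty\le3C\,d_g^{1/2}\quad\text{and}\quad\mu_{\mathcal{O}_g}\in\mathcal{M}_{\max}(g,v_g),$$ and for all $\phi\in C^1(M,\mathbb{R})$ with $\mathcal{M}_{\max}(f,\phi)=\{\mu_{\mathcal{O}}\}$, $$\mathcal{M}_{\max}\bigl(g,\phi+\|\mathrm{D}\phi\|_\infty v_g\bigr)=\{\mu_{\mathcal{O}_g}\}.$$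
   Context: Notation. $\Omega(f)$ is the nonwandering set of $f$: the complement of the set of points $x$ having a neighbourhood $V$ with $f^n(V)\cap V=\emptyset$ for all $n\ge1$. $\operatorname{LIP}(f)$ is the optimal Lipschitz constant of $f$. $d_\infty(h,\mathrm{id})=\sup_x d(h(x),x)$ over the domain of $h$. $C^{0,\alpha}(M,\mathbb{R})$ is the space of $\alpha$-Hölder functions, $|\phi|_{\alpha}=\sup_{x\neq y}|\phi(x)-\phi(y)|/d(x,y)^\alpha$. $Q(f,\phi)=\sup\int\phi\,d\mu$ over $f$-invariant Borel probability measures $\mu$; $\mathcal{M}_{\max}(f,\phi)$ is the set of invariant probability measures attaining this supremum. For a periodic orbit $\mathcal{O}$, $\mu_{\mathcal{O}}=\frac1{\operatorname{card}\mathcal{O}}\sum_{x\in\mathcal{O}}\delta_x$. Definition. $f\in\mathcal{F}$ is $\mathcal{F}$-stably hyperbolic if: (IS) For every $\varepsilon>0$ there is a neighbourhood $U$ of $f$ in $\mathcal{F}$ such that if $g\in U$ then $\operatorname{LIP}(g)<2\operatorname{LIP}(f)$ and there exist maps $h_g\colon\Omega(f)\to\Omega(g)$, $i_g\colon\Omega(g)\to\Omega(f)$ with $h_g\circ f=g\circ h_g$, $i_g\circ g=f\circ i_g$, $d_\infty(h_g,\mathrm{id})<\varepsilon$, $d_\infty(i_g,\mathrm{id})<\varepsilon$. (RHE) There are a neighbourhood $U$ of $f$ and constants $K>0$, $\delta>0$, $\lambda>1$ such that for all $g\in U$, $x,y\in\Omega(g)$, $n\in\mathbb{N}$: if $\max_{0\le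 m\le n}d(g^m(x),g^m(y))<\delta$, then $d(g^m(x),g^m(y))\le K\lambda^{-\min\{m,n-m\}}(d(x,y)+d(g^n(x),g^n(y)))$ for all $0\le m\le n$. (ML) For every $\alpha\in(0,1]$ there is $L>0$ such that for all $\phi\in C^{0,\alpha}(M,\mathbb{R})$ there is $u\in C^{0,\alpha}(\Omega(f),\mathbb{R})$ with $\phi+u-u\circ f\le Q(f,\phi)$ on $\Omega(f)$ and $|u|_\alpha\le L|\phi|_\alpha$. *)

theory Defs
  imports "HOL-Probability.Probability"
begin

section \<open>Riemannian manifolds\<close>

text \<open>
  The manifold is a whole metric space type; its topology is the manifold topology.
  A chart is a domain together with a coordinate map, whose values outside the domain are irrelevant.
\<close>

type_synonym ('m, 'b) chart = "'m set \<times> ('m \<Rightarrow> 'b)"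

text \<open>
  \<open>C\<^sup>k\<close> maps on an open set of a finite-dimensional space, by iterated directional derivatives.
\<close>

primrec Ck_on :: "nat \<Rightarrow> 'a::euclidean_space set \<Rightarrow> ('a \<Rightarrow> 'c::real_normed_vector) \<Rightarrow> bool" where
  "Ck_on 0 S f = continuous_on S f"
| "Ck_on (Suc k) S f =
    ((\<forall>x\<in>S. f differentiable (at x)) \<and> (\<forall>v. Ck_on k S (\<lambda>x. frechet_derivative f (at x) v)))"

definition smooth_on :: "'a::euclidean_space set \<Rightarrow> ('a \<Rightarrow> 'c::real_normed_vector) \<Rightarrow> bool" where
  "smooth_on S f \<longleftrightarrow> (\<forall>k. Ck_on k S f)"

definition smooth_atlas :: "('m::topological_space, 'b::euclidean_space) chart set \<Rightarrow> bool" where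
  "smooth_atlas A \<longleftrightarrow>
     (\<forall>(U, \<psi>)\<in>A. open U \<and> open (\<psi> ` U) \<and> homeomorphism U (\<psi> ` U) \<psi> (inv_into U \<psi>)) \<and>
     (\<Union>(U, \<psi>)\<in>A. U) = UNIV \<and>
     (\<forall>(U, \<psi>)\<in>A. \<forall>(V, \<eta>)\<in>A. smooth_on (\<psi> ` (U \<inter> V)) (\<eta> \<circ> inv_into U \<psi>))"

text \<open>
  A Riemannian metric is given by its coordinate expressions: \<open>G c p\<close> is the inner product on
  the tangent space at \<open>p\<close>, read in the chart \<open>c\<close>. The expressions in two charts are related by
  the derivative of the coordinate change.
\<close>

type_synonym ('m, 'b) metric_coords = "('m, 'b) chart \<Rightarrow> 'm \<Rightarrow> 'b \<Rightarrow> 'b \<Rightarrow> real"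

definition riemannian_metric ::
  "('m::topological_space, 'b::euclidean_space) chart set \<Rightarrow> ('m, 'b) metric_coords \<Rightarrow> bool" where
  "riemannian_metric A G \<longleftrightarrow>
     (\<forall>(U, \<psi>)\<in>A. \<forall>p\<in>U.
        bilinear (G (U, \<psi>) p) \<and>
        (\<forall>v w. G (U, \<psi>) p v w = G (U, \<psi>) p w v) \<and>
        (\<forall>v. v \<noteq> 0 \<longrightarrow> G (U, \<psi>) p v v > 0)) \<and>
     (\<forall>(U, \<psi>)\<in>A. \<forall>v w. smooth_on (\<psi> ` U) (\<lambda>y. G (U, \<psi>) (inv_into U \<psi> y) v w)) \<and>
     (\<forall>(U, \<psi>)\<in>A. \<forall>(V, \<eta>)\<in>A. \<forall>p\<in>U \<inter> V. \<forall>v w.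
        G (U, \<psi>) p v w =
          G (V, \<eta>) p (frechet_derivative (\<eta> \<circ> inv_into U \<psi>) (at (\<psi> p)) v)
                   (frechet_derivative (\<eta> \<circ> inv_into U \<psi>) (at (\<psi> p)) w))"

text \<open>At end points of the interval only one-sided derivatives are required.\<close>

definition C1_curve_on ::
  "('m::topological_space, 'b::euclidean_space) chart set \<Rightarrow> real \<Rightarrow> real \<Rightarrow> (real \<Rightarrow> 'm) \<Rightarrow> bool" where
  "C1_curve_on A a b \<gamma> \<longleftrightarrow>
     continuous_on {a..b} \<gamma> \<and>
     (\<forall>(U, \<psi>)\<in>A. \<exists>D. continuous_on {t\<in>{a..b}. \<gamma> t \<in> U} D \<and>
        (\<forall>t\<in>{t\<in>{a..b}. \<gamma> t \<in> U}. ((\<psi> \<circ> \<gamma>) has_vector_derivative D t) (at t within {a..b})))"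

text \<open>The break points of the curve are contained in the finite set \<open>S\<close>.\<close>

definition piecewise_C1_curve ::
  "('m::topological_space, 'b::euclidean_space) chart set \<Rightarrow> (real \<Rightarrow> 'm) \<Rightarrow> bool" where
  "piecewise_C1_curve A \<gamma> \<longleftrightarrow>
     (\<exists>S. finite S \<and> {0, 1} \<subseteq> S \<and> S \<subseteq> {0..1} \<and>
        (\<forall>a\<in>S. \<forall>b\<in>S. a < b \<and> {a<..<b} \<inter> S = {} \<longrightarrow> C1_curve_on A a b \<gamma>))"

text \<open>
  The speed does not depend on the choice of the chart. It is meaningless at the finitely many
  break points, which does not affect the length.
\<close>

definition curve_speed ::
  "('m::topological_space, 'b::euclidean_space) chart set \<Rightarrow> ('m, 'b) metric_coords \<Rightarrow>
     (real \<Rightarrow> 'm) \<Rightarrow> real \<Rightarrow> real" where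
  "curve_speed A G \<gamma> t =
     (let c = (SOME c. c \<in> A \<and> \<gamma> t \<in> fst c);
          v = vector_derivative (snd c \<circ> \<gamma>) (at t)
      in sqrt (G c (\<gamma> t) v v))"

definition curve_length ::
  "('m::topological_space, 'b::euclidean_space) chart set \<Rightarrow> ('m, 'b) metric_coords \<Rightarrow>
     (real \<Rightarrow> 'm) \<Rightarrow> real" where
  "curve_length A G \<gamma> = integral {0..1} (curve_speed A G \<gamma>)"

text \<open>
  The distance of the metric space type is the one induced by the Riemannian metric. The infimum
  is taken in the extended reals, where the infimum of the empty set is \<open>\<infinity>\<close>; as \<open>dist\<close> is
  finite, any two points are joined by a curve.
\<close>

definition induced_distance ::
  "('m::metric_space, 'b::euclidean_space) chart set \<Rightarrow> ('m, 'b) metric_coords \<Rightarrow> bool" where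
  "induced_distance A G \<longleftrightarrow>
     (\<forall>x y. ereal (dist x y) =
        (INF \<gamma>\<in>{\<gamma>. piecewise_C1_curve A \<gamma> \<and> \<gamma> 0 = x \<and> \<gamma> 1 = y}. ereal (curve_length A G \<gamma>)))"

definition compact_riemannian_manifold ::
  "('m::metric_space, 'b::euclidean_space) chart set \<Rightarrow> ('m, 'b) metric_coords \<Rightarrow> bool" where
  "compact_riemannian_manifold A G \<longleftrightarrow>
     compact (UNIV :: 'm set) \<and> smooth_atlas A \<and> riemannian_metric A G \<and> induced_distance A G"

definition C1_functions ::
  "('m::topological_space, 'b::euclidean_space) chart set \<Rightarrow> ('m \<Rightarrow> real) set" where
  "C1_functions A = {\<phi>. \<forall>(U, \<psi>)\<in>A. Ck_on 1 (\<psi> ` U) (\<phi> \<circ> inv_into U \<psi>)}"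

text \<open>
  The supremum over all points of the operator norm of the derivative with respect to the
  Riemannian metric, in coordinates.
\<close>

definition D_sup_norm ::
  "('m::topological_space, 'b::euclidean_space) chart set \<Rightarrow> ('m, 'b) metric_coords \<Rightarrow>
     ('m \<Rightarrow> real) \<Rightarrow> real" where
  "D_sup_norm A G \<phi> =
     Sup {\<bar>frechet_derivative (\<phi> \<circ> inv_into U \<psi>) (at (\<psi> p)) w\<bar> | U \<psi> p w.
            (U, \<psi>) \<in> A \<and> p \<in> U \<and> G (U, \<psi>) p w w \<le> 1}"


section \<open>Dynamics\<close>

definition nonwandering :: "('m::topological_space \<Rightarrow> 'm) \<Rightarrow> 'm set" where
  "nonwandering f = - {x. \<exists>V. open V \<and> x \<in> V \<and> (\<forall>n\<ge>1. (f ^^ n) ` V \<inter> V = {})}"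

definition LIP :: "('m::metric_space \<Rightarrow> 'm) \<Rightarrow> real" where
  "LIP f = Inf {L. L-lipschitz_on UNIV f}"

text \<open>The distance to the identity of a map with domain \<open>S\<close>.\<close>

definition d_inf_id :: "'m::metric_space set \<Rightarrow> ('m \<Rightarrow> 'm) \<Rightarrow> real" where
  "d_inf_id S h = (SUP x\<in>S. dist (h x) x)"

definition intertwines :: "('m::topological_space \<Rightarrow> 'm) \<Rightarrow> ('m \<Rightarrow> 'm) \<Rightarrow> ('m \<Rightarrow> 'm) \<Rightarrow> bool" where
  "intertwines f g h \<longleftrightarrow>
     h \<in> nonwandering f \<rightarrow> nonwandering g \<and> (\<forall>x\<in>nonwandering f. h (f x) = g (h x))"

definition periodic_orbit :: "('m \<Rightarrow> 'm) \<Rightarrow> 'm set \<Rightarrow> bool" where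
  "periodic_orbit f \<O> \<longleftrightarrow> (\<exists>x p. p \<ge> 1 \<and> (f ^^ p) x = x \<and> \<O> = range (\<lambda>n. (f ^^ n) x))"

definition holder_on :: "real \<Rightarrow> 'm::metric_space set \<Rightarrow> ('m \<Rightarrow> real) \<Rightarrow> bool" where
  "holder_on \<alpha> S \<phi> \<longleftrightarrow> (\<exists>C. \<forall>x\<in>S. \<forall>y\<in>S. \<bar>\<phi> x - \<phi> y\<bar> \<le> C * dist x y powr \<alpha>)"

text \<open>
  The pairs with \<open>x = y\<close> only contribute the value \<open>0 / 0 = 0\<close>, so that the supremum is \<open>0\<close> if
  \<open>S\<close> is a singleton.
\<close>

definition holder_seminorm :: "real \<Rightarrow> 'm::metric_space set \<Rightarrow> ('m \<Rightarrow> real) \<Rightarrow> real" where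
  "holder_seminorm \<alpha> S \<phi> = (SUP (x, y)\<in>S \<times> S. \<bar>\<phi> x - \<phi> y\<bar> / dist x y powr \<alpha>)"

definition invariant_measures :: "('m::topological_space \<Rightarrow> 'm) \<Rightarrow> 'm measure set" where
  "invariant_measures f = {\<mu>. prob_space \<mu> \<and> sets \<mu> = sets borel \<and> distr \<mu> borel f = \<mu>}"

definition max_integral :: "('m::topological_space \<Rightarrow> 'm) \<Rightarrow> ('m \<Rightarrow> real) \<Rightarrow> real" where
  "max_integral f \<phi> = (SUP \<mu>\<in>invariant_measures f. \<integral>x. \<phi> x \<partial>\<mu>)"

definition maximizing_measures ::
  "('m::topological_space \<Rightarrow> 'm) \<Rightarrow> ('m \<Rightarrow> real) \<Rightarrow> 'm measure set" where
  "maximizing_measures f \<phi> = {\<mu>\<in>invariant_measures f. (\<integral>x. \<phi> x \<partial>\<mu>) = max_integral f \<phi>}"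

definition orbit_measure :: "'m::topological_space set \<Rightarrow> 'm measure" where
  "orbit_measure \<O> =
     measure_of UNIV (sets borel) (\<lambda>B. (\<Sum>x\<in>\<O>. emeasure (return borel x) B) / of_nat (card \<O>))"


section \<open>Stable hyperbolicity\<close>

text \<open>
  The space of maps is an abstract topology on a set of maps. Neighbourhoods may be taken open,
  since all conditions required on a neighbourhood pass to smaller ones.
\<close>

definition cond_IS :: "('m::metric_space \<Rightarrow> 'm) topology \<Rightarrow> ('m \<Rightarrow> 'm) \<Rightarrow> bool" where
  "cond_IS F f \<longleftrightarrow>
     (\<forall>\<epsilon>>0. \<exists>U. openin F U \<and> f \<in> U \<and>
        (\<forall>g\<in>U. LIP g < 2 * LIP f \<and>
           (\<exists>h i. intertwines f g h \<and> intertwines g f i \<and>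
              d_inf_id (nonwandering f) h < \<epsilon> \<and> d_inf_id (nonwandering g) i < \<epsilon>)))"

definition cond_RHE :: "('m::metric_space \<Rightarrow> 'm) topology \<Rightarrow> ('m \<Rightarrow> 'm) \<Rightarrow> bool" where
  "cond_RHE F f \<longleftrightarrow>
     (\<exists>U K \<delta> \<Lambda>. openin F U \<and> f \<in> U \<and> K > 0 \<and> \<delta> > 0 \<and> \<Lambda> > 1 \<and>
        (\<forall>g\<in>U. \<forall>x\<in>nonwandering g. \<forall>y\<in>nonwandering g. \<forall>n.
           (\<forall>m\<le>n. dist ((g ^^ m) x) ((g ^^ m) y) < \<delta>) \<longrightarrow>
           (\<forall>m\<le>n. dist ((g ^^ m) x) ((g ^^ m) y)
              \<le> K * \<Lambda> powr (- real (min m (n - m))) * (dist x y + dist ((g ^^ n) x) ((g ^^ n) y)))))"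

definition cond_ML :: "('m::metric_space \<Rightarrow> 'm) \<Rightarrow> bool" where
  "cond_ML f \<longleftrightarrow>
     (\<forall>\<alpha>. 0 < \<alpha> \<and> \<alpha> \<le> 1 \<longrightarrow>
        (\<exists>L>0. \<forall>\<phi>. holder_on \<alpha> UNIV \<phi> \<longrightarrow>
           (\<exists>u. holder_on \<alpha> (nonwandering f) u \<and>
              (\<forall>x\<in>nonwandering f. \<phi> x + u x - u (f x) \<le> max_integral f \<phi>) \<and>
              holder_seminorm \<alpha> (nonwandering f) u \<le> L * holder_seminorm \<alpha> UNIV \<phi>)))"

definition stably_hyperbolic :: "('m::metric_space \<Rightarrow> 'm) topology \<Rightarrow> ('m \<Rightarrow> 'm) \<Rightarrow> bool" where
  "stably_hyperbolic F f \<longleftrightarrow> f \<in> topspace F \<and> cond_IS F f \<and> cond_RHE F f \<and> cond_ML f"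

end

theory Submission
  imports Defs
begin

text \<open>
  Let \<open>\<rho> = d\<^sub>g\<close>, and let \<open>u\<close> be a Lipschitz function with \<open>\<phi> + u - u \<circ> f \<le> Q(f, \<phi>)\<close> on the nonwandering
  set of \<open>f\<close>. Along a \<open>g\<close>-orbit, \<open>u \<circ> i\<^sub>g\<close> makes \<open>\<phi>\<close> exceed \<open>Q(f, \<phi>)\<close>, hence its mean over the perturbed
  cycle, by at most a multiple of \<open>\<rho>\<close> per step, up to a coboundary. While the orbit stays in
  a fixed small neighbourhood of the cycle it shadows the cycle, and hyperbolicity makes the distance
  to the cycle at most \<open>\<rho>\<close> except in the first and the last \<open>O(\<rho> powr (-1/2))\<close> steps. A whole
  shadowing run therefore gains at most \<open>O(\<rho> powr (1/2))\<close>. This is paid back by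
  \<open>v\<^sub>g = - c w\<close> with \<open>c\<close> of order \<open>\<rho> powr (1/2)\<close>, where \<open>w \<ge> 0\<close> is a fixed \<open>C\<^sup>1\<close> function that
  vanishes near the cycle and is at least \<open>1\<close> at every step at which the orbit leaves the
  neighbourhood. An invariant measure that never leaves it must be carried by the cycle.
\<close>

section \<open>Invariant measures and the nonwandering set\<close>

text \<open>Neither \<open>h\<close> nor \<open>i\<close> is assumed continuous or measurable, so
  the coboundary built from \<open>u\<close> and \<open>i\<close> cannot be integrated away. What is
  proved instead is a pointwise bound on Birkhoff sums that does not depend on their length;
  integrating it yields the inequality between integrals. The order of choices matters as well: the
  neighbourhood, \<open>w\<close> and all constants are fixed before \<open>\<phi>\<close> is known.
  This works because (ML) with exponent 1 makes the Lipschitz constant of \<open>u\<close> a fixed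
  multiple of that of \<open>\<phi>\<close>, so that every estimate is linear in the norm of the
  derivative, and this norm is the factor in front of \<open>v\<close>. Condition (IS) gives maps
  that may change with the prescribed accuracy, whereas one family has to serve all accuracies. For
  each \<open>g\<close> a pair is taken whose displacement is within a factor 2 of the best one. Two
  degenerate cases need arguments of their own: a \<open>\<phi>\<close> with zero derivative, whose
  penalty is zero, and displacement zero, for which \<open>v\<close> itself is zero.\<close>

lemma in_nonwandering_step:
  assumes g: "continuous_on UNIV g" and x: "x \<in> nonwandering g"
  shows "g x \<in> nonwandering g"
proof -
  have "\<exists>n\<ge>1. (g ^^ n) ` V \<inter> V \<noteq> {}" if V: "open V" "g x \<in> V" for V
  proof -
    have "open (g -` V)"
      using g V by (auto simp: continuous_on_open_vimage)
    then obtain n z where n: "n \<ge> 1" and z: "g z \<in> V" "g ((g ^^ n) z) \<in> V"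
      using x V unfolding nonwandering_def by blast
    have "(g ^^ n) (g z) = g ((g ^^ n) z)"
      by (metis funpow_swap1)
    with n z show ?thesis by (metis IntI empty_iff imageI)
  qed
  then show ?thesis unfolding nonwandering_def by blast
qed

lemma funpow_in_nonwandering:
  assumes "continuous_on UNIV g" "x \<in> nonwandering g"
  shows "(g ^^ n) x \<in> nonwandering g"
  by (induction n) (simp_all add: assms in_nonwandering_step)

lemma closed_nonwandering: "closed (nonwandering g)"
proof -
  have "\<exists>T. open T \<and> x \<in> T \<and> T \<subseteq> - nonwandering g" if "x \<in> - nonwandering g" for x
    using that unfolding nonwandering_def by auto
  then have "open (- nonwandering g)"
    by (subst open_subopen) blast
  then show ?thesis by (simp add: closed_def)
qed

lemma continuous_on_funpow:
  fixes g :: "'a::topological_space \<Rightarrow> 'a"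
  assumes "continuous_on UNIV g"
  shows "continuous_on UNIV (g ^^ n)"
proof (induction n)
  case (Suc n)
  then have "continuous_on UNIV (g \<circ> (g ^^ n))"
    using assms continuous_on_compose continuous_on_subset by blast
  then show ?case by simp
qed (simp add: id_def)

lemma invariant_measuresD:
  assumes "\<mu> \<in> invariant_measures g"
  shows "prob_space \<mu>" "sets \<mu> = sets borel" "space \<mu> = UNIV" "distr \<mu> borel g = \<mu>"
  using assms sets_eq_imp_space_eq[of \<mu> borel] unfolding invariant_measures_def by auto

lemma distr_funpow_invariant:
  assumes \<mu>: "\<mu> \<in> invariant_measures g" and g: "continuous_on UNIV g"
  shows "distr \<mu> borel (g ^^ n) = \<mu>"
proof (induction n)
  case 0
  show ?case
    using distr_id2[of borel \<mu>] invariant_measuresD[OF \<mu>] by (simp add: id_def)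
next
  case (Suc n)
  have [measurable_cong]: "sets \<mu> = sets borel" using invariant_measuresD(2)[OF \<mu>] .
  have [measurable]: "g \<in> borel_measurable borel" "g ^^ n \<in> borel_measurable borel"
    using g continuous_on_funpow[OF g] by (auto intro: borel_measurable_continuous_onI)
  have "distr \<mu> borel (g ^^ Suc n) = distr (distr \<mu> borel (g ^^ n)) borel g"
    by (simp add: distr_distr comp_def)
  also have "\<dots> = \<mu>" using Suc invariant_measuresD(4)[OF \<mu>] by simp
  finally show ?case .
qed

lemma borel_measurable_continuous_invariant:
  fixes a :: "'m::topological_space \<Rightarrow> 'b::topological_space"
  assumes "\<mu> \<in> invariant_measures g" "continuous_on UNIV a"
  shows "a \<in> borel_measurable \<mu>"
  unfolding measurable_cong_sets[OF invariant_measuresD(2)[OF assms(1)] refl]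
  by (rule borel_measurable_continuous_onI[OF assms(2)])

lemma emeasure_funpow_vimage_invariant:
  assumes \<mu>: "\<mu> \<in> invariant_measures g" and g: "continuous_on UNIV g" and B: "B \<in> sets borel"
  shows "emeasure \<mu> ((g ^^ n) -` B) = emeasure \<mu> B"
proof -
  have "emeasure \<mu> B = emeasure (distr \<mu> borel (g ^^ n)) B"
    by (simp add: distr_funpow_invariant[OF \<mu> g])
  also have "\<dots> = emeasure \<mu> ((g ^^ n) -` B)"
    using B invariant_measuresD(3)[OF \<mu>]
      borel_measurable_continuous_invariant[OF \<mu> continuous_on_funpow[OF g]]
    by (subst emeasure_distr) auto
  finally show ?thesis by simp
qed

text \<open>The preimages of \<open>V\<close> under the iterates are pairwise disjoint and have
  equal measure, so a positive common value would make the total mass infinite.\<close>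

lemma wandering_null:
  assumes \<mu>: "\<mu> \<in> invariant_measures g" and g: "continuous_on UNIV g"
    and V: "open V" "\<forall>n\<ge>1. (g ^^ n) ` V \<inter> V = {}"
  shows "emeasure \<mu> V = 0"
proof -
  interpret prob_space \<mu> using invariant_measuresD[OF \<mu>] by simp
  let ?A = "\<lambda>n. (g ^^ n) -` V"
  have disj: "?A m \<inter> ?A n = {}" if "m < n" for m n
  proof -
    have "(g ^^ (n - m)) ((g ^^ m) z) = (g ^^ n) z" for z
      using that by (metis comp_apply funpow_add le_add_diff_inverse2 less_imp_le)
    moreover have "n - m \<ge> 1" using that by simp
    ultimately show ?thesis using V(2) by (auto simp: disjoint_iff) (metis imageI)
  qed
  have "disjoint_family ?A"
    unfolding disjoint_family_on_def by (metis Int_commute disj linorder_neqE_nat)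
  moreover have "range ?A \<subseteq> events"
    using V(1) continuous_on_funpow[OF g] invariant_measuresD[OF \<mu>]
    by (auto simp: continuous_on_open_vimage)
  ultimately have "(\<lambda>n. prob (?A n)) sums prob (\<Union>n. ?A n)"
    by (intro finite_measure_UNION)
  moreover have "prob (?A n) = prob V" for n
    using emeasure_funpow_vimage_invariant[OF \<mu> g] V(1) by (simp add: measure_def)
  ultimately have "summable (\<lambda>n::nat. prob V)"
    by (simp add: sums_iff)
  then show ?thesis by (simp add: summable_const_iff emeasure_eq_measure)
qed

text \<open>The complement of the nonwandering set is a union of wandering open sets, but possibly
  of uncountably many. It is exhausted by countably many compact sets, each of which is covered by
  finitely many of these null sets. Nonemptiness matters because \<open>infdist\<close> to the empty
  set is 0.\<close>

lemma AE_nonwandering: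
  fixes g :: "'m::metric_space \<Rightarrow> 'm"
  assumes \<mu>: "\<mu> \<in> invariant_measures g" and g: "continuous_on UNIV g"
    and comp: "compact (UNIV :: 'm set)" and ne: "nonwandering g \<noteq> {}"
  shows "AE x in \<mu>. x \<in> nonwandering g"
proof -
  let ?B = "\<lambda>n::nat. {x. infdist x (nonwandering g) \<ge> 1 / real (Suc n)}"
  have clB: "closed (?B n)" for n
    by (intro closed_Collect_le continuous_intros)
  have "?B n \<in> null_sets \<mu>" for n
  proof -
    have "compact (?B n)"
      using compact_Int_closed[OF comp clB] by simp
    define \<V> where "\<V> = {V. open V \<and> (\<forall>n\<ge>1. (g ^^ n) ` V \<inter> V = {})}"
    have "?B n \<subseteq> - nonwandering g"
    proof
      fix x assume "x \<in> ?B n"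
      moreover have "1 / real (Suc n) > 0" by simp
      ultimately have "infdist x (nonwandering g) > 0"
        by (metis (mono_tags, lifting) less_le_trans mem_Collect_eq)
      then show "x \<in> - nonwandering g" using infdist_zero by fastforce
    qed
    moreover have "- nonwandering g \<subseteq> \<Union>\<V>"
      unfolding \<V>_def nonwandering_def by blast
    ultimately have "?B n \<subseteq> \<Union>\<V>" by blast
    then obtain \<W> where W: "\<W> \<subseteq> \<V>" "finite \<W>" "?B n \<subseteq> \<Union>\<W>"
      using compactE[OF \<open>compact (?B n)\<close>, of \<V>] unfolding \<V>_def by blast
    have "V \<in> null_sets \<mu>" if "V \<in> \<W>" for V
      using wandering_null[OF \<mu> g, of V] that W(1) invariant_measuresD(2)[OF \<mu>]
      unfolding \<V>_def null_sets_def by auto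
    then have "\<Union>\<W> \<in> null_sets \<mu>"
      using null_sets.finite_Union[OF W(2), of \<mu>] by blast
    then show ?thesis
      using W(3) clB[of n] invariant_measuresD(2)[OF \<mu>]
      by (metis (no_types, lifting) borel_closed null_sets_subset)
  qed
  then have "(\<Union>n. ?B n) \<in> null_sets \<mu>" by blast
  moreover have "- nonwandering g \<subseteq> (\<Union>n. ?B n)"
  proof
    fix x assume "x \<in> - nonwandering g"
    then have "infdist x (nonwandering g) > 0"
      using infdist_pos_not_in_closed[OF closed_nonwandering ne] by auto
    then obtain n where "inverse (real (Suc n)) < infdist x (nonwandering g)"
      using reals_Archimedean by blast
    then show "x \<in> (\<Union>n. ?B n)" by (auto simp: inverse_eq_divide intro: less_imp_le)
  qed
  ultimately show ?thesis by (intro AE_I') blast+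
qed

lemma integrable_continuous_invariant:
  fixes a :: "'m::metric_space \<Rightarrow> real"
  assumes \<mu>: "\<mu> \<in> invariant_measures g" and comp: "compact (UNIV :: 'm set)"
    and a: "continuous_on UNIV a"
  shows "integrable \<mu> a"
proof -
  interpret prob_space \<mu> using invariant_measuresD[OF \<mu>] by simp
  obtain B where "\<And>x. norm (a x) \<le> B"
    using compact_imp_bounded[OF compact_continuous_image[OF a comp]]
    by (auto simp: bounded_iff)
  then show ?thesis
    by (intro integrable_const_bound[where B=B] borel_measurable_continuous_invariant[OF \<mu> a]) auto
qed

lemma integral_funpow_invariant:
  fixes a :: "'m::topological_space \<Rightarrow> real"
  assumes \<mu>: "\<mu> \<in> invariant_measures g" and g: "continuous_on UNIV g" and a: "continuous_on UNIV a"
  shows "(\<integral>x. a ((g ^^ n) x) \<partial>\<mu>) = (\<integral>x. a x \<partial>\<mu>)"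
proof -
  have "(\<integral>x. a x \<partial>\<mu>) = (\<integral>x. a x \<partial>distr \<mu> borel (g ^^ n))"
    by (simp add: distr_funpow_invariant[OF \<mu> g])
  also have "\<dots> = (\<integral>x. a ((g ^^ n) x) \<partial>\<mu>)"
    by (intro integral_distr borel_measurable_continuous_onI a
        borel_measurable_continuous_invariant[OF \<mu> continuous_on_funpow[OF g]])
  finally show ?thesis by simp
qed

text \<open>By invariance the integral of a Birkhoff sum of length \<open>n\<close> is
  \<open>n\<close> times the integral of \<open>a\<close>, so a positive integral would exceed any
  fixed bound. The bound is required only on the nonwandering set, which carries the
  measure.\<close>

lemma integral_nonpos_if_sums_bounded:
  fixes a :: "'m::metric_space \<Rightarrow> real"
  assumes \<mu>: "\<mu> \<in> invariant_measures g" and g: "continuous_on UNIV g" and a: "continuous_on UNIV a"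
    and comp: "compact (UNIV :: 'm set)" and ne: "nonwandering g \<noteq> {}"
    and B: "\<And>x n. x \<in> nonwandering g \<Longrightarrow> (\<Sum>k<n. a ((g ^^ k) x)) \<le> B"
  shows "(\<integral>x. a x \<partial>\<mu>) \<le> 0"
proof (rule ccontr)
  interpret prob_space \<mu> using invariant_measuresD[OF \<mu>] by simp
  assume "\<not> ?thesis"
  then obtain n where n: "real n * (\<integral>x. a x \<partial>\<mu>) > B"
    using reals_Archimedean3[of "\<integral>x. a x \<partial>\<mu>"] by (auto simp: not_le)
  have int: "integrable \<mu> (\<lambda>x. a ((g ^^ k) x))" for k
    by (intro integrable_continuous_invariant[OF \<mu> comp]
        continuous_on_compose2[OF a continuous_on_funpow[OF g]]) auto
  have "real n * (\<integral>x. a x \<partial>\<mu>) = (\<Sum>k<n. \<integral>x. a ((g ^^ k) x) \<partial>\<mu>)"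
    by (simp add: integral_funpow_invariant[OF \<mu> g a])
  also have "\<dots> = (\<integral>x. (\<Sum>k<n. a ((g ^^ k) x)) \<partial>\<mu>)"
    by (rule Bochner_Integration.integral_sum[symmetric]) (rule int)
  also have "\<dots> \<le> (\<integral>x. B \<partial>\<mu>)"
    using AE_nonwandering[OF \<mu> g comp ne] B
    by (intro integral_mono_AE Bochner_Integration.integrable_sum int) auto
  finally show False using n by (simp add: prob_space)
qed

section \<open>Orbit measures and maximizing measures\<close>

lemma orbit_measure_eq_distr:
  fixes \<O> :: "'m::t1_space set"
  assumes "finite \<O>" "\<O> \<noteq> {}"
  shows "orbit_measure \<O> = distr (measure_pmf (pmf_of_set \<O>)) borel (\<lambda>x. x)" (is "_ = ?N")
proof -
  \<comment> \<open>\<open>measure_of\<close> takes the prescribed values only if they form a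
    measure; this is inherited from \<open>?N\<close>, which has the same values.\<close>
  have "orbit_measure \<O> = measure_of (space ?N) (sets ?N) (emeasure ?N)"
    unfolding orbit_measure_def
  proof (simp, intro measure_of_eq)
    fix B :: "'m set" assume "B \<in> sigma_sets UNIV (sets borel)"
    then have B: "B \<in> sets borel" by (metis sets.sigma_sets_eq space_borel)
    have "(\<Sum>x\<in>\<O>. emeasure (return borel x) B) = of_nat (card (\<O> \<inter> B))"
      using B assms(1) by (simp add: indicator_def sum.If_cases Int_def flip: of_bool_def)
    then show "(\<Sum>x\<in>\<O>. emeasure (return borel x) B) / of_nat (card \<O>) = emeasure ?N B"
      using B assms by (simp add: emeasure_distr emeasure_pmf_of_set divide_ennreal ennreal_of_nat_eq_real_of_nat card_gt_0_iff)
  qed simp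
  then show ?thesis by (simp only: measure_of_of_measure)
qed

lemma integral_orbit_measure:
  fixes a :: "'m::metric_space \<Rightarrow> real"
  assumes "finite \<O>" "\<O> \<noteq> {}" "continuous_on UNIV a"
  shows "(\<integral>x. a x \<partial>orbit_measure \<O>) = (\<Sum>x\<in>\<O>. a x) / card \<O>"
proof -
  have "(\<integral>x. a x \<partial>orbit_measure \<O>) = (\<integral>x. a x \<partial>measure_pmf (pmf_of_set \<O>))"
    unfolding orbit_measure_eq_distr[OF assms(1,2)]
    by (intro integral_distr borel_measurable_continuous_onI assms(3)) simp
  then show ?thesis by (simp add: integral_pmf_of_set assms)
qed

text \<open>A surjection of a finite set onto itself is a permutation and therefore preserves the
  uniform distribution.\<close>

lemma orbit_measure_invariant:
  fixes \<O> :: "'m::metric_space set"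
  assumes "finite \<O>" "\<O> \<noteq> {}" "g ` \<O> = \<O>" "continuous_on UNIV g"
  shows "orbit_measure \<O> \<in> invariant_measures g"
proof -
  let ?p = "pmf_of_set \<O>"
  have [measurable]: "g \<in> borel_measurable borel"
    using assms(4) by (rule borel_measurable_continuous_onI)
  have "inj_on g \<O>" using assms by (simp add: eq_card_imp_inj_on)
  then have "map_pmf g ?p = ?p" using assms by (simp add: map_pmf_of_set_inj)
  have "distr (distr (measure_pmf ?p) borel (\<lambda>x. x)) borel g = distr (measure_pmf ?p) borel g"
    by (subst distr_distr) (auto simp: comp_def)
  also have "\<dots> = distr (distr (measure_pmf ?p) (count_space UNIV) g) borel (\<lambda>x. x)"
    by (subst distr_distr) (auto simp: comp_def)
  also have "\<dots> = distr (measure_pmf ?p) borel (\<lambda>x. x)"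
    using \<open>map_pmf g ?p = ?p\<close> by (metis map_pmf_rep_eq)
  finally show ?thesis
    unfolding orbit_measure_eq_distr[OF assms(1,2)] invariant_measures_def
    by (auto intro!: prob_space.prob_space_distr simp: prob_space_measure_pmf)
qed

text \<open>Up to a null set the preimage of \<open>{g x}\<close> is \<open>{x}\<close>, because
  \<open>g\<close> permutes the cycle. Hence all points of the cycle carry the same mass.\<close>

lemma invariant_measure_on_orbit:
  fixes \<O> :: "'m::metric_space set"
  assumes \<mu>: "\<mu> \<in> invariant_measures g" and O: "finite \<O>" "\<O> \<noteq> {}" "g ` \<O> = \<O>"
    and trans: "\<And>x y. x \<in> \<O> \<Longrightarrow> y \<in> \<O> \<Longrightarrow> \<exists>n. y = (g ^^ n) x"
    and g: "continuous_on UNIV g" and AE: "AE x in \<mu>. x \<in> \<O>"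
  shows "\<mu> = orbit_measure \<O>"
proof -
  interpret prob_space \<mu> using invariant_measuresD[OF \<mu>] by simp
  note sets_\<mu>[simp] = invariant_measuresD(2,3)[OF \<mu>]
  have inj: "inj_on g \<O>" using O by (simp add: eq_card_imp_inj_on)
  have fin_sets: "B \<in> sets \<mu>" if "finite B" for B
    using that by (simp add: finite_imp_closed)
  have step: "prob {g x} = prob {x}" if x: "x \<in> \<O>" for x
  proof -
    have "prob {g x} = prob (g -` {g x})"
      using emeasure_funpow_vimage_invariant[OF \<mu> g, of "{g x}" 1] by (simp add: measure_def)
    also have "\<dots> = prob {x}"
    proof (rule finite_measure_eq_AE)
      show "AE z in \<mu>. z \<in> g -` {g x} \<longleftrightarrow> z \<in> {x}"
        using AE by eventually_elim (use inj x in \<open>auto dest: inj_onD\<close>)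
      show "g -` {g x} \<in> events"
        using continuous_closed_vimage[of "{g x}" g] g
        by (auto simp: continuous_on_eq_continuous_at)
    qed (rule fin_sets, simp)
    finally show ?thesis .
  qed
  have pow: "(g ^^ n) x \<in> \<O>" "prob {(g ^^ n) x} = prob {x}" if "x \<in> \<O>" for x n
    by (induction n) (use that O(3) step in auto)
  obtain x0 where x0: "x0 \<in> \<O>" using O by blast
  define c where "c = prob {x0}"
  have c: "prob {x} = c" if "x \<in> \<O>" for x
    using trans[OF x0 that] pow(2)[OF x0] unfolding c_def by metis
  have fin: "prob B = card B * c" if "B \<subseteq> \<O>" for B
  proof -
    have "prob B = (\<Sum>x\<in>B. prob {x})"
      using that O(1) by (intro measure_eq_sum_singleton) (auto intro: fin_sets finite_subset)
    also have "\<dots> = (\<Sum>x\<in>B. c)" using c that by (intro sum.cong) auto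
    finally show ?thesis by simp
  qed
  have "prob \<O> = 1" using AE fin_sets[OF O(1)] by (simp add: prob_eq_1)
  then have c_eq: "c = 1 / card \<O>" using fin[of \<O>] O by (simp add: field_simps)
  show ?thesis
  proof (rule measure_eqI)
    fix B assume "B \<in> sets \<mu>"
    then have B: "B \<in> sets borel" by simp
    have "prob B = prob (\<O> \<inter> B)"
      by (rule finite_measure_eq_AE) (use AE B O fin_sets in auto)
    then have "emeasure \<mu> B = ennreal (card (\<O> \<inter> B) / card \<O>)"
      using fin[of "\<O> \<inter> B"] c_eq by (simp add: emeasure_eq_measure)
    then show "emeasure \<mu> B = emeasure (orbit_measure \<O>) B"
      using B O by (simp add: orbit_measure_eq_distr emeasure_distr emeasure_pmf_of_set)
  qed (simp add: orbit_measure_eq_distr[OF O(1,2)])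
qed

lemma bdd_above_integral_invariant:
  fixes a :: "'m::metric_space \<Rightarrow> real"
  assumes comp: "compact (UNIV :: 'm set)" and a: "continuous_on UNIV a"
  shows "bdd_above ((\<lambda>\<mu>. \<integral>x. a x \<partial>\<mu>) ` invariant_measures g)"
proof -
  obtain B where B: "\<And>x. norm (a x) \<le> B"
    using compact_imp_bounded[OF compact_continuous_image[OF a comp]]
    by (auto simp: bounded_iff)
  have "(\<integral>x. a x \<partial>\<mu>) \<le> B" if \<mu>: "\<mu> \<in> invariant_measures g" for \<mu>
  proof -
    interpret prob_space \<mu> using invariant_measuresD[OF \<mu>] by simp
    have "a x \<le> B" for x using B[of x] by simp
    then show ?thesis
      using integral_le_const[OF integrable_continuous_invariant[OF \<mu> comp a]] by simp
  qed
  then show ?thesis by (intro bdd_aboveI2)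
qed

text \<open>Compactness bounds the integrals, so that the real supremum in
  \<open>max_integral\<close> is a true one and can be replaced by pairwise comparison.\<close>

lemma maximizing_measures_iff:
  fixes a :: "'m::metric_space \<Rightarrow> real"
  assumes "compact (UNIV :: 'm set)" "continuous_on UNIV a"
  shows "\<mu> \<in> maximizing_measures g a \<longleftrightarrow>
    \<mu> \<in> invariant_measures g \<and> (\<forall>\<nu>\<in>invariant_measures g. (\<integral>x. a x \<partial>\<nu>) \<le> (\<integral>x. a x \<partial>\<mu>))"
proof
  assume "\<mu> \<in> maximizing_measures g a"
  then show "\<mu> \<in> invariant_measures g \<and> (\<forall>\<nu>\<in>invariant_measures g. (\<integral>x. a x \<partial>\<nu>) \<le> (\<integral>x. a x \<partial>\<mu>))"
    using cSUP_upper[OF _ bdd_above_integral_invariant[OF assms, of g]]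
    unfolding maximizing_measures_def max_integral_def by auto
next
  assume "\<mu> \<in> invariant_measures g \<and> (\<forall>\<nu>\<in>invariant_measures g. (\<integral>x. a x \<partial>\<nu>) \<le> (\<integral>x. a x \<partial>\<mu>))"
  then have "\<mu> \<in> invariant_measures g" "max_integral g a = (\<integral>x. a x \<partial>\<mu>)"
    unfolding max_integral_def by (auto intro!: cSup_eq_maximum)
  then show "\<mu> \<in> maximizing_measures g a"
    unfolding maximizing_measures_def by simp
qed

section \<open>Orbits near a perturbed cycle\<close>

definition birkhoff_sum :: "('m \<Rightarrow> 'm) \<Rightarrow> ('m \<Rightarrow> real) \<Rightarrow> 'm \<Rightarrow> nat \<Rightarrow> real" where
  "birkhoff_sum g a x n = (\<Sum>k<n. a ((g ^^ k) x))"

lemma birkhoff_sum_0 [simp]: "birkhoff_sum g a x 0 = 0"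
  by (simp add: birkhoff_sum_def)

lemma birkhoff_sum_1 [simp]: "birkhoff_sum g a x (Suc 0) = a x"
  by (simp add: birkhoff_sum_def)

lemma birkhoff_sum_add:
  "birkhoff_sum g a x (m + n) = birkhoff_sum g a x m + birkhoff_sum g a ((g ^^ m) x) n"
proof -
  have "birkhoff_sum g a x (m + n) = birkhoff_sum g a x m + (\<Sum>k<n. a ((g ^^ (m + k)) x))"
    unfolding birkhoff_sum_def by (induction n) (simp_all add: add.assoc)
  moreover have "(g ^^ (m + k)) x = (g ^^ k) ((g ^^ m) x)" for k
    by (metis add.commute comp_apply funpow_add)
  ultimately show ?thesis by (simp add: birkhoff_sum_def)
qed

lemma birkhoff_sum_le_coboundary:
  assumes "\<And>x. x \<in> S \<Longrightarrow> g x \<in> S" "\<And>x. x \<in> S \<Longrightarrow> a x \<le> U (g x) - U x + e" "x \<in> S"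
  shows "birkhoff_sum g a x n \<le> U ((g ^^ n) x) - U x + real n * e"
proof (induction n)
  case (Suc n)
  have "(g ^^ n) x \<in> S" by (induction n) (simp_all add: assms)
  from assms(2)[OF this] Suc show ?case
    by (simp add: birkhoff_sum_def algebra_simps)
qed simp

text \<open>\<open>P\<close> may be a proper multiple of the minimal period. The sum over
  \<open>P\<close> steps has the same value from every starting point, so it can be summed over the
  cycle and the two sums exchanged.\<close>

lemma birkhoff_sum_eq_average_on_cycle:
  assumes O: "finite \<O>" "f ` \<O> = \<O>" "\<And>x y. x \<in> \<O> \<Longrightarrow> y \<in> \<O> \<Longrightarrow> \<exists>n. y = (f ^^ n) x"
    and P: "\<And>x. x \<in> \<O> \<Longrightarrow> (f ^^ P) x = x" and x: "x \<in> \<O>"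
  shows "birkhoff_sum f a x P = P * ((\<Sum>y\<in>\<O>. a y) / card \<O>)"
proof -
  have inj: "inj_on f \<O>" using O by (simp add: eq_card_imp_inj_on)
  have bij: "bij_betw (f ^^ k) \<O> \<O>" for k
  proof (induction k)
    case (Suc k)
    then show ?case
      using bij_betw_trans[of "f ^^ k" \<O> \<O> f \<O>] inj O(2) by (simp add: bij_betw_def comp_def)
  qed (simp add: bij_betw_def)
  have pow: "(f ^^ k) y \<in> \<O>" if "y \<in> \<O>" for y k
    using bij[of k] that by (auto simp: bij_betw_def)
  have step: "birkhoff_sum f a (f y) P = birkhoff_sum f a y P" if "y \<in> \<O>" for y
    using birkhoff_sum_add[of f a y 1 P] birkhoff_sum_add[of f a y P 1] P[OF that] by simp
  have "birkhoff_sum f a ((f ^^ n) x) P = birkhoff_sum f a x P" for n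
    by (induction n) (simp_all add: step pow x)
  then have const: "birkhoff_sum f a y P = birkhoff_sum f a x P" if "y \<in> \<O>" for y
    using O(3)[OF x that] by metis
  have "card \<O> * birkhoff_sum f a x P = (\<Sum>y\<in>\<O>. birkhoff_sum f a y P)"
    using const by simp
  also have "\<dots> = (\<Sum>k<P. \<Sum>y\<in>\<O>. a ((f ^^ k) y))"
    unfolding birkhoff_sum_def by (rule sum.swap)
  also have "\<dots> = (\<Sum>k<P. \<Sum>y\<in>\<O>. a y)"
    by (intro sum.cong refl sum.reindex_bij_betw bij)
  finally have "card \<O> * birkhoff_sum f a x P = P * (\<Sum>y\<in>\<O>. a y)" by simp
  moreover have "card \<O> > 0" using O(1) x by (auto simp: card_gt_0_iff)
  ultimately show ?thesis by (simp add: field_simps)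
qed

text \<open>Each term is at most a power decaying from the left end plus one decaying from the right
  end.\<close>

lemma sum_geometric_two_sided_le:
  assumes "1 < (\<Lambda>::real)"
  shows "(\<Sum>m<l. \<Lambda> powr - real (min m (l - m))) \<le> 2 * (\<Lambda> / (\<Lambda> - 1))"
proof -
  define q where "q = 1 / \<Lambda>"
  have q: "0 < q" "q < 1" using assms by (auto simp: q_def)
  have qS: "\<Lambda> / (\<Lambda> - 1) = 1 / (1 - q)" using assms by (simp add: q_def field_simps)
  have pw: "\<Lambda> powr - real k = q ^ k" for k
    using assms by (simp add: q_def powr_minus_divide powr_realpow power_one_over)
  have geo: "(\<Sum>m<l. q ^ m) \<le> 1 / (1 - q)" for l
    using sum_le_suminf[of "\<lambda>m. q ^ m" "{..<l}"] q by (simp add: suminf_geometric summable_geometric)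
  have "(\<Sum>m<l. \<Lambda> powr - real (min m (l - m))) \<le> (\<Sum>m<l. q ^ m + q ^ (l - m))"
    unfolding pw using q by (intro sum_mono) (auto simp: min_def)
  also have "\<dots> = (\<Sum>m<l. q ^ m) + (\<Sum>m<l. q ^ (l - m))" by (rule sum.distrib)
  also have "(\<Sum>m<l. q ^ (l - m)) = (\<Sum>m<l. q ^ (Suc m))"
    by (rule sum.reindex_bij_witness[where i="\<lambda>m. l - Suc m" and j="\<lambda>m. l - Suc m"])
      (auto simp: Suc_diff_Suc simp flip: power_Suc)
  also have "\<dots> \<le> (\<Sum>m<l. q ^ m)"
    using q by (intro sum_mono) (simp add: mult_left_le_one_le)
  finally show ?thesis using geo[of l] unfolding qS by linarith
qed

text \<open>\<open>s\<close> separates the points of the cycle and \<open>B\<close> bounds the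
  expansion of \<open>g\<close>; the inequality relating them to \<open>r\<close> leaves an orbit
  near the cycle only one cycle point to follow at the next step. The threshold \<open>2 * r\<close>
  for hyperbolicity is the distance \<open>r\<close> to the cycle plus the displacement of
  \<open>h\<close>, which is at most \<open>\<rho> \<le> r\<close>.\<close>

locale perturbed_orbit =
  fixes f g h i :: "'m::metric_space \<Rightarrow> 'm" and \<O> :: "'m set" and w :: "'m \<Rightarrow> real"
    and \<rho> r B s K \<Lambda> :: real and P :: nat
  assumes compact_UNIV: "compact (UNIV :: 'm set)"
    and cont_g: "continuous_on UNIV g"
    and O: "finite \<O>" "\<O> \<noteq> {}" "f ` \<O> = \<O>" "\<O> \<subseteq> nonwandering f"
      "\<And>x y. x \<in> \<O> \<Longrightarrow> y \<in> \<O> \<Longrightarrow> \<exists>n. y = (f ^^ n) x"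
    and period: "\<And>y. y \<in> \<O> \<Longrightarrow> (f ^^ P) y = y" "P \<ge> 1"
    and hi: "intertwines f g h" "intertwines g f i"
    and dist_h: "\<And>x. x \<in> nonwandering f \<Longrightarrow> dist (h x) x \<le> \<rho>"
    and dist_i: "\<And>x. x \<in> nonwandering g \<Longrightarrow> dist (i x) x \<le> \<rho>"
    and sep: "\<And>x y. x \<in> \<O> \<Longrightarrow> y \<in> \<O> \<Longrightarrow> dist x y < s \<Longrightarrow> x = y"
    and radii: "\<rho> \<le> r" "0 < r" "2 * r + 2 * B * r < s"
    and lipschitz_g: "B-lipschitz_on UNIV g"
    and K: "K > 0" and \<Lambda>: "\<Lambda> > 1"
    and hyperbolic: "\<And>x y n m. \<lbrakk>x \<in> nonwandering g; y \<in> nonwandering g;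
      \<And>m. m \<le> n \<Longrightarrow> dist ((g ^^ m) x) ((g ^^ m) y) < 2 * r; m \<le> n\<rbrakk> \<Longrightarrow>
      dist ((g ^^ m) x) ((g ^^ m) y)
        \<le> K * \<Lambda> powr (- real (min m (n - m))) * (dist x y + dist ((g ^^ n) x) ((g ^^ n) y))"
    and cont_w: "continuous_on UNIV w"
    and w_nonneg: "\<And>x. 0 \<le> w x"
    and w_orbit: "\<And>y. y \<in> \<O> \<Longrightarrow> w (h y) = 0"
    and w_small: "\<And>x. w x < 1 \<Longrightarrow> \<exists>y\<in>\<O>. dist x y < r"
begin

lemma B_nonneg: "0 \<le> B"
  using lipschitz_g by (rule lipschitz_on_nonneg)

lemma \<rho>_nonneg: "0 \<le> \<rho>"
  using dist_h O by (meson all_not_in_conv order.trans subsetD zero_le_dist)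

lemma in_nonwandering:
  "x \<in> nonwandering g \<Longrightarrow> (g ^^ n) x \<in> nonwandering g"
  "x \<in> nonwandering f \<Longrightarrow> h x \<in> nonwandering g"
  "x \<in> nonwandering g \<Longrightarrow> i x \<in> nonwandering f"
  using funpow_in_nonwandering[OF cont_g] hi unfolding intertwines_def by auto

lemma h_step: "y \<in> nonwandering f \<Longrightarrow> g (h y) = h (f y)"
  and i_step: "x \<in> nonwandering g \<Longrightarrow> f (i x) = i (g x)"
  using hi unfolding intertwines_def by auto

lemma funpow_f_in: "y \<in> \<O> \<Longrightarrow> (f ^^ n) y \<in> \<O>"
  by (induction n) (use O(3) in auto)

lemma funpow_h: "y \<in> \<O> \<Longrightarrow> (g ^^ n) (h y) = h ((f ^^ n) y)"
  by (induction n) (use h_step funpow_f_in O(4) in auto)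

lemma image_orbit: "finite (h ` \<O>)" "h ` \<O> \<noteq> {}" "g ` h ` \<O> = h ` \<O>"
  "\<And>x y. x \<in> h ` \<O> \<Longrightarrow> y \<in> h ` \<O> \<Longrightarrow> \<exists>n. y = (g ^^ n) x"
  "h ` \<O> \<subseteq> nonwandering g"
proof -
  show "finite (h ` \<O>)" "h ` \<O> \<noteq> {}" using O by auto
  have "g ` h ` \<O> = h ` f ` \<O>"
    unfolding image_image using h_step O(4) by (intro image_cong) auto
  then show "g ` h ` \<O> = h ` \<O>" by (simp add: O(3))
  show "\<exists>n. y = (g ^^ n) x" if "x \<in> h ` \<O>" "y \<in> h ` \<O>" for x y
    using that O(5) funpow_h by (metis imageE)
  show "h ` \<O> \<subseteq> nonwandering g" using in_nonwandering(2) O(4) by auto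
qed

lemma nonwandering_nonempty: "nonwandering g \<noteq> {}"
  using image_orbit(2,5) by auto

text \<open>Points with the same image are at most \<open>2 * r\<close> apart, which is below the
  separation \<open>s\<close>. Hence the perturbed cycle has as many points as the original one, and
  means over it are sums over \<open>\<O>\<close>.\<close>

lemma inj_on_h: "inj_on h \<O>"
proof
  fix x y assume xy: "x \<in> \<O>" "y \<in> \<O>" "h x = h y"
  have "dist x y \<le> dist (h x) x + dist (h y) y"
    using xy(3) by (metis dist_commute dist_triangle2)
  also have "\<dots> \<le> 2 * r" using dist_h[of x] dist_h[of y] xy O(4) radii by force
  finally have "dist x y \<le> 2 * r" .
  moreover have "0 \<le> 2 * B * r" using B_nonneg radii by simp
  ultimately show "x = y" using sep xy radii by force
qed

text \<open>The cycle point near the start of the orbit is iterated by \<open>f\<close>; what has to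
  be excluded is that the orbit later comes close to a different point of the cycle.\<close>

lemma shadowed:
  assumes "\<And>m. m \<le> n \<Longrightarrow> w ((g ^^ m) x) < 1"
  shows "\<exists>y\<in>\<O>. \<forall>m\<le>n. dist ((g ^^ m) x) ((g ^^ m) (h y)) < 2 * r"
proof -
  obtain y where y: "y \<in> \<O>" "dist x y < r" using w_small assms[of 0] by auto
  have near: "dist x' (h y') < 2 * r" if "y' \<in> \<O>" "dist x' y' < r" for x' y'
    using dist_triangle2[of x' "h y'" y'] dist_h[of y'] that O(4) radii(1)
    by (smt (verit) dist_commute subsetD)
  have "dist ((g ^^ m) x) ((f ^^ m) y) < r" if "m \<le> n" for m
    using that
  proof (induction m)
    case (Suc m)
    let ?x = "(g ^^ m) x" and ?y = "(f ^^ m) y"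
    have yO: "?y \<in> \<O>" "f ?y \<in> \<O>" using funpow_f_in[OF y(1)] O(3) by blast+
    have IH: "dist ?x ?y < r" using Suc by simp
    \<comment> \<open>\<open>z\<close> is some cycle point near \<open>g ?x\<close>. Passing through
      \<open>g ?x\<close> and \<open>h (f ?y)\<close>, its distance to \<open>f ?y\<close> is less
      than \<open>r + 2 * B * r + r\<close>, so that separation identifies the two.\<close>
    obtain z where z: "z \<in> \<O>" "dist (g ?x) z < r"
      using w_small[OF assms[OF Suc.prems]] by auto
    have "dist (g ?x) (g (h ?y)) \<le> B * dist ?x (h ?y)"
      using lipschitz_g by (simp add: lipschitz_on_def)
    also have "\<dots> \<le> B * (2 * r)"
      using near[OF yO(1) IH] B_nonneg by (intro mult_left_mono) auto
    finally have "dist (g ?x) (h (f ?y)) \<le> 2 * B * r"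
      using h_step[of ?y] yO O(4) by auto
    moreover have "dist (h (f ?y)) (f ?y) \<le> r" using dist_h[of "f ?y"] yO O(4) radii by force
    ultimately have "dist z (f ?y) < s"
      using z(2) radii dist_triangle[of z "f ?y" "g ?x"]
        dist_triangle[of "g ?x" "f ?y" "h (f ?y)"]
      by (smt (verit) dist_commute)
    then have "z = f ?y" using sep z(1) yO(2) by blast
    then show ?case using z(2) by simp
  qed (use y in simp)
  then show ?thesis
    using y(1) near funpow_f_in funpow_h by (intro bexI[of _ y]) auto
qed

text \<open>The orbits confined to the region near the cycle converge to it, so that Poincare recurrence
  leaves no room for other invariant measures.\<close>

lemma unique_measure_near_orbit:
  assumes \<mu>: "\<mu> \<in> invariant_measures g" and w0: "(\<integral>x. w x \<partial>\<mu>) = 0"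
  shows "\<mu> = orbit_measure (h ` \<O>)"
proof (rule invariant_measure_on_orbit[OF \<mu> image_orbit(1-4) cont_g])
  interpret prob_space \<mu> using invariant_measuresD[OF \<mu>] by simp
  note sets_\<mu>[simp] = invariant_measuresD(2,3)[OF \<mu>]
  let ?W = "{x. 1 \<le> w x}"
  have clW: "closed ?W" using cont_w by (intro closed_Collect_le continuous_intros)
  have "AE x in \<mu>. w x = 0"
    using w0 w_nonneg integrable_continuous_invariant[OF \<mu> compact_UNIV cont_w]
    by (subst (asm) integral_nonneg_eq_0_iff_AE) auto
  then have "AE x in \<mu>. x \<notin> ?W" by eventually_elim auto
  then have "emeasure \<mu> ?W = 0"
    using clW by (subst (asm) AE_iff_measurable[of ?W]) auto
  then have W_null: "AE x in \<mu>. (g ^^ k) x \<notin> ?W" for k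
    using emeasure_funpow_vimage_invariant[OF \<mu> cont_g, of ?W k] clW
      continuous_closed_vimage[OF clW, of "g ^^ k"] continuous_on_funpow[OF cont_g, of k]
    by (subst AE_iff_measurable[of "(g ^^ k) -` ?W"])
      (auto simp: continuous_on_eq_continuous_at vimage_def)
  have W: "AE x in \<mu>. \<forall>k. (g ^^ k) x \<notin> ?W"
    using W_null by (simp only: AE_all_countable) blast
  let ?R = "\<lambda>e. {x. e \<le> infdist x (h ` \<O>)}"
  have clR: "closed (?R e)" for e by (intro closed_Collect_le continuous_intros)
  have "emeasure \<mu> (?R e) = 0" if "e > 0" for e
  proof -
    have "(\<lambda>m. K * \<Lambda> powr (- real m) * (4 * r)) \<longlonglongrightarrow> K * 0 * (4 * r)"
    proof (intro tendsto_intros)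
      have "(\<lambda>m. (1 / \<Lambda>) ^ m) \<longlonglongrightarrow> 0" using \<Lambda> by (intro LIMSEQ_power_zero) simp
      moreover have "\<Lambda> powr (- real m) = (1 / \<Lambda>) ^ m" for m
        using \<Lambda> by (simp add: powr_minus_divide powr_realpow power_one_over)
      ultimately show "(\<lambda>m. \<Lambda> powr (- real m)) \<longlonglongrightarrow> 0" by simp
    qed
    then have "\<forall>\<^sub>F m in sequentially. K * \<Lambda> powr (- real m) * (4 * r) < e"
      using that by (intro order_tendstoD(2)) auto
    then obtain m where m: "K * \<Lambda> powr (- real m) * (4 * r) < e"
      by (meson eventually_sequentially order_refl)
    \<comment> \<open>At the middle time \<open>m\<close> of a run of length \<open>2 * m\<close>
      hyperbolicity makes the distance to the cycle less than \<open>e\<close>; the distances at the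
      two ends add up to at most \<open>4 * r\<close>. Invariance of \<open>\<mu>\<close> then moves
      the estimate from time \<open>m\<close> to time 0.\<close>
    have "AE x in \<mu>. x \<notin> (g ^^ m) -` ?R e"
      using W AE_nonwandering[OF \<mu> cont_g compact_UNIV nonwandering_nonempty]
    proof eventually_elim
      fix x assume x: "\<forall>k. (g ^^ k) x \<notin> ?W" "x \<in> nonwandering g"
      obtain y where y: "y \<in> \<O>" "\<And>k. k \<le> 2 * m \<Longrightarrow> dist ((g ^^ k) x) ((g ^^ k) (h y)) < 2 * r"
        using shadowed[of "2 * m" x] x(1) by (auto simp: not_le)
      have "h y \<in> nonwandering g" using image_orbit(5) y(1) by auto
      then have "dist ((g ^^ m) x) ((g ^^ m) (h y)) \<le> K * \<Lambda> powr (- real m) *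
          (dist x (h y) + dist ((g ^^ (2 * m)) x) ((g ^^ (2 * m)) (h y)))"
        using hyperbolic[of x "h y" "2 * m" m] x(2) y(2) by (simp add: min_def)
      also have "\<dots> \<le> K * \<Lambda> powr (- real m) * (4 * r)"
        using K y(2)[of 0] y(2)[of "2 * m"] by (intro mult_left_mono) auto
      finally have "dist ((g ^^ m) x) (h ((f ^^ m) y)) < e" using m funpow_h[OF y(1)] by simp
      then show "x \<notin> (g ^^ m) -` ?R e"
        using infdist_le[of "h ((f ^^ m) y)" "h ` \<O>" "(g ^^ m) x"] funpow_f_in[OF y(1), of m]
        by auto
    qed
    then have "emeasure \<mu> ((g ^^ m) -` ?R e) = 0"
      using continuous_closed_vimage[OF clR, of "g ^^ m" e] continuous_on_funpow[OF cont_g, of m]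
      by (subst (asm) AE_iff_measurable[of "(g ^^ m) -` ?R e"])
        (auto simp: continuous_on_eq_continuous_at vimage_def)
    then show ?thesis
      using emeasure_funpow_vimage_invariant[OF \<mu> cont_g, of "?R e" m] clR[of e] by simp
  qed
  then have "AE x in \<mu>. x \<notin> ?R (1 / real (Suc n))" for n
    using clR[of "1 / real (Suc n)"] by (subst AE_iff_measurable[of "?R (1 / real (Suc n))"]) auto
  then have "AE x in \<mu>. \<forall>n. x \<notin> ?R (1 / real (Suc n))"
    by (simp only: AE_all_countable) blast
  then show "AE x in \<mu>. x \<in> h ` \<O>"
  proof eventually_elim
    fix x assume x: "\<forall>n. x \<notin> ?R (1 / real (Suc n))"
    have "infdist x (h ` \<O>) = 0"
    proof (rule ccontr)
      assume "infdist x (h ` \<O>) \<noteq> 0"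
      then have "infdist x (h ` \<O>) > 0" using infdist_nonneg[of x "h ` \<O>"] by linarith
      then obtain n where "inverse (real (Suc n)) < infdist x (h ` \<O>)"
        using reals_Archimedean by blast
      then show False using x by (auto simp: inverse_eq_divide dest: less_imp_le)
    qed
    then show "x \<in> h ` \<O>"
      using in_closed_iff_infdist_zero[OF finite_imp_closed[OF image_orbit(1)] image_orbit(2)] by blast
  qed
qed

section \<open>Gain of a potential over its mean on the perturbed cycle\<close>

context
  fixes \<phi> u :: "'m \<Rightarrow> real" and D L Q Qg :: real
  assumes \<phi>: "\<And>x y. \<bar>\<phi> x - \<phi> y\<bar> \<le> D * dist x y"
    and u: "\<And>x y. x \<in> nonwandering f \<Longrightarrow> y \<in> nonwandering f \<Longrightarrow> \<bar>u x - u y\<bar> \<le> L * D * dist x y"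
    and cohom: "\<And>x. x \<in> nonwandering f \<Longrightarrow> \<phi> x + u x - u (f x) \<le> Q"
    and Q: "Q = (\<Sum>y\<in>\<O>. \<phi> y) / card \<O>"
    and Qg: "Qg = (\<Sum>y\<in>\<O>. \<phi> (h y)) / card \<O>"
    and DL: "0 \<le> D" "0 \<le> L"
begin

text \<open>The transfer function for \<open>g\<close>. Since \<open>i\<close> need not be
  continuous, \<open>U\<close> is used only through pointwise estimates.\<close>

definition U where "U x = u (i x)"

definition excess where "excess x = \<phi> x - Qg"

lemma \<phi>_le: "dist x y \<le> e \<Longrightarrow> \<phi> x \<le> \<phi> y + D * e"
  using \<phi>[of x y] mult_left_mono[of "dist x y" e D] DL by linarith

lemma Q_le: "Q \<le> Qg + D * \<rho>"
proof -
  have c: "card \<O> > 0" using O by (simp add: card_gt_0_iff)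
  have "(\<Sum>y\<in>\<O>. \<phi> y) \<le> (\<Sum>y\<in>\<O>. \<phi> (h y) + D * \<rho>)"
    using dist_h O(4) by (intro sum_mono \<phi>_le) (auto simp: dist_commute)
  also have "\<dots> = (\<Sum>y\<in>\<O>. \<phi> (h y)) + card \<O> * (D * \<rho>)" by (simp add: sum.distrib)
  finally have "Q \<le> ((\<Sum>y\<in>\<O>. \<phi> (h y)) + card \<O> * (D * \<rho>)) / card \<O>"
    unfolding Q by (intro divide_right_mono) auto
  then show ?thesis unfolding Qg using c by (simp add: add_divide_distrib)
qed

text \<open>One \<open>D * \<rho>\<close> comes from comparing \<open>\<phi>\<close> at
  \<open>x\<close> and at \<open>i x\<close>, the other from replacing \<open>Q\<close> by
  \<open>Qg\<close>.\<close>

lemma excess_le: "x \<in> nonwandering g \<Longrightarrow> excess x \<le> U (g x) - U x + 2 * D * \<rho>"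
  using \<phi>_le[of x "i x" \<rho>] dist_i[of x] cohom[of "i x"] in_nonwandering(3)[of x] i_step[of x] Q_le
  unfolding U_def excess_def by (simp add: dist_commute)

lemma birkhoff_excess_le:
  "x \<in> nonwandering g \<Longrightarrow>
    birkhoff_sum g excess x n \<le> U ((g ^^ n) x) - U x + n * (2 * D * \<rho>)"
  using birkhoff_sum_le_coboundary[of "nonwandering g" g excess U] excess_le in_nonwandering(1)[of _ 1]
  by simp

text \<open>On the perturbed cycle the excess has mean zero, so complete periods cancel exactly and
  only the fewer than \<open>P\<close> remaining steps cost anything. This makes the error
  independent of \<open>n\<close>, unlike in the estimate for general orbits.\<close>

lemma birkhoff_excess_orbit_le:
  "y \<in> \<O> \<Longrightarrow> birkhoff_sum g excess (h y) n \<le> u ((f ^^ n) y) - u y + P * (2 * D * \<rho>)"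
proof (induction n rule: less_induct)
  case (less n)
  have eq: "birkhoff_sum g excess (h y) n = birkhoff_sum f (excess \<circ> h) y n" for n
    unfolding birkhoff_sum_def using funpow_h[OF less.prems] by simp
  have step: "(excess \<circ> h) z \<le> u (f z) - u z + 2 * D * \<rho>" if "z \<in> \<O>" for z
    using \<phi>_le[of "h z" z \<rho>] dist_h[of z] cohom[of z] Q_le O(4) that
    unfolding excess_def by (force simp: dist_commute)
  show ?case
  proof (cases "n < P")
    case True
    have "birkhoff_sum f (excess \<circ> h) y n \<le> u ((f ^^ n) y) - u y + n * (2 * D * \<rho>)"
      using birkhoff_sum_le_coboundary[of \<O> f "excess \<circ> h" u] step O(3) less.prems by blast
    moreover have "n * (2 * D * \<rho>) \<le> P * (2 * D * \<rho>)"
      using True DL \<rho>_nonneg by (intro mult_right_mono) auto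
    ultimately show ?thesis unfolding eq by linarith
  next
    case False
    have "(\<Sum>y\<in>\<O>. (excess \<circ> h) y) = 0"
      using O(1,2) by (simp add: excess_def sum_subtractf) (simp add: Qg)
    then have "birkhoff_sum f (excess \<circ> h) y P = 0"
      using birkhoff_sum_eq_average_on_cycle[OF O(1,3,5) period(1) less.prems, of "excess \<circ> h"]
      by simp
    then have "birkhoff_sum f (excess \<circ> h) y (P + (n - P)) = birkhoff_sum f (excess \<circ> h) y (n - P)"
      using period(1)[OF less.prems] by (subst birkhoff_sum_add) simp
    moreover have "(f ^^ n) y = (f ^^ (n - P)) y"
      using period(1)[OF less.prems] False
      by (metis comp_apply funpow_add le_add_diff_inverse2 not_less)
    ultimately show ?thesis
      using less.IH[of "n - P"] less.prems False period(2) unfolding eq by auto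
  qed
qed

text \<open>Allows switching between the transfer functions of an orbit and of the cycle point that
  it follows. The three distances are the displacement of \<open>i\<close>, the distance to the
  perturbed cycle, and the displacement of \<open>h\<close>.\<close>

lemma U_near_u:
  assumes "x \<in> nonwandering g" "y \<in> \<O>" "dist x (h y) \<le> \<rho>"
  shows "\<bar>U x - u y\<bar> \<le> L * D * (3 * \<rho>)"
proof -
  have "dist (i x) y \<le> dist (i x) x + (dist x (h y) + dist (h y) y)"
    using dist_triangle[of "i x" y x] dist_triangle[of x y "h y"] by linarith
  also have "\<dots> \<le> 3 * \<rho>" using dist_i[of x] dist_h[of y] assms O(4) by force
  finally have "L * D * dist (i x) y \<le> L * D * (3 * \<rho>)"
    using DL by (intro mult_left_mono) auto
  moreover have "\<bar>U x - u y\<bar> \<le> L * D * dist (i x) y"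
    unfolding U_def using u[of "i x" y] in_nonwandering(3)[OF assms(1)] assms(2) O(4) by auto
  ultimately show ?thesis by linarith
qed

context
  fixes T :: nat and E :: real
  assumes T: "K * \<Lambda> powr (- real T) * (4 * r) \<le> \<rho>"
    and E: "E = D * \<rho> * (4 * T + 2 + 2 * P + 2 * (\<Lambda> / (\<Lambda> - 1)) + 6 * L)"
begin

lemma E_ge: "2 * T * (2 * D * \<rho>) \<le> E" "0 \<le> E"
proof -
  have "0 \<le> \<Lambda> / (\<Lambda> - 1)" using \<Lambda> by simp
  then have "D * \<rho> * (4 * T) \<le> E"
    unfolding E using DL \<rho>_nonneg by (intro mult_left_mono) auto
  then show "2 * T * (2 * D * \<rho>) \<le> E" by (simp add: algebra_simps)
  moreover have "0 \<le> 2 * T * (2 * D * \<rho>)" using DL \<rho>_nonneg by simp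
  ultimately show "0 \<le> E" by linarith
qed

text \<open>In the first and the last \<open>T\<close> steps of a shadowing run \<open>\<phi>\<close> is compared with its values
  along \<open>i x\<close>, which costs \<open>\<rho>\<close> per step, and in the middle with its values along the cycle.\<close>

lemma birkhoff_excess_run_le:
  assumes x: "x \<in> nonwandering g" and small: "\<And>m. m < k \<Longrightarrow> w ((g ^^ m) x) < 1"
  shows "birkhoff_sum g excess x k \<le> U ((g ^^ k) x) - U x + E"
proof (cases "k \<le> 2 * T")
  case True
  then have "k * (2 * D * \<rho>) \<le> 2 * T * (2 * D * \<rho>)"
    using DL \<rho>_nonneg by (intro mult_right_mono) auto
  then show ?thesis using birkhoff_excess_le[OF x, of k] E_ge by linarith
next
  case False
  \<comment> \<open>Smallness of \<open>w\<close> is known only at times below \<open>k\<close>, so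
    shadowing reaches just to \<open>n = k - 1\<close>. The steps are cut into \<open>T\<close>
    initial, \<open>l\<close> middle and \<open>Suc T\<close> final ones.\<close>
  define l where "l = k - 1 - 2 * T"
  have k: "k = T + (l + Suc T)" using False by (simp add: l_def)
  define n where "n = T + l + T"
  obtain y where y: "y \<in> \<O>" "\<And>m. m \<le> n \<Longrightarrow> dist ((g ^^ m) x) ((g ^^ m) (h y)) < 2 * r"
    using shadowed[of n x] small unfolding k n_def by auto
  define x1 y1 where "x1 = (g ^^ T) x" and "y1 = (f ^^ T) y"
  have y1: "y1 \<in> \<O>" using funpow_f_in[OF y(1)] by (simp add: y1_def)
  have x1: "x1 \<in> nonwandering g" using in_nonwandering(1)[OF x] by (simp add: x1_def)
  have close: "dist ((g ^^ m) x1) ((g ^^ m) (h y1)) \<le> \<rho> * \<Lambda> powr (- real (min m (l - m)))"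
    if "m \<le> l" for m
  proof -
    have hy: "h y \<in> nonwandering g" using image_orbit(5) y(1) by auto
    \<comment> \<open>A middle time is at least \<open>T\<close> away from both ends of the
      shadowing interval; this provides the factor \<open>\<Lambda> powr (- real T)\<close> that
      turns \<open>4 * r\<close> into \<open>\<rho>\<close>.\<close>
    have min: "min (T + m) (n - (T + m)) = T + min m (l - m)" using that by (auto simp: n_def min_def)
    have shift: "(g ^^ (T + m)) z = (g ^^ m) ((g ^^ T) z)" for z
      by (metis add.commute comp_apply funpow_add)
    have "dist ((g ^^ (T + m)) x) ((g ^^ (T + m)) (h y))
      \<le> K * \<Lambda> powr (- real (T + min m (l - m))) * (dist x (h y) + dist ((g ^^ n) x) ((g ^^ n) (h y)))"
      using hyperbolic[of x "h y" n "T + m"] x hy y(2) that unfolding min by (simp add: n_def)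
    also have "\<dots> \<le> K * \<Lambda> powr (- real (T + min m (l - m))) * (4 * r)"
      using K y(2)[of 0] y(2)[of n] by (intro mult_left_mono) auto
    also have "\<dots> = (K * \<Lambda> powr (- real T) * (4 * r)) * \<Lambda> powr (- real (min m (l - m)))"
      by (simp add: powr_add[symmetric] algebra_simps)
    also have "\<dots> \<le> \<rho> * \<Lambda> powr (- real (min m (l - m)))"
      using T by (intro mult_right_mono) auto
    finally show ?thesis by (simp add: shift x1_def y1_def flip: funpow_h[OF y(1)])
  qed
  have "birkhoff_sum g excess x1 l \<le>
      birkhoff_sum g excess (h y1) l + D * \<rho> * (\<Sum>m<l. \<Lambda> powr (- real (min m (l - m))))"
  proof -
    have "birkhoff_sum g excess x1 l \<le>
        (\<Sum>m<l. excess ((g ^^ m) (h y1)) + D * (\<rho> * \<Lambda> powr (- real (min m (l - m)))))"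
      unfolding birkhoff_sum_def
    proof (rule sum_mono)
      fix m assume "m \<in> {..<l}"
      then show "excess ((g ^^ m) x1) \<le>
          excess ((g ^^ m) (h y1)) + D * (\<rho> * \<Lambda> powr (- real (min m (l - m))))"
        using \<phi>_le[OF close[of m]] by (simp add: excess_def)
    qed
    then show ?thesis
      by (simp add: birkhoff_sum_def sum.distrib sum_distrib_left mult.assoc)
  qed
  moreover have "D * \<rho> * (\<Sum>m<l. \<Lambda> powr (- real (min m (l - m)))) \<le> D * \<rho> * (2 * (\<Lambda> / (\<Lambda> - 1)))"
    using sum_geometric_two_sided_le[OF \<Lambda>] DL \<rho>_nonneg by (intro mult_left_mono) auto
  moreover have "birkhoff_sum g excess (h y1) l \<le> u ((f ^^ l) y1) - u y1 + P * (2 * D * \<rho>)"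
    by (rule birkhoff_excess_orbit_le[OF y1])
  \<comment> \<open>The middle block telescopes in \<open>u\<close> along the cycle, the outer
    blocks in \<open>U\<close> along the orbit; each of the two junctions costs
    \<open>L * D * (3 * \<rho>)\<close>.\<close>
  moreover have "\<bar>U x1 - u y1\<bar> \<le> L * D * (3 * \<rho>)"
    using U_near_u[OF x1 y1] close[of 0] \<Lambda> by simp
  moreover have "\<bar>U ((g ^^ l) x1) - u ((f ^^ l) y1)\<bar> \<le> L * D * (3 * \<rho>)"
    using U_near_u[OF in_nonwandering(1)[OF x1, of l] funpow_f_in[OF y1, of l]] close[of l]
      funpow_h[OF y1, of l] \<Lambda> by simp
  moreover have "birkhoff_sum g excess x T \<le> U x1 - U x + T * (2 * D * \<rho>)"
    using birkhoff_excess_le[OF x, of T] by (simp add: x1_def)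
  moreover have "birkhoff_sum g excess ((g ^^ l) x1) (Suc T) \<le>
      U ((g ^^ Suc T) ((g ^^ l) x1)) - U ((g ^^ l) x1) + Suc T * (2 * D * \<rho>)"
    by (rule birkhoff_excess_le[OF in_nonwandering(1)[OF x1]])
  moreover have "U ((g ^^ k) x) = U ((g ^^ Suc T) ((g ^^ l) x1))"
  proof -
    have "k = Suc T + (l + T)" using k by simp
    then show ?thesis by (simp only: x1_def funpow_add comp_apply)
  qed
  moreover have "birkhoff_sum g excess x k = birkhoff_sum g excess x T +
      (birkhoff_sum g excess x1 l + birkhoff_sum g excess ((g ^^ l) x1) (Suc T))"
    unfolding k birkhoff_sum_add x1_def by simp
  \<comment> \<open>The summands are the initial block, the final block with its extra step, the
    incomplete period on the cycle, the geometric sums and the two junctions.\<close>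
  moreover have "E = T * (2 * D * \<rho>) + Suc T * (2 * D * \<rho>) + P * (2 * D * \<rho>)
      + D * \<rho> * (2 * (\<Lambda> / (\<Lambda> - 1))) + 2 * (L * D * (3 * \<rho>))"
    unfolding E by (simp add: algebra_simps)
  ultimately show ?thesis by linarith
qed

text \<open>The orbit is cut at the first time with \<open>w \<ge> 1\<close>. The loss of at least
  \<open>c\<close> in that step pays for its own \<open>2 * D * \<rho>\<close> and for the gain
  \<open>E\<close> of the run before it, so that a single \<open>E\<close> remains however many runs
  there are.\<close>

lemma birkhoff_penalized_le:
  assumes "E + 2 * D * \<rho> \<le> c"
  shows "x \<in> nonwandering g \<Longrightarrow>
    birkhoff_sum g (\<lambda>x. excess x - c * w x) x N \<le> U ((g ^^ N) x) - U x + E"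
proof (induction N arbitrary: x rule: less_induct)
  case (less N)
  let ?F = "\<lambda>x. excess x - c * w x"
  have c: "0 \<le> c" using assms E_ge DL \<rho>_nonneg by (smt (verit) mult_nonneg_nonneg)
  have le: "birkhoff_sum g ?F x n \<le> birkhoff_sum g excess x n" for n
    unfolding birkhoff_sum_def using c w_nonneg by (intro sum_mono) auto
  show ?case
  proof (cases "\<forall>m<N. w ((g ^^ m) x) < 1")
    case True
    then show ?thesis using birkhoff_excess_run_le[OF less.prems, of N] le[of N] by force
  next
    case False
    define k where "k = (LEAST m. m < N \<and> \<not> w ((g ^^ m) x) < 1)"
    have k: "k < N" "w ((g ^^ k) x) \<ge> 1"
      using LeastI_ex[of "\<lambda>m. m < N \<and> \<not> w ((g ^^ m) x) < 1"] False unfolding k_def by auto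
    have before: "w ((g ^^ m) x) < 1" if "m < k" for m
      using not_less_Least[of m "\<lambda>m. m < N \<and> \<not> w ((g ^^ m) x) < 1"] that k(1) unfolding k_def by auto
    let ?x = "(g ^^ k) x"
    have x: "?x \<in> nonwandering g" "g ?x \<in> nonwandering g"
      using in_nonwandering(1)[OF less.prems, of k] in_nonwandering(1)[OF less.prems, of "Suc k"] by auto
    define l where "l = N - Suc k"
    have N: "N = k + (Suc 0 + l)" using k(1) by (simp add: l_def)
    have "birkhoff_sum g ?F x N = birkhoff_sum g ?F x k + (?F ?x + birkhoff_sum g ?F (g ?x) l)"
      unfolding N birkhoff_sum_add by simp
    moreover have "birkhoff_sum g ?F x k \<le> U ?x - U x + E"
      using birkhoff_excess_run_le[OF less.prems before] le[of k] by force
    moreover have "?F ?x \<le> U (g ?x) - U ?x + 2 * D * \<rho> - c"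
      using excess_le[OF x(1)] mult_left_mono[OF k(2) c] by simp
    moreover have "birkhoff_sum g ?F (g ?x) l \<le> U ((g ^^ l) (g ?x)) - U (g ?x) + E"
      using less.IH[OF _ x(2)] k(1) by (simp add: l_def)
    moreover have "U ((g ^^ N) x) = U ((g ^^ l) (g ?x))"
      unfolding N by (simp add: funpow_add funpow_swap1 add.commute[of k])
    ultimately show ?thesis using assms by linarith
  qed
qed

text \<open>The space is bounded and \<open>u\<close> is Lipschitz, so \<open>U\<close> has bounded
  oscillation and the penalized Birkhoff sums are bounded uniformly in their length.\<close>

lemma integral_penalized_le:
  assumes c: "E + 2 * D * \<rho> \<le> c" and \<mu>: "\<mu> \<in> invariant_measures g"
  shows "(\<integral>x. \<phi> x \<partial>\<mu>) - c * (\<integral>x. w x \<partial>\<mu>) \<le> Qg"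
proof -
  interpret prob_space \<mu> using invariant_measuresD[OF \<mu>] by simp
  have cont_\<phi>: "continuous_on UNIV \<phi>"
    using \<phi> DL by (intro lipschitz_on_continuous_on[of D] lipschitz_onI) (auto simp: dist_real_def)
  obtain e where e: "\<And>x y::'m. dist x y \<le> e"
    using compact_imp_bounded[OF compact_UNIV] bounded_two_points by (metis UNIV_I)
  have "birkhoff_sum g (\<lambda>x. excess x - c * w x) x n \<le> L * D * e + E" if "x \<in> nonwandering g" for x n
  proof -
    have "U ((g ^^ n) x) - U x \<le> L * D * dist (i ((g ^^ n) x)) (i x)"
      unfolding U_def using u in_nonwandering that by (smt (verit))
    also have "\<dots> \<le> L * D * e" using e DL by (intro mult_left_mono) auto
    finally show ?thesis using birkhoff_penalized_le[OF c that, of n] by linarith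
  qed
  then have "(\<integral>x. excess x - c * w x \<partial>\<mu>) \<le> 0"
    unfolding birkhoff_sum_def
    by (intro integral_nonpos_if_sums_bounded[OF \<mu> cont_g _ compact_UNIV nonwandering_nonempty])
      (auto simp: excess_def intro!: continuous_intros cont_w cont_\<phi>)
  then show ?thesis
    using integrable_continuous_invariant[OF \<mu> compact_UNIV cont_w]
      integrable_continuous_invariant[OF \<mu> compact_UNIV cont_\<phi>]
    by (simp add: excess_def prob_space)
qed

end
end
end

section \<open>Size of the penalty and uniqueness of the maximizing measure\<close>

lemma continuous_if_lipschitz:
  fixes \<phi> :: "'m::metric_space \<Rightarrow> real"
  assumes "\<And>x y. \<bar>\<phi> x - \<phi> y\<bar> \<le> D * dist x y" "0 \<le> D"
  shows "continuous_on UNIV \<phi>"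
  using assms by (intro lipschitz_on_continuous_on[of D] lipschitz_onI) (auto simp: dist_real_def)

text \<open>Multiplied by \<open>D * sqrt \<rho>\<close> this dominates
  \<open>E + 2 * D * \<rho>\<close> when \<open>T\<close> is at most
  \<open>sqrt (8 * K * r) / ln \<Lambda> / sqrt \<rho> + 1\<close> and
  \<open>\<rho> \<le> 1\<close>. The 8 collects 4 from rounding \<open>T\<close>, 2 from the extra
  step of a run and 2 from the exit step.\<close>

definition penalty :: "real \<Rightarrow> real \<Rightarrow> real \<Rightarrow> nat \<Rightarrow> real \<Rightarrow> real" where
  "penalty K r \<Lambda> P L = 4 * (sqrt (8 * K * r) / ln \<Lambda>) + 8 + 2 * real P + 2 * (\<Lambda> / (\<Lambda> - 1)) + 6 * L"

lemma penalty_pos: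
  assumes "0 < K" "0 < r" "1 < \<Lambda>" "0 \<le> L"
  shows "0 < penalty K r \<Lambda> P L"
proof -
  have "0 \<le> sqrt (8 * K * r) / ln \<Lambda>" "0 \<le> \<Lambda> / (\<Lambda> - 1)" using assms by auto
  then show ?thesis using assms(4) by (simp add: penalty_def)
qed

text \<open>With \<open>T\<close> of order \<open>\<rho> powr (-1/2)\<close> the exponential \<open>\<Lambda> powr T\<close> exceeds its quadratic Taylor term,
  which is of order \<open>1 / \<rho>\<close>; this crude choice is where the square root of the distance comes from.\<close>

lemma exists_transient_length:
  fixes K r \<Lambda> \<rho> :: real
  assumes K: "0 < K" and r: "0 < r" and \<Lambda>: "1 < \<Lambda>" and \<rho>: "0 < \<rho>"
  obtains T :: nat where "K * \<Lambda> powr (- real T) * (4 * r) \<le> \<rho>"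
    "real T \<le> sqrt (8 * K * r) / ln \<Lambda> / sqrt \<rho> + 1"
proof -
  \<comment> \<open>Chosen so that half the square of \<open>b / sqrt \<rho> * ln \<Lambda>\<close>
    is \<open>4 * K * r / \<rho>\<close>, the size that \<open>\<Lambda> powr T\<close> has to
    reach.\<close>
  define b where "b = sqrt (8 * K * r) / ln \<Lambda>"
  have ln: "0 < ln \<Lambda>" using \<Lambda> by simp
  have b: "0 \<le> b" "(b * ln \<Lambda>)\<^sup>2 = 8 * K * r" using K r ln by (simp_all add: b_def)
  define T where "T = nat \<lceil>b / sqrt \<rho>\<rceil>"
  have T: "b / sqrt \<rho> \<le> T" "T \<le> b / sqrt \<rho> + 1"
    using b \<rho> by (simp_all add: T_def)
  have "8 * K * r / \<rho> = (b / sqrt \<rho> * ln \<Lambda>)\<^sup>2"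
    using b(2) \<rho> by (simp add: power_divide power_mult_distrib)
  also have "\<dots> \<le> (T * ln \<Lambda>)\<^sup>2"
    using T(1) b(1) \<rho> ln by (intro power_mono mult_right_mono) auto
  also have "\<dots> \<le> 2 * exp (T * ln \<Lambda>)"
  proof -
    have "0 \<le> T * ln \<Lambda>" using ln by simp
    from exp_lower_Taylor_quadratic[OF this] this show ?thesis by simp
  qed
  also have "exp (T * ln \<Lambda>) = \<Lambda> powr T" using \<Lambda> by (simp add: powr_def)
  finally have "4 * K * r \<le> \<rho> * \<Lambda> powr T" using \<rho> by (simp add: field_simps)
  then have "K * \<Lambda> powr (- real T) * (4 * r) \<le> \<rho>"
    using \<Lambda> by (simp add: powr_minus_divide field_simps)
  then show thesis using that[of T] T(2) by (simp add: b_def)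
qed

context perturbed_orbit
begin

lemma orbit_measure_g: "orbit_measure (h ` \<O>) \<in> invariant_measures g"
  by (rule orbit_measure_invariant[OF image_orbit(1-3) cont_g])

lemma integral_orbit_measure_g:
  "continuous_on UNIV a \<Longrightarrow> (\<integral>x. a x \<partial>orbit_measure (h ` \<O>)) = (\<Sum>y\<in>\<O>. a (h y)) / card \<O>"
  by (simp add: integral_orbit_measure[OF image_orbit(1,2)] sum.reindex[OF inj_on_h]
      card_image[OF inj_on_h])

lemma integral_w_orbit: "(\<integral>x. w x \<partial>orbit_measure (h ` \<O>)) = 0"
  by (simp add: integral_orbit_measure_g[OF cont_w] w_orbit)

lemma integral_w_nonneg: "0 \<le> (\<integral>x. w x \<partial>\<mu>)"
  using w_nonneg by (intro Bochner_Integration.integral_nonneg)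

context
  fixes L :: real
  assumes \<rho>: "0 < \<rho>" "\<rho> \<le> 1" and L: "0 \<le> L"
    and subaction: "\<And>\<phi> D. 0 \<le> D \<Longrightarrow> (\<And>x y. \<bar>\<phi> x - \<phi> y\<bar> \<le> D * dist x y) \<Longrightarrow>
      \<exists>u. (\<forall>x\<in>nonwandering f. \<forall>y\<in>nonwandering f. \<bar>u x - u y\<bar> \<le> L * D * dist x y) \<and>
        (\<forall>x\<in>nonwandering f. \<phi> x + u x - u (f x) \<le> max_integral f \<phi>)"
begin

text \<open>Maximality of the orbit measure for \<open>f\<close> enters here: it identifies the
  constant in the subaction inequality with the mean of \<open>\<phi>\<close> over the
  cycle.\<close>

lemma integral_le_orbit:
  assumes D: "0 \<le> D" "\<And>x y. \<bar>\<phi> x - \<phi> y\<bar> \<le> D * dist x y"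
    and max: "orbit_measure \<O> \<in> maximizing_measures f \<phi>" and \<mu>: "\<mu> \<in> invariant_measures g"
  shows "(\<integral>x. \<phi> x \<partial>\<mu>) - penalty K r \<Lambda> P L * D * sqrt \<rho> * (\<integral>x. w x \<partial>\<mu>)
    \<le> (\<integral>x. \<phi> x \<partial>orbit_measure (h ` \<O>))"
proof -
  have cont: "continuous_on UNIV \<phi>" using D by (rule continuous_if_lipschitz[rotated])
  obtain u where u: "\<And>x y. x \<in> nonwandering f \<Longrightarrow> y \<in> nonwandering f \<Longrightarrow> \<bar>u x - u y\<bar> \<le> L * D * dist x y"
    "\<And>x. x \<in> nonwandering f \<Longrightarrow> \<phi> x + u x - u (f x) \<le> max_integral f \<phi>"
    using subaction[OF D] by blast
  have Q: "max_integral f \<phi> = (\<Sum>y\<in>\<O>. \<phi> y) / card \<O>"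
    using max integral_orbit_measure[OF O(1,2) cont] by (simp add: maximizing_measures_def)
  obtain T where T: "K * \<Lambda> powr (- real T) * (4 * r) \<le> \<rho>"
    "real T \<le> sqrt (8 * K * r) / ln \<Lambda> / sqrt \<rho> + 1"
    using exists_transient_length[OF K radii(2) \<Lambda> \<rho>(1)] by blast
  define X where "X = 4 + 2 * real P + 2 * (\<Lambda> / (\<Lambda> - 1)) + 6 * L"
  have X: "0 \<le> X" using \<Lambda> L by (simp add: X_def)
  define E where "E = D * \<rho> * (4 * T + 2 + 2 * P + 2 * (\<Lambda> / (\<Lambda> - 1)) + 6 * L)"
  have sq: "\<rho> = sqrt \<rho> * sqrt \<rho>" "\<rho> \<le> sqrt \<rho>"
    using \<rho> by (simp_all add: real_le_rsqrt power2_eq_square mult_left_le)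
  \<comment> \<open>The part containing \<open>T\<close> is of order
    \<open>\<rho> / sqrt \<rho> = sqrt \<rho>\<close>; the rest is of order \<open>\<rho>\<close>,
    which is at most \<open>sqrt \<rho>\<close> because \<open>\<rho> \<le> 1\<close>.\<close>
  have "\<rho> * (4 * real T + X) \<le> \<rho> * (4 * (sqrt (8 * K * r) / ln \<Lambda> / sqrt \<rho>) + (4 + X))"
    using T(2) \<rho> by (intro mult_left_mono) auto
  also have "\<dots> = (\<rho> / sqrt \<rho>) * (4 * (sqrt (8 * K * r) / ln \<Lambda>)) + \<rho> * (4 + X)"
    by (simp add: distrib_left)
  also have "\<dots> = sqrt \<rho> * (4 * (sqrt (8 * K * r) / ln \<Lambda>)) + \<rho> * (4 + X)"
    using \<rho>(1) by (simp add: real_div_sqrt)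
  also have "\<dots> \<le> sqrt \<rho> * (4 * (sqrt (8 * K * r) / ln \<Lambda>)) + sqrt \<rho> * (4 + X)"
    using sq(2) X by (intro add_left_mono mult_right_mono) auto
  also have "\<dots> = penalty K r \<Lambda> P L * sqrt \<rho>"
    by (simp add: penalty_def X_def algebra_simps)
  finally have "D * (\<rho> * (4 * real T + X)) \<le> D * (penalty K r \<Lambda> P L * sqrt \<rho>)"
    using D(1) by (rule mult_left_mono)
  moreover have "E + 2 * D * \<rho> = D * (\<rho> * (4 * real T + X))"
    by (simp add: E_def X_def algebra_simps)
  ultimately have "E + 2 * D * \<rho> \<le> penalty K r \<Lambda> P L * D * sqrt \<rho>"
    by (simp add: mult_ac)
  from integral_penalized_le[OF D(2) u Q refl D(1) L T(1) E_def this \<mu>]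
  show ?thesis by (simp add: integral_orbit_measure_g[OF cont])
qed

text \<open>The penalty is twice the \<open>c\<close> of the integral estimate. One half compensates
  the excess and gives maximality; the other half is a surplus that forces the integral of
  \<open>w\<close> to vanish for every maximizing measure, hence uniqueness.\<close>

lemma maximizing_penalized:
  assumes cont_f: "continuous_on UNIV f"
    and w_lipschitz: "0 \<le> D'" "\<And>x y. \<bar>w x - w y\<bar> \<le> D' * dist x y" "penalty K r \<Lambda> P L * D' * sqrt \<rho> < 1"
    and D: "0 \<le> D" "\<And>x y. \<bar>\<phi> x - \<phi> y\<bar> \<le> D * dist x y"
    and max: "maximizing_measures f \<phi> = {orbit_measure \<O>}"
  shows "maximizing_measures g (\<lambda>x. \<phi> x + D * (- 2 * penalty K r \<Lambda> P L * sqrt \<rho> * w x)) =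
    {orbit_measure (h ` \<O>)}"
proof -
  let ?\<kappa> = "penalty K r \<Lambda> P L"
  let ?\<phi> = "\<lambda>x. \<phi> x + D * (- 2 * ?\<kappa> * sqrt \<rho> * w x)"
  define c where "c = ?\<kappa> * D * sqrt \<rho>"
  have \<kappa>: "0 < ?\<kappa>" using penalty_pos K radii(2) \<Lambda> L by blast
  have cont: "continuous_on UNIV \<phi>" using D by (rule continuous_if_lipschitz[rotated])
  have cont': "continuous_on UNIV ?\<phi>" by (intro continuous_intros cont cont_w)
  have c: "0 \<le> c" using \<kappa> D(1) \<rho>(1) by (simp add: c_def)
  have int: "(\<integral>x. ?\<phi> x \<partial>\<mu>) = (\<integral>x. \<phi> x \<partial>\<mu>) - 2 * c * (\<integral>x. w x \<partial>\<mu>)"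
    if "\<mu> \<in> invariant_measures g" for \<mu>
  proof -
    have "(\<integral>x. ?\<phi> x \<partial>\<mu>) = (\<integral>x. \<phi> x - 2 * c * w x \<partial>\<mu>)"
      by (intro Bochner_Integration.integral_cong refl) (simp add: c_def)
    then show ?thesis
      using integrable_continuous_invariant[OF that compact_UNIV cont]
        integrable_continuous_invariant[OF that compact_UNIV cont_w] by simp
  qed
  note int_orbit = int[OF orbit_measure_g, unfolded integral_w_orbit mult_zero_right diff_zero]
  have le: "(\<integral>x. \<phi> x \<partial>\<mu>) - c * (\<integral>x. w x \<partial>\<mu>) \<le> (\<integral>x. \<phi> x \<partial>orbit_measure (h ` \<O>))"
    if "\<mu> \<in> invariant_measures g" for \<mu>
    using integral_le_orbit[OF D _ that] max unfolding c_def by simp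
  have "\<mu> = orbit_measure (h ` \<O>)" if \<mu>: "\<mu> \<in> maximizing_measures g ?\<phi>" for \<mu>
  proof (rule unique_measure_near_orbit)
    show inv: "\<mu> \<in> invariant_measures g" using \<mu> by (simp add: maximizing_measures_def)
    show "(\<integral>x. w x \<partial>\<mu>) = 0"
    proof (cases "D = 0")
      case True
      text \<open>Then \<open>f\<close> is uniquely ergodic, so that the estimate applies to \<open>w\<close> itself.\<close>
      have const: "\<phi> x = \<phi> undefined" for x using D(2)[of x undefined] True by simp
      have "invariant_measures f \<subseteq> maximizing_measures f \<phi>"
      proof
        fix \<nu> assume \<nu>: "\<nu> \<in> invariant_measures f"
        have "(\<integral>x. \<phi> x \<partial>\<nu>') = \<phi> undefined" if "\<nu>' \<in> invariant_measures f" for \<nu>'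
        proof -
          interpret prob_space \<nu>' using invariant_measuresD[OF that] by simp
          show ?thesis by (subst const) (simp add: prob_space)
        qed
        then show "\<nu> \<in> maximizing_measures f \<phi>"
          using \<nu> by (simp add: maximizing_measures_iff[OF compact_UNIV cont])
      qed
      then have inv_f: "invariant_measures f \<subseteq> {orbit_measure \<O>}" using max by simp
      have "orbit_measure \<O> \<in> invariant_measures f"
        by (rule orbit_measure_invariant[OF O(1-3) cont_f])
      then have "orbit_measure \<O> \<in> maximizing_measures f w"
        using inv_f by (auto simp: maximizing_measures_iff[OF compact_UNIV cont_w])
      \<comment> \<open>With \<open>w\<close> in place of \<open>\<phi>\<close> the right-hand side
        is 0, and the smallness assumption leaves a positive factor in front of the integral of
        \<open>w\<close>.\<close>
      from integral_le_orbit[OF w_lipschitz(1,2) this inv]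
      have "(1 - ?\<kappa> * D' * sqrt \<rho>) * (\<integral>x. w x \<partial>\<mu>) \<le> 0"
        by (simp add: integral_w_orbit algebra_simps)
      then have "(\<integral>x. w x \<partial>\<mu>) \<le> 0" using w_lipschitz(3) by (simp add: mult_le_0_iff)
      then show ?thesis using integral_w_nonneg[of \<mu>] by simp
    next
      case False
      then have "0 < c" using D(1) \<kappa> \<rho>(1) by (simp add: c_def)
      have "(\<integral>x. ?\<phi> x \<partial>orbit_measure (h ` \<O>)) \<le> (\<integral>x. ?\<phi> x \<partial>\<mu>)"
        using \<mu> orbit_measure_g unfolding maximizing_measures_iff[OF compact_UNIV cont'] by blast
      then have "c * (\<integral>x. w x \<partial>\<mu>) \<le> 0" using le[OF inv] int[OF inv] int_orbit by linarith
      then have "(\<integral>x. w x \<partial>\<mu>) \<le> 0" using \<open>0 < c\<close> by (simp add: mult_le_0_iff)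
      then show ?thesis using integral_w_nonneg[of \<mu>] by simp
    qed
  qed
  moreover have "orbit_measure (h ` \<O>) \<in> maximizing_measures g ?\<phi>"
    unfolding maximizing_measures_iff[OF compact_UNIV cont']
  proof (intro conjI ballI orbit_measure_g)
    fix \<mu> assume \<mu>: "\<mu> \<in> invariant_measures g"
    have "0 \<le> c * (\<integral>x. w x \<partial>\<mu>)" using c integral_w_nonneg by simp
    then show "(\<integral>x. ?\<phi> x \<partial>\<mu>) \<le> (\<integral>x. ?\<phi> x \<partial>orbit_measure (h ` \<O>))"
      using le[OF \<mu>] int[OF \<mu>] int_orbit by linarith
  qed
  ultimately show ?thesis by blast
qed

end

lemma orbit_maximizing_nonpos_multiple:
  assumes "0 \<le> c"
  shows "orbit_measure (h ` \<O>) \<in> maximizing_measures g (\<lambda>x. - c * w x)"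
proof -
  have "continuous_on UNIV (\<lambda>x. - c * w x)" by (intro continuous_intros cont_w)
  then show ?thesis
    using orbit_measure_g integral_w_orbit integral_w_nonneg assms
    by (auto simp: maximizing_measures_iff[OF compact_UNIV])
qed

end

section \<open>Intertwining maps and subactions\<close>

text \<open>Exponent 1 turns the condition into one on Lipschitz constants. The seminorms are real
  suprema, so the one of \<open>u\<close> controls its difference quotients only after these are
  known to be bounded.\<close>

lemma lipschitz_subaction:
  assumes ml: "cond_ML f" and ne: "nonwandering f \<noteq> {}"
  shows "\<exists>L>0. \<forall>\<phi> D. 0 \<le> D \<longrightarrow> (\<forall>x y. \<bar>\<phi> x - \<phi> y\<bar> \<le> D * dist x y) \<longrightarrow>
      (\<exists>u. (\<forall>x\<in>nonwandering f. \<forall>y\<in>nonwandering f. \<bar>u x - u y\<bar> \<le> L * D * dist x y) \<and>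
        (\<forall>x\<in>nonwandering f. \<phi> x + u x - u (f x) \<le> max_integral f \<phi>))"
proof -
  obtain L where L: "L > 0" and ml1: "\<And>\<phi>. holder_on 1 UNIV \<phi> \<Longrightarrow>
           (\<exists>u. holder_on 1 (nonwandering f) u \<and>
              (\<forall>x\<in>nonwandering f. \<phi> x + u x - u (f x) \<le> max_integral f \<phi>) \<and>
              holder_seminorm 1 (nonwandering f) u \<le> L * holder_seminorm 1 UNIV \<phi>)"
    using ml unfolding cond_ML_def by (meson order_refl zero_less_one)
  have "\<exists>u. (\<forall>x\<in>nonwandering f. \<forall>y\<in>nonwandering f. \<bar>u x - u y\<bar> \<le> L * D * dist x y) \<and>
        (\<forall>x\<in>nonwandering f. \<phi> x + u x - u (f x) \<le> max_integral f \<phi>)"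
    if D: "0 \<le> D" and \<phi>: "\<And>x y. \<bar>\<phi> x - \<phi> y\<bar> \<le> D * dist x y" for \<phi> D
  proof -
    have "holder_on 1 UNIV \<phi>" using \<phi> by (auto simp: holder_on_def)
    then obtain u where u: "holder_on 1 (nonwandering f) u"
      "\<forall>x\<in>nonwandering f. \<phi> x + u x - u (f x) \<le> max_integral f \<phi>"
      "holder_seminorm 1 (nonwandering f) u \<le> L * holder_seminorm 1 UNIV \<phi>"
      using ml1 by blast
    have "holder_seminorm 1 UNIV \<phi> \<le> D"
      unfolding holder_seminorm_def
    proof (rule cSUP_least)
      fix z :: "'a \<times> 'a"
      obtain x y where z: "z = (x, y)" by fastforce
      show "(case z of (x, y) \<Rightarrow> \<bar>\<phi> x - \<phi> y\<bar> / dist x y powr 1) \<le> D"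
        using \<phi>[of x y] D by (cases "x = y") (simp_all add: z pos_divide_le_eq)
    qed simp
    then have semi: "holder_seminorm 1 (nonwandering f) u \<le> L * D"
      using u(3) L by (meson less_imp_le mult_left_mono order_trans)
    obtain C where C: "\<And>x y. x \<in> nonwandering f \<Longrightarrow> y \<in> nonwandering f \<Longrightarrow> \<bar>u x - u y\<bar> \<le> C * dist x y"
      using u(1) by (auto simp: holder_on_def)
    have bdd: "bdd_above ((\<lambda>(x, y). \<bar>u x - u y\<bar> / dist x y powr 1) ` (nonwandering f \<times> nonwandering f))"
    proof (rule bdd_aboveI2[where M = "\<bar>C\<bar>"])
      fix z assume "z \<in> nonwandering f \<times> nonwandering f"
      then obtain x y where z: "z = (x, y)" "x \<in> nonwandering f" "y \<in> nonwandering f" by auto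
      have "\<bar>u x - u y\<bar> \<le> \<bar>C\<bar> * dist x y"
        using C[OF z(2,3)] mult_right_mono[OF abs_ge_self zero_le_dist, of C x y] by linarith
      then show "(case z of (x, y) \<Rightarrow> \<bar>u x - u y\<bar> / dist x y powr 1) \<le> \<bar>C\<bar>"
        by (cases "x = y") (simp_all add: z(1) pos_divide_le_eq)
    qed
    have "\<bar>u x - u y\<bar> \<le> L * D * dist x y" if xy: "x \<in> nonwandering f" "y \<in> nonwandering f" for x y
    proof (cases "x = y")
      case False
      have "(\<lambda>(x, y). \<bar>u x - u y\<bar> / dist x y powr 1) (x, y) \<le> holder_seminorm 1 (nonwandering f) u"
        unfolding holder_seminorm_def by (rule cSUP_upper[OF _ bdd]) (use xy in simp)
      then have "\<bar>u x - u y\<bar> / dist x y \<le> L * D" using semi by simp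
      then show ?thesis using False by (simp add: pos_divide_le_eq)
    qed simp
    then show ?thesis using u(2) by blast
  qed
  then show ?thesis using L by (intro exI[of _ L]) simp
qed

lemma dist_le_d_inf_id:
  fixes h :: "'m::metric_space \<Rightarrow> 'm"
  assumes "compact (UNIV :: 'm set)" "x \<in> S"
  shows "dist (h x) x \<le> d_inf_id S h"
proof -
  obtain e where "\<And>x y::'m. dist x y \<le> e"
    using compact_imp_bounded[OF assms(1)] bounded_two_points by (metis UNIV_I)
  then show ?thesis
    unfolding d_inf_id_def by (intro cSUP_upper assms(2) bdd_aboveI2)
qed

lemma d_inf_id_nonneg:
  fixes h :: "'m::metric_space \<Rightarrow> 'm"
  assumes "compact (UNIV :: 'm set)" "S \<noteq> {}"
  shows "0 \<le> d_inf_id S h"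
  using dist_le_d_inf_id[OF assms(1)] assms(2) by (meson ex_in_conv order_trans zero_le_dist)

text \<open>As \<open>h\<close> tends to the identity, \<open>x\<close> becomes a limit of points
  \<open>h x\<close> of a closed set, and \<open>h (f x) = g (h x)\<close> passes to the limit by
  continuity of \<open>g\<close>.\<close>

lemma intertwining_near_identity:
  fixes f g :: "'m::metric_space \<Rightarrow> 'm"
  assumes comp: "compact (UNIV :: 'm set)" and cont: "continuous_on UNIV f" "continuous_on UNIV g"
    and near: "\<And>e. e > 0 \<Longrightarrow> \<exists>h. intertwines f g h \<and> d_inf_id (nonwandering f) h < e"
    and x: "x \<in> nonwandering f"
  shows "x \<in> nonwandering g" "f x = g x"
proof -
  have near': "\<exists>h. intertwines f g h \<and> (\<forall>x\<in>nonwandering f. dist (h x) x < e)" if "e > 0" for e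
    using near[OF that] dist_le_d_inf_id[OF comp, of _ "nonwandering f"] by (meson le_less_trans)
  have "\<exists>y\<in>nonwandering g. dist y x < e" if e: "e > 0" for e
    using near'[OF e] x unfolding intertwines_def by blast
  then have "x \<in> closure (nonwandering g)" by (simp add: closure_approachable)
  then show "x \<in> nonwandering g" by (simp add: closed_nonwandering)
  have "dist (f x) (g x) \<le> 0 + e" if e: "e > 0" for e
  proof -
    obtain d where d: "d > 0" "\<And>y. dist y x < d \<Longrightarrow> dist (g y) (g x) < e / 2"
      using cont(2) e unfolding continuous_on_iff by (metis UNIV_I half_gt_zero)
    obtain h where h: "intertwines f g h" "\<forall>x\<in>nonwandering f. dist (h x) x < min d (e / 2)"
      using near'[of "min d (e / 2)"] d e by auto
    have "dist (h (f x)) (f x) < e / 2" "dist (h x) x < d"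
      using h(2) x in_nonwandering_step[OF cont(1) x] by auto
    moreover have "h (f x) = g (h x)" using h(1) x by (simp add: intertwines_def)
    ultimately show ?thesis
      using d(2)[of "h x"] dist_triangle3[of "f x" "g x" "g (h x)"] by simp
  qed
  then have "dist (f x) (g x) \<le> 0" by (rule field_le_epsilon)
  then show "f x = g x" by simp
qed

text \<open>A pair within a factor 2 of the infimum inherits, up to that factor, every bound that
  some pair satisfies. An infimum of 0 has to be attained: in that case \<open>f\<close> and
  \<open>g\<close> have the same nonwandering set and agree on it, and the identity attains
  it.\<close>

lemma near_optimal_intertwining:
  fixes f g :: "'m::metric_space \<Rightarrow> 'm"
  defines "d \<equiv> \<lambda>h i. max (d_inf_id (nonwandering f) h) (d_inf_id (nonwandering g) i)"
  assumes comp: "compact (UNIV :: 'm set)" and cont: "continuous_on UNIV f" "continuous_on UNIV g"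
    and ne: "nonwandering f \<noteq> {}" and ex: "intertwines f g h0" "intertwines g f i0"
  shows "\<exists>h i. intertwines f g h \<and> intertwines g f i \<and>
    (\<forall>h' i'. intertwines f g h' \<longrightarrow> intertwines g f i' \<longrightarrow> d h i \<le> 2 * d h' i')"
proof -
  have ne': "nonwandering g \<noteq> {}" using ne ex(1) unfolding intertwines_def by blast
  have nonneg: "0 \<le> d h i" for h i
    unfolding d_def using d_inf_id_nonneg[OF comp ne, of h] by (simp add: le_max_iff_disj)
  define X where "X = {d h i |h i. intertwines f g h \<and> intertwines g f i}"
  have X: "X \<noteq> {}" "bdd_below X" using ex nonneg unfolding X_def by (auto intro: bdd_belowI[of _ 0])
  have lower: "Inf X \<le> d h i" if "intertwines f g h" "intertwines g f i" for h i
    using that by (intro cInf_lower X(2)) (auto simp: X_def)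
  have "0 \<le> Inf X" using nonneg by (intro cInf_greatest X(1)) (auto simp: X_def)
  show ?thesis
  proof (cases "Inf X = 0")
    case False
    then have "Inf X < 2 * Inf X" using \<open>0 \<le> Inf X\<close> by simp
    then obtain h i where hi: "intertwines f g h" "intertwines g f i" "d h i < 2 * Inf X"
      using cInf_lessD[OF X(1)] unfolding X_def by blast
    have "d h i \<le> 2 * d h' i'" if "intertwines f g h'" "intertwines g f i'" for h' i'
      using lower[OF that] hi(3) by linarith
    then show ?thesis using hi by blast
  next
    case True
    have small: "\<exists>h i. intertwines f g h \<and> intertwines g f i \<and> d h i < e" if "e > 0" for e
      using cInf_lessD[OF X(1), of e] that True unfolding X_def by auto
    have "\<exists>h. intertwines f g h \<and> d_inf_id (nonwandering f) h < e"
      "\<exists>i. intertwines g f i \<and> d_inf_id (nonwandering g) i < e" if "e > 0" for e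
      using small[OF that] unfolding d_def by auto
    note fg = intertwining_near_identity[OF comp cont this(1)]
      intertwining_near_identity[OF comp cont(2,1) this(2)]
    have "intertwines f g (\<lambda>x. x)" "intertwines g f (\<lambda>x. x)"
      unfolding intertwines_def by (intro conjI Pi_I ballI; rule fg; assumption)+
    moreover have "d (\<lambda>x. x) (\<lambda>x. x) = 0" using ne ne' by (simp add: d_def d_inf_id_def)
    ultimately show ?thesis using nonneg by (metis mult_nonneg_nonneg zero_le_numeral)
  qed
qed

text \<open>An invariant measure of \<open>f\<close> lives on the nonwandering set and does not see
  where else \<open>f\<close> and \<open>g\<close> differ.\<close>

lemma invariant_measures_subset:
  fixes f g :: "'m::metric_space \<Rightarrow> 'm"
  assumes comp: "compact (UNIV :: 'm set)" and cont: "continuous_on UNIV f" "continuous_on UNIV g"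
    and ne: "nonwandering f \<noteq> {}" and eq: "\<And>x. x \<in> nonwandering f \<Longrightarrow> f x = g x"
  shows "invariant_measures f \<subseteq> invariant_measures g"
proof
  fix \<mu> assume \<mu>: "\<mu> \<in> invariant_measures f"
  have "AE x in \<mu>. f x = g x"
    using AE_nonwandering[OF \<mu> cont(1) comp ne] by eventually_elim (rule eq)
  then have "distr \<mu> borel f = distr \<mu> borel g"
    by (intro distr_cong_AE refl borel_measurable_continuous_invariant[OF \<mu>] cont)
  then show "\<mu> \<in> invariant_measures g" using \<mu> by (simp add: invariant_measures_def)
qed

lemma LIP_less_imp_lipschitz:
  assumes "L-lipschitz_on UNIV g" "LIP g < B"
  shows "B-lipschitz_on UNIV g"
proof -
  obtain L' where "L'-lipschitz_on UNIV g" "L' < B"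
    using cInf_lessD[of "{L. L-lipschitz_on UNIV g}" B] assms unfolding LIP_def by blast
  then show ?thesis using lipschitz_on_le by (metis less_imp_le)
qed

lemma LIP_nonneg: "L-lipschitz_on UNIV g \<Longrightarrow> 0 \<le> LIP g"
  unfolding LIP_def by (intro cInf_greatest) (auto dest: lipschitz_on_nonneg)

lemma periodic_orbitE:
  assumes "periodic_orbit f \<O>"
  obtains P where "P \<ge> 1" "\<And>y. y \<in> \<O> \<Longrightarrow> (f ^^ P) y = y" "finite \<O>" "\<O> \<noteq> {}" "f ` \<O> = \<O>"
    "\<O> \<subseteq> nonwandering f" "\<And>x y. x \<in> \<O> \<Longrightarrow> y \<in> \<O> \<Longrightarrow> \<exists>n. y = (f ^^ n) x"
proof -
  obtain x P where P: "P \<ge> 1" "(f ^^ P) x = x" and \<O>: "\<O> = range (\<lambda>n. (f ^^ n) x)"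
    using assms unfolding periodic_orbit_def by blast
  have per: "(f ^^ P) ((f ^^ n) x) = (f ^^ n) x" for n
    using P(2) by (metis add.commute comp_apply funpow_add)
  have mult: "(f ^^ (P * k)) x = x" for k
    by (induction k) (simp_all add: funpow_add P(2))
  have mod: "(f ^^ n) x = (f ^^ (n mod P)) x" for n
  proof -
    have "(f ^^ n) x = (f ^^ (n mod P + P * (n div P))) x" by simp
    also have "\<dots> = (f ^^ (n mod P)) x" by (simp only: funpow_add comp_apply mult)
    finally show ?thesis .
  qed
  \<comment> \<open>Moving backwards along the cycle is replaced by moving forwards:
    \<open>m\<close> additional full periods make the target time at least \<open>m\<close>.\<close>
  have reach: "\<exists>k. (f ^^ n) x = (f ^^ k) ((f ^^ m) x)" for m n
  proof -
    have "m \<le> P * m" using P(1) by simp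
    then have "n + P * m = (n + (P * m - m)) + m" by (simp only: add.assoc le_add_diff_inverse2)
    then have "(f ^^ (n + P * m)) x = (f ^^ (n + (P * m - m))) ((f ^^ m) x)"
      by (metis comp_apply funpow_add)
    then show ?thesis by (metis comp_apply funpow_add mult)
  qed
  show thesis
  proof (rule that[of P])
    show "finite \<O>"
    proof (rule finite_subset)
      show "\<O> \<subseteq> (\<lambda>n. (f ^^ n) x) ` {..<P}" using mod P(1) unfolding \<O> by force
    qed simp
    show "f ` \<O> = \<O>"
    proof
      show "f ` \<O> \<subseteq> \<O>" unfolding \<O> by (auto intro: range_eqI[of _ _ "Suc n" for n])
      show "\<O> \<subseteq> f ` \<O>"
      proof
        fix y assume "y \<in> \<O>"
        then obtain n where y: "y = (f ^^ n) x" unfolding \<O> by blast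
        have "y = (f ^^ Suc (P - 1)) y" using per[of n] P(1) y by simp
        also have "\<dots> = f ((f ^^ (P - 1 + n)) x)" unfolding y by (simp add: funpow_add)
        finally show "y \<in> f ` \<O>" unfolding \<O> by blast
      qed
    qed
    show "\<O> \<subseteq> nonwandering f"
      using per P(1) unfolding \<O> nonwandering_def by (auto simp: disjoint_iff) (metis imageI)
  qed (use P(1) per reach in \<open>auto simp: \<O>\<close>)
qed

lemma finite_set_separated:
  fixes S :: "'m::metric_space set"
  assumes "finite S"
  obtains s where "s > 0" "\<And>x y. x \<in> S \<Longrightarrow> y \<in> S \<Longrightarrow> dist x y < s \<Longrightarrow> x = y"
proof -
  have "\<forall>x. \<exists>d>0. \<forall>y\<in>S. y \<noteq> x \<longrightarrow> d \<le> dist x y"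
    using finite_set_avoid[OF assms] by (rule allI)
  then obtain d where d: "\<And>x. d x > 0 \<and> (\<forall>y\<in>S. y \<noteq> x \<longrightarrow> d x \<le> dist x y)"
    by (auto dest!: choice)
  define s where "s = Min (insert 1 (d ` S))"
  have "s > 0" unfolding s_def using assms d by (subst Min_gr_iff) auto
  moreover have "x = y" if "x \<in> S" "y \<in> S" "dist x y < s" for x y
  proof (rule ccontr)
    assume "x \<noteq> y"
    have "s \<le> d x" unfolding s_def using assms that(1) by (intro Min_le) auto
    also have "\<dots> \<le> dist x y" using d[of x] that(2) \<open>x \<noteq> y\<close> by simp
    finally show False using that(3) by simp
  qed
  ultimately show thesis by (rule that)
qed

text \<open>A pair with displacement 0 meets every positive bound, so the maps agree on a common
  nonwandering set. This settles the case in which the correction \<open>v\<close> vanishes.\<close>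

lemma invariant_measures_eq_if_dist_0:
  fixes f g :: "'m::metric_space \<Rightarrow> 'm"
  assumes comp: "compact (UNIV :: 'm set)" and cont: "continuous_on UNIV f" "continuous_on UNIV g"
    and ne: "nonwandering f \<noteq> {}" and hi: "intertwines f g h" "intertwines g f i"
    and 0: "d_inf_id (nonwandering f) h \<le> 0" "d_inf_id (nonwandering g) i \<le> 0"
  shows "invariant_measures f = invariant_measures g"
proof -
  have "\<exists>h. intertwines f g h \<and> d_inf_id (nonwandering f) h < e"
    "\<exists>i. intertwines g f i \<and> d_inf_id (nonwandering g) i < e" if "e > 0" for e
    using hi 0 that by force+
  note fg = intertwining_near_identity[OF comp cont this(1)]
    intertwining_near_identity[OF comp cont(2,1) this(2)]
  have "nonwandering g \<noteq> {}" using ne fg(1) by blast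
  show ?thesis
  proof
    show "invariant_measures f \<subseteq> invariant_measures g"
      by (rule invariant_measures_subset[OF comp cont ne fg(2)])
    show "invariant_measures g \<subseteq> invariant_measures f"
      by (rule invariant_measures_subset[OF comp cont(2,1) \<open>nonwandering g \<noteq> {}\<close> fg(4)])
  qed
qed

section \<open>Continuously differentiable functions on a Riemannian manifold\<close>

lemma C1_on_iff:
  "Ck_on 1 S f \<longleftrightarrow> (\<forall>x\<in>S. f differentiable (at x)) \<and>
    (\<forall>v. continuous_on S (\<lambda>x. frechet_derivative f (at x) v))"
  by (simp add: One_nat_def)

lemma C1_onI:
  assumes "\<And>x. x \<in> S \<Longrightarrow> (f has_derivative f' x) (at x)" "\<And>v. continuous_on S (\<lambda>x. f' x v)"
  shows "Ck_on 1 S f"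
proof -
  have "frechet_derivative f (at x) = f' x" if "x \<in> S" for x
    using frechet_derivative_at[OF assms(1)[OF that]] by simp
  then have "continuous_on S (\<lambda>x. frechet_derivative f (at x) v)" for v
    using assms(2)[of v] by (simp cong: continuous_on_cong)
  then show ?thesis
    using assms(1) unfolding C1_on_iff differentiable_def by blast
qed

lemma C1_onD:
  assumes "Ck_on 1 S f"
  shows "x \<in> S \<Longrightarrow> (f has_derivative frechet_derivative f (at x)) (at x)"
    "continuous_on S (\<lambda>x. frechet_derivative f (at x) v)"
  using assms unfolding C1_on_iff by (auto simp: frechet_derivative_works)

lemma C1_on_continuous: "Ck_on 1 S f \<Longrightarrow> continuous_on S f"
  by (meson C1_onD(1) continuous_at_imp_continuous_on has_derivative_continuous)

lemma C1_on_locally: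
  assumes "\<And>x. x \<in> S \<Longrightarrow> \<exists>T. open T \<and> x \<in> T \<and> Ck_on 1 T f"
  shows "Ck_on 1 S f"
proof (rule C1_onI[where f' = "\<lambda>x. frechet_derivative f (at x)"])
  show "(f has_derivative frechet_derivative f (at x)) (at x)" if "x \<in> S" for x
    using assms[OF that] C1_onD(1) by blast
  show "continuous_on S (\<lambda>x. frechet_derivative f (at x) v)" for v
  proof (intro continuous_at_imp_continuous_on ballI)
    fix x assume "x \<in> S"
    then obtain T where "open T" "x \<in> T" "Ck_on 1 T f" using assms by blast
    then show "isCont (\<lambda>x. frechet_derivative f (at x) v) x"
      using C1_onD(2)[of T f v] continuous_on_eq_continuous_at by blast
  qed
qed

lemma C1_on_cong:
  assumes "open S" "\<And>x. x \<in> S \<Longrightarrow> f x = g x" "Ck_on 1 S f"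
  shows "Ck_on 1 S g"
proof (rule C1_onI[where f' = "\<lambda>x. frechet_derivative f (at x)"])
  show "(g has_derivative frechet_derivative f (at x)) (at x)" if "x \<in> S" for x
    using has_derivative_transform_within_open[OF C1_onD(1)[OF assms(3) that] assms(1) that] assms(2)
    by blast
qed (rule C1_onD(2)[OF assms(3)])

lemma C1_on_const: "Ck_on 1 S (\<lambda>x. c)"
  by (rule C1_onI[where f' = "\<lambda>x v. 0"]) auto

lemma C1_on_add:
  assumes "Ck_on 1 S f" "Ck_on 1 S g"
  shows "Ck_on 1 S (\<lambda>x. f x + g x)"
  by (rule C1_onI, rule has_derivative_add[OF C1_onD(1)[OF assms(1)] C1_onD(1)[OF assms(2)]])
    (auto intro!: continuous_on_add C1_onD(2) assms)

lemma C1_on_compose_real: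
  fixes f :: "'a::euclidean_space \<Rightarrow> real"
  assumes f: "Ck_on 1 S f" and \<beta>: "\<And>t. (\<beta> has_real_derivative \<beta>' t) (at t)" "continuous_on UNIV \<beta>'"
  shows "Ck_on 1 S (\<lambda>x. \<beta> (f x))"
proof (rule C1_onI[where f' = "\<lambda>x v. frechet_derivative f (at x) v * \<beta>' (f x)"])
  show "((\<lambda>x. \<beta> (f x)) has_derivative (\<lambda>v. frechet_derivative f (at x) v * \<beta>' (f x))) (at x)"
    if "x \<in> S" for x
    by (rule DERIV_compose_FDERIV[OF \<beta>(1) C1_onD(1)[OF f that]])
  show "continuous_on S (\<lambda>x. frechet_derivative f (at x) v * \<beta>' (f x))" for v
    by (intro continuous_on_mult C1_onD(2)[OF f] continuous_on_compose2[OF \<beta>(2) C1_on_continuous[OF f]]) auto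
qed

lemma C1_on_norm_diff_sq:
  fixes z :: "'a::euclidean_space \<Rightarrow> 'b::euclidean_space"
  assumes z: "Ck_on 1 S z"
  shows "Ck_on 1 S (\<lambda>y. (z y - a) \<bullet> (z y - a))"
proof (rule C1_onI[where f' = "\<lambda>y v. 2 * ((z y - a) \<bullet> frechet_derivative z (at y) v)"])
  show "((\<lambda>y. (z y - a) \<bullet> (z y - a)) has_derivative
      (\<lambda>v. 2 * ((z y - a) \<bullet> frechet_derivative z (at y) v))) (at y)" if "y \<in> S" for y
    by (rule derivative_eq_intros refl C1_onD(1)[OF z that])+ (auto simp: inner_commute)
  show "continuous_on S (\<lambda>y. 2 * ((z y - a) \<bullet> frechet_derivative z (at y) v))" for v
    by (intro continuous_intros C1_onD(2)[OF z] C1_on_continuous[OF z])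
qed

text \<open>Squaring removes the corner of \<open>max 0 t\<close>. One continuous derivative is all
  that the cutoff functions have to possess, so this takes the place of a smooth cutoff.\<close>

lemma has_real_derivative_max_0_sq:
  "((\<lambda>t::real. (max 0 t)\<^sup>2) has_real_derivative 2 * max 0 t) (at t)"
proof -
  consider "t > 0" | "t < 0" | "t = 0" by linarith
  then show ?thesis
  proof cases
    case 1
    have "((\<lambda>t::real. t\<^sup>2) has_real_derivative 2 * t) (at t)"
      by (auto intro!: derivative_eq_intros)
    then show ?thesis
      using has_field_derivative_transform_within_open[of "\<lambda>t. t\<^sup>2" "2 * t" t "{0<..}" "\<lambda>t. (max 0 t)\<^sup>2"] 1
      by auto
  next
    case 2
    have "((\<lambda>t::real. 0) has_real_derivative 0) (at t)" by simp
    then show ?thesis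
      using has_field_derivative_transform_within_open[of "\<lambda>t. 0" "0" t "{..<0}" "\<lambda>t. (max 0 t)\<^sup>2"] 2
      by auto
  next
    case 3
    have "((\<lambda>h::real. (max 0 h)\<^sup>2 / h) \<longlongrightarrow> 0) (at 0)"
    proof (rule Lim_null_comparison)
      show "\<forall>\<^sub>F h in at 0. norm ((max 0 h)\<^sup>2 / h) \<le> \<bar>h\<bar>"
        by (auto simp: max_def power2_eq_square)
      show "((\<lambda>h::real. \<bar>h\<bar>) \<longlongrightarrow> 0) (at 0)" by (auto intro!: tendsto_eq_intros)
    qed
    then show ?thesis by (simp add: 3 DERIV_def)
  qed
qed

text \<open>Continuity of derivatives is known only along each fixed direction; the expansion in a
  basis upgrades it to joint continuity in the point and the vector.\<close>

lemma linear_real_expand: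
  fixes f :: "'a::euclidean_space \<Rightarrow> real"
  assumes "linear f"
  shows "f v = (\<Sum>i\<in>Basis. (v \<bullet> i) * f i)"
proof -
  have "f v = f (\<Sum>i\<in>Basis. (v \<bullet> i) *\<^sub>R i)" by (simp add: euclidean_representation)
  also have "\<dots> = (\<Sum>i\<in>Basis. (v \<bullet> i) * f i)"
    by (simp add: linear_sum[OF assms] linear_scale[OF assms])
  finally show ?thesis .
qed

lemma bilinear_real_expand:
  fixes B :: "'a::euclidean_space \<Rightarrow> 'a \<Rightarrow> real"
  assumes "bilinear B"
  shows "B v w = (\<Sum>i\<in>Basis. \<Sum>j\<in>Basis. (v \<bullet> i) * (w \<bullet> j) * B i j)"
proof -
  have "linear (\<lambda>v. B v w)" "\<And>v. linear (B v)" using assms by (auto simp: bilinear_def)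
  then show ?thesis
    using linear_real_expand[of "\<lambda>v. B v w" v] linear_real_expand[of "B i" w for i]
    by (simp add: sum_distrib_left mult.assoc)
qed

section \<open>Derivatives in charts and their supremum norm\<close>

locale riemannian_manifold =
  fixes A :: "('m::metric_space, 'b::euclidean_space) chart set" and G :: "('m, 'b) metric_coords"
  assumes manifold: "compact_riemannian_manifold A G"
begin

lemma compact_UNIV: "compact (UNIV :: 'm set)"
  using manifold by (simp add: compact_riemannian_manifold_def)

lemma chart:
  assumes "(U, \<psi>) \<in> A"
  shows "open U" "open (\<psi> ` U)" "continuous_on U \<psi>" "continuous_on (\<psi> ` U) (inv_into U \<psi>)" "inj_on \<psi> U"
proof -
  show "open U" "open (\<psi> ` U)"
    using manifold assms unfolding compact_riemannian_manifold_def smooth_atlas_def by auto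
  have "homeomorphism U (\<psi> ` U) \<psi> (inv_into U \<psi>)"
    using manifold assms unfolding compact_riemannian_manifold_def smooth_atlas_def by auto
  then show "continuous_on U \<psi>" "continuous_on (\<psi> ` U) (inv_into U \<psi>)" "inj_on \<psi> U"
    by (auto simp: homeomorphism_def intro: inj_on_inverseI)
qed

lemma open_chart_image:
  assumes "(U, \<psi>) \<in> A" "open N"
  shows "open (\<psi> ` (U \<inter> N))"
proof -
  have "\<psi> ` (U \<inter> N) = inv_into U \<psi> -` N \<inter> \<psi> ` U"
    using chart(5)[OF assms(1)] by (auto simp: inv_into_f_f)
  then show ?thesis
    using chart(2,4)[OF assms(1)] assms(2) by (simp add: continuous_on_open_vimage)
qed

lemma chart_at: "\<exists>U \<psi>. (U, \<psi>) \<in> A \<and> p \<in> U"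
  using manifold unfolding compact_riemannian_manifold_def smooth_atlas_def by blast

lemma C1_transition:
  assumes "(U, \<psi>) \<in> A" "(V, \<eta>) \<in> A"
  shows "Ck_on 1 (\<psi> ` (U \<inter> V)) (\<eta> \<circ> inv_into U \<psi>)"
  using manifold assms
  unfolding compact_riemannian_manifold_def smooth_atlas_def smooth_on_def by blast

abbreviation D_transition :: "'m set \<Rightarrow> ('m \<Rightarrow> 'b) \<Rightarrow> ('m \<Rightarrow> 'b) \<Rightarrow> 'm \<Rightarrow> 'b \<Rightarrow> 'b" where
  "D_transition U \<psi> \<eta> p \<equiv> frechet_derivative (\<eta> \<circ> inv_into U \<psi>) (at (\<psi> p))"

lemma metric:
  assumes "(U, \<psi>) \<in> A"
  shows "p \<in> U \<Longrightarrow> bilinear (G (U, \<psi>) p)"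
    "p \<in> U \<Longrightarrow> v \<noteq> 0 \<Longrightarrow> G (U, \<psi>) p v v > 0"
    "continuous_on (\<psi> ` U) (\<lambda>y. G (U, \<psi>) (inv_into U \<psi> y) v w)"
proof -
  have R: "riemannian_metric A G" using manifold by (simp add: compact_riemannian_manifold_def)
  then show "p \<in> U \<Longrightarrow> bilinear (G (U, \<psi>) p)" "p \<in> U \<Longrightarrow> v \<noteq> 0 \<Longrightarrow> G (U, \<psi>) p v v > 0"
    using assms unfolding riemannian_metric_def by auto
  have "Ck_on 0 (\<psi> ` U) (\<lambda>y. G (U, \<psi>) (inv_into U \<psi> y) v w)"
    using R assms unfolding riemannian_metric_def smooth_on_def by fast
  then show "continuous_on (\<psi> ` U) (\<lambda>y. G (U, \<psi>) (inv_into U \<psi> y) v w)" by simp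
qed

lemma metric_transition:
  assumes "(U, \<psi>) \<in> A" "(V, \<eta>) \<in> A" "p \<in> U" "p \<in> V"
  shows "G (U, \<psi>) p v w = G (V, \<eta>) p (D_transition U \<psi> \<eta> p v) (D_transition U \<psi> \<eta> p w)"
proof -
  have "riemannian_metric A G" using manifold by (simp add: compact_riemannian_manifold_def)
  then show ?thesis using assms unfolding riemannian_metric_def by fast
qed

lemma metric_scale: "(U, \<psi>) \<in> A \<Longrightarrow> p \<in> U \<Longrightarrow> G (U, \<psi>) p (a *\<^sub>R v) (a *\<^sub>R v) = a\<^sup>2 * G (U, \<psi>) p v v"
  using metric(1)[of U \<psi> p] by (simp add: bilinear_lmul bilinear_rmul power2_eq_square)

lemma C1_functionsD:
  "\<phi> \<in> C1_functions A \<Longrightarrow> (U, \<psi>) \<in> A \<Longrightarrow> Ck_on 1 (\<psi> ` U) (\<phi> \<circ> inv_into U \<psi>)"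
  unfolding C1_functions_def by blast

lemma C1_functionsI:
  "(\<And>U \<psi>. (U, \<psi>) \<in> A \<Longrightarrow> Ck_on 1 (\<psi> ` U) (\<phi> \<circ> inv_into U \<psi>)) \<Longrightarrow> \<phi> \<in> C1_functions A"
  unfolding C1_functions_def by blast

lemma C1_functions_compose_real:
  assumes "\<phi> \<in> C1_functions A" "\<And>t. (\<beta> has_real_derivative \<beta>' t) (at t)" "continuous_on UNIV \<beta>'"
  shows "(\<lambda>x. \<beta> (\<phi> x)) \<in> C1_functions A"
  using C1_on_compose_real[OF C1_functionsD[OF assms(1)] assms(2,3)]
  by (intro C1_functionsI) (simp add: comp_def)

lemma C1_functions_add:
  assumes "\<phi> \<in> C1_functions A" "\<theta> \<in> C1_functions A"
  shows "(\<lambda>x. \<phi> x + \<theta> x) \<in> C1_functions A"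
  using C1_on_add[OF C1_functionsD[OF assms(1)] C1_functionsD[OF assms(2)]]
  by (intro C1_functionsI) (simp add: comp_def)

lemma C1_functions_const: "(\<lambda>x. c) \<in> C1_functions A"
  by (intro C1_functionsI) (simp add: comp_def C1_on_const del: One_nat_def)

lemma C1_functions_sum:
  "finite I \<Longrightarrow> (\<And>j. j \<in> I \<Longrightarrow> \<phi> j \<in> C1_functions A) \<Longrightarrow> (\<lambda>x. \<Sum>j\<in>I. \<phi> j x) \<in> C1_functions A"
  by (induction I rule: finite_induct) (simp_all add: C1_functions_const C1_functions_add)

abbreviation D_coord :: "('m \<Rightarrow> real) \<Rightarrow> 'm set \<Rightarrow> ('m \<Rightarrow> 'b) \<Rightarrow> 'm \<Rightarrow> 'b \<Rightarrow> real" where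
  "D_coord \<phi> U \<psi> p \<equiv> frechet_derivative (\<phi> \<circ> inv_into U \<psi>) (at (\<psi> p))"

lemma has_derivative_coord:
  "\<phi> \<in> C1_functions A \<Longrightarrow> (U, \<psi>) \<in> A \<Longrightarrow> p \<in> U \<Longrightarrow>
    ((\<phi> \<circ> inv_into U \<psi>) has_derivative D_coord \<phi> U \<psi> p) (at (\<psi> p))"
  using C1_onD(1)[OF C1_functionsD] by blast

lemma has_derivative_transition:
  "(U, \<psi>) \<in> A \<Longrightarrow> (V, \<eta>) \<in> A \<Longrightarrow> p \<in> U \<Longrightarrow> p \<in> V \<Longrightarrow>
    ((\<eta> \<circ> inv_into U \<psi>) has_derivative D_transition U \<psi> \<eta> p) (at (\<psi> p))"
  using C1_onD(1)[OF C1_transition] by blast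

text \<open>The chain rule, applied to a composition that agrees with
  \<open>\<phi> \<circ> inv_into U \<psi>\<close> only on the overlap of the charts, which is open
  around \<open>\<psi> p\<close>.\<close>

lemma D_coord_transition:
  assumes \<phi>: "\<phi> \<in> C1_functions A" and c: "(U, \<psi>) \<in> A" "(V, \<eta>) \<in> A" and p: "p \<in> U" "p \<in> V"
  shows "D_coord \<phi> U \<psi> p v = D_coord \<phi> V \<eta> p (D_transition U \<psi> \<eta> p v)"
proof -
  have inv: "inv_into U \<psi> (\<psi> q) = q" if "q \<in> U" for q
    using chart(5)[OF c(1)] that by simp
  have inv': "inv_into V \<eta> (\<eta> q) = q" if "q \<in> V" for q
    using chart(5)[OF c(2)] that by simp
  have "((\<phi> \<circ> inv_into V \<eta>) \<circ> (\<eta> \<circ> inv_into U \<psi>) has_derivative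
      D_coord \<phi> V \<eta> p \<circ> D_transition U \<psi> \<eta> p) (at (\<psi> p))"
    using has_derivative_coord[OF \<phi> c(2) p(2)] inv[OF p(1)]
    by (intro diff_chain_at has_derivative_transition[OF c p]) simp
  then have "((\<phi> \<circ> inv_into U \<psi>) has_derivative D_coord \<phi> V \<eta> p \<circ> D_transition U \<psi> \<eta> p) (at (\<psi> p))"
    by (rule has_derivative_transform_within_open[OF _ open_chart_image[OF c(1) chart(1)[OF c(2)]]])
      (use p inv inv' in auto)
  from frechet_derivative_at[OF this] show ?thesis by (metis comp_apply)
qed

lemma C1_functions_continuous:
  assumes \<phi>: "\<phi> \<in> C1_functions A"
  shows "continuous_on UNIV \<phi>"
proof (intro continuous_at_imp_continuous_on ballI)
  fix p
  obtain U \<psi> where c: "(U, \<psi>) \<in> A" "p \<in> U" using chart_at by blast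
  have "continuous_on U ((\<phi> \<circ> inv_into U \<psi>) \<circ> \<psi>)"
    by (intro continuous_on_compose chart(3)[OF c(1)] C1_on_continuous C1_functionsD[OF \<phi> c(1)])
  then have "continuous_on U \<phi>"
    by (rule continuous_on_eq) (use chart(5)[OF c(1)] in auto)
  then show "isCont \<phi> p" using chart(1)[OF c(1)] c(2) continuous_on_eq_continuous_at by blast
qed

lemma continuous_on_metric_compose:
  assumes c: "(U, \<psi>) \<in> A" and p: "continuous_on S p" "p ` S \<subseteq> U" and v: "continuous_on S v"
  shows "continuous_on S (\<lambda>t. G (U, \<psi>) (p t) (v t) (v t))"
proof -
  have pU: "p t \<in> U" if "t \<in> S" for t using p(2) that by blast
  have "continuous_on S (\<lambda>t. G (U, \<psi>) (inv_into U \<psi> (\<psi> (p t))) i j)" for i j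
    by (rule continuous_on_compose2[OF metric(3)[OF c] continuous_on_compose2[OF chart(3)[OF c] p]])
      (use pU in auto)
  then have "continuous_on S (\<lambda>t. \<Sum>i\<in>Basis. \<Sum>j\<in>Basis.
      (v t \<bullet> i) * (v t \<bullet> j) * G (U, \<psi>) (inv_into U \<psi> (\<psi> (p t))) i j)"
    by (intro continuous_intros v)
  then show ?thesis
  proof (rule continuous_on_eq)
    fix t assume "t \<in> S"
    then show "(\<Sum>i\<in>Basis. \<Sum>j\<in>Basis. (v t \<bullet> i) * (v t \<bullet> j) * G (U, \<psi>) (inv_into U \<psi> (\<psi> (p t))) i j)
        = G (U, \<psi>) (p t) (v t) (v t)"
      using bilinear_real_expand[OF metric(1)[OF c pU]] chart(5)[OF c] pU by simp
  qed
qed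

text \<open>The atlas may be infinite, so the bound is computed in one chart around \<open>p\<close>
  and carried to the others by the transformation rules of derivative and metric. In that chart the
  metric has a positive minimum over Euclidean unit vectors above a closed ball, which bounds the
  Euclidean norm of vectors of metric length at most 1.\<close>

lemma locally_bounded_derivative:
  assumes \<phi>: "\<phi> \<in> C1_functions A"
  shows "\<exists>W b. open W \<and> p \<in> W \<and> (\<forall>V \<eta> q w. (V, \<eta>) \<in> A \<longrightarrow> q \<in> V \<longrightarrow>
    q \<in> W \<longrightarrow> G (V, \<eta>) q w w \<le> 1 \<longrightarrow> \<bar>D_coord \<phi> V \<eta> q w\<bar> \<le> b)"
proof -
  obtain U \<psi> where c: "(U, \<psi>) \<in> A" and p: "p \<in> U" using chart_at by blast
  note inv = inv_into_f_f[OF chart(5)[OF c]]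
  obtain e where e: "e > 0" "cball (\<psi> p) e \<subseteq> \<psi> ` U"
    using open_contains_cball_eq[OF chart(2)[OF c]] p by blast
  define Z where "Z = cball (\<psi> p) e \<times> sphere (0::'b) 1"
  have Z: "compact Z" unfolding Z_def by (intro compact_Times compact_cball compact_sphere)
  obtain u :: 'b where "norm u = 1" using vector_choose_size[of 1] by auto
  then have "(\<psi> p, u) \<in> Z" using e(1) by (simp add: Z_def)
  then have "Z \<noteq> {}" by blast
  have fstZ: "fst ` Z \<subseteq> \<psi> ` U" using e(2) by (auto simp: Z_def)
  have "continuous_on Z (\<lambda>z. G (U, \<psi>) (inv_into U \<psi> (fst z)) (snd z) (snd z))"
  proof (rule continuous_on_metric_compose[OF c])
    show "continuous_on Z (\<lambda>z. inv_into U \<psi> (fst z))"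
      by (rule continuous_on_compose2[OF chart(4)[OF c] _ fstZ]) (intro continuous_intros)
    show "(\<lambda>z. inv_into U \<psi> (fst z)) ` Z \<subseteq> U"
      by (intro image_subsetI inv_into_into) (use fstZ in blast)
  qed (intro continuous_intros)
  then obtain z0 where z0: "z0 \<in> Z" and z0_min: "\<And>z. z \<in> Z \<Longrightarrow>
      G (U, \<psi>) (inv_into U \<psi> (fst z0)) (snd z0) (snd z0) \<le> G (U, \<psi>) (inv_into U \<psi> (fst z)) (snd z) (snd z)"
    using continuous_attains_inf[OF Z \<open>Z \<noteq> {}\<close>] by blast
  define m where "m = G (U, \<psi>) (inv_into U \<psi> (fst z0)) (snd z0) (snd z0)"
  have "m > 0" unfolding m_def
    by (rule metric(2)[OF c inv_into_into]) (use fstZ z0 in \<open>auto simp: Z_def\<close>)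
  have lin: "linear (frechet_derivative (\<phi> \<circ> inv_into U \<psi>) (at y))" if "y \<in> \<psi> ` U" for y
    using has_derivative_linear[OF C1_onD(1)[OF C1_functionsD[OF \<phi> c] that]] .
  have "continuous_on Z (\<lambda>z. \<Sum>i\<in>Basis. (snd z \<bullet> i) * frechet_derivative (\<phi> \<circ> inv_into U \<psi>) (at (fst z)) i)"
    by (intro continuous_intros continuous_on_compose2[OF C1_onD(2)[OF C1_functionsD[OF \<phi> c]]] fstZ)
  then have "continuous_on Z (\<lambda>z. frechet_derivative (\<phi> \<circ> inv_into U \<psi>) (at (fst z)) (snd z))"
    by (rule continuous_on_eq) (use linear_real_expand[OF lin] fstZ in auto)
  from compact_imp_bounded[OF compact_continuous_image[OF this Z]]
  obtain M where "M > 0" and M: "\<And>z. z \<in> Z \<Longrightarrow> \<bar>frechet_derivative (\<phi> \<circ> inv_into U \<psi>) (at (fst z)) (snd z)\<bar> \<le> M"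
    unfolding bounded_pos by auto
  have main: "\<bar>D_coord \<phi> U \<psi> q w\<bar> \<le> M / sqrt m"
    if q: "q \<in> U" "\<psi> q \<in> ball (\<psi> p) e" and w: "G (U, \<psi>) q w w \<le> 1" for q w
  proof (cases "w = 0")
    case True
    then show ?thesis using linear_0[OF lin, of "\<psi> q"] q(1) \<open>M > 0\<close> \<open>m > 0\<close> by simp
  next
    case False
    define u where "u = w /\<^sub>R norm w"
    have wu: "w = norm w *\<^sub>R u" using False by (simp add: u_def)
    have z: "(\<psi> q, u) \<in> Z" using q False by (simp add: Z_def u_def)
    have "(norm w)\<^sup>2 * m \<le> (norm w)\<^sup>2 * G (U, \<psi>) q u u"
      using z0_min[OF z] q inv by (intro mult_left_mono) (auto simp: m_def)
    also have "\<dots> = G (U, \<psi>) q w w"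
      using metric_scale[OF c q(1), of "norm w" u] wu by simp
    finally have "(norm w)\<^sup>2 * m \<le> 1" using w by linarith
    then have "(norm w)\<^sup>2 \<le> 1 / m" using \<open>m > 0\<close> by (simp add: field_simps)
    then have nw: "norm w \<le> 1 / sqrt m" using real_le_rsqrt[of "norm w" "1 / m"] by (simp add: real_sqrt_divide)
    have "D_coord \<phi> U \<psi> q w = norm w * D_coord \<phi> U \<psi> q u"
      using linear_scale[OF lin, of "\<psi> q" "norm w" u] q wu by simp
    also have "\<bar>\<dots>\<bar> \<le> 1 / sqrt m * M"
      unfolding abs_mult using M[OF z] nw \<open>m > 0\<close> by (intro mult_mono) auto
    finally show ?thesis by simp
  qed
  define W where "W = U \<inter> \<psi> -` ball (\<psi> p) e"
  have "open W" unfolding W_def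
    using chart(1,3)[OF c] by (metis Int_commute continuous_on_open_vimage open_ball)
  moreover have "p \<in> W" using p e(1) by (simp add: W_def)
  moreover have "\<bar>D_coord \<phi> V \<eta> q w\<bar> \<le> M / sqrt m"
    if "(V, \<eta>) \<in> A" "q \<in> V" "q \<in> W" "G (V, \<eta>) q w w \<le> 1" for V \<eta> q w
    using D_coord_transition[OF \<phi> that(1) c that(2)] metric_transition[OF that(1) c that(2)] that main
    by (simp add: W_def)
  ultimately show ?thesis by blast
qed

text \<open>Guarantees that the real \<open>Sup\<close> in \<open>D_sup_norm\<close> is a true
  supremum; by compactness finitely many local bounds suffice.\<close>

lemma bdd_above_derivative:
  assumes \<phi>: "\<phi> \<in> C1_functions A"
  shows "bdd_above {\<bar>D_coord \<phi> U \<psi> p w\<bar> | U \<psi> p w. (U, \<psi>) \<in> A \<and> p \<in> U \<and> G (U, \<psi>) p w w \<le> 1}"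
proof -
  define R where "R p W b \<longleftrightarrow> open W \<and> p \<in> W \<and> (\<forall>V \<eta> q w. (V, \<eta>) \<in> A \<longrightarrow> q \<in> V \<longrightarrow>
    q \<in> W \<longrightarrow> G (V, \<eta>) q w w \<le> 1 \<longrightarrow> \<bar>D_coord \<phi> V \<eta> q w\<bar> \<le> b)" for p W b
  have "\<forall>p. \<exists>W b. R p W b"
    using locally_bounded_derivative[OF \<phi>] unfolding R_def by simp
  then obtain W b where R: "\<And>p. R p (W p) (b p)" by metis
  have W: "\<And>p. open (W p)" "\<And>p. p \<in> W p" using R by (simp_all add: R_def)
  have b: "\<bar>D_coord \<phi> V \<eta> q w\<bar> \<le> b p"
    if "(V, \<eta>) \<in> A" "q \<in> V" "q \<in> W p" "G (V, \<eta>) q w w \<le> 1" for p V \<eta> q w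
    using R[of p] that unfolding R_def by simp
  have "UNIV \<subseteq> (\<Union>p\<in>UNIV. W p)" using W(2) by auto
  then obtain P where "P \<subseteq> UNIV" and P: "finite P" "UNIV \<subseteq> (\<Union>p\<in>P. W p)"
    by (rule compactE_image[OF compact_UNIV W(1)])
  then have "P \<noteq> {}" by auto
  show ?thesis
  proof (rule bdd_aboveI[where M = "Max (b ` P)"], clarify)
    fix U \<psi> q w assume q: "(U, \<psi>) \<in> A" "q \<in> U" "G (U, \<psi>) q w w \<le> 1"
    obtain p where p: "p \<in> P" "q \<in> W p" using P(2) by blast
    have "\<bar>D_coord \<phi> U \<psi> q w\<bar> \<le> b p" using b q p(2) by blast
    also have "\<dots> \<le> Max (b ` P)" using P(1) p(1) by auto
    finally show "\<bar>D_coord \<phi> U \<psi> q w\<bar> \<le> Max (b ` P)" .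
  qed
qed

lemma D_sup_norm_upper:
  assumes \<phi>: "\<phi> \<in> C1_functions A" and c: "(U, \<psi>) \<in> A" "p \<in> U"
  shows "\<bar>D_coord \<phi> U \<psi> p v\<bar> \<le> D_sup_norm A G \<phi> * sqrt (G (U, \<psi>) p v v)"
proof (cases "v = 0")
  case True
  then show ?thesis
    using linear_0[OF has_derivative_linear[OF has_derivative_coord[OF \<phi> c]]]
      bilinear_lzero[OF metric(1)[OF c]] by simp
next
  case False
  define l where "l = sqrt (G (U, \<psi>) p v v)"
  have l: "l > 0" "l\<^sup>2 = G (U, \<psi>) p v v" using metric(2)[OF c False] by (auto simp: l_def)
  have "G (U, \<psi>) p (v /\<^sub>R l) (v /\<^sub>R l) \<le> 1"
    unfolding metric_scale[OF c] using l by (simp add: power2_eq_square field_simps)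
  then have "\<bar>D_coord \<phi> U \<psi> p (v /\<^sub>R l)\<bar> \<le> D_sup_norm A G \<phi>"
    unfolding D_sup_norm_def by (intro cSup_upper bdd_above_derivative[OF \<phi>]) (use c in blast)
  moreover have "D_coord \<phi> U \<psi> p (v /\<^sub>R l) = D_coord \<phi> U \<psi> p v / l"
    using linear_scale[OF has_derivative_linear[OF has_derivative_coord[OF \<phi> c]], of "inverse l" v]
    by (simp only: real_scaleR_def divide_inverse_commute)
  ultimately show ?thesis
    using l(1) by (simp add: l_def[symmetric] abs_divide pos_divide_le_eq)
qed

lemma derivative_values_nonempty:
  "{\<bar>D_coord \<phi> U \<psi> p w\<bar> | U \<psi> p w. (U, \<psi>) \<in> A \<and> p \<in> U \<and> G (U, \<psi>) p w w \<le> 1} \<noteq> {}"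
proof -
  obtain U \<psi> where c: "(U, \<psi>) \<in> A" "undefined \<in> U" using chart_at by blast
  then have "G (U, \<psi>) undefined 0 0 \<le> 1" using bilinear_lzero[OF metric(1)[OF c]] by simp
  with c show ?thesis by blast
qed

lemma D_sup_norm_nonneg:
  assumes "\<phi> \<in> C1_functions A"
  shows "0 \<le> D_sup_norm A G \<phi>"
proof -
  define X where "X = {\<bar>D_coord \<phi> U \<psi> p w\<bar> | U \<psi> p w. (U, \<psi>) \<in> A \<and> p \<in> U \<and> G (U, \<psi>) p w w \<le> 1}"
  obtain d where d: "d \<in> X" using derivative_values_nonempty[of \<phi>] unfolding X_def by blast
  then have "0 \<le> d" by (auto simp: X_def)
  also have "d \<le> Sup X" using d bdd_above_derivative[OF assms] by (intro cSup_upper) (simp_all add: X_def)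
  finally show ?thesis by (simp add: D_sup_norm_def X_def)
qed

lemma D_sup_norm_scale:
  assumes \<phi>: "\<phi> \<in> C1_functions A"
  shows "(\<lambda>x. a * \<phi> x) \<in> C1_functions A" "D_sup_norm A G (\<lambda>x. a * \<phi> x) \<le> \<bar>a\<bar> * D_sup_norm A G \<phi>"
proof -
  have comp: "(\<lambda>x. a * \<phi> x) \<circ> inv_into U \<psi> = (\<lambda>y. a * (\<phi> \<circ> inv_into U \<psi>) y)" for U and \<psi> :: "'m \<Rightarrow> 'b"
    by auto
  show "(\<lambda>x. a * \<phi> x) \<in> C1_functions A"
    by (rule C1_functions_compose_real[OF \<phi>, of "\<lambda>t. a * t" "\<lambda>t. a"])
      (auto intro!: derivative_eq_intros)
  show "D_sup_norm A G (\<lambda>x. a * \<phi> x) \<le> \<bar>a\<bar> * D_sup_norm A G \<phi>"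
    unfolding D_sup_norm_def[of A G "\<lambda>x. a * \<phi> x"]
  proof (rule cSup_least)
    show "{\<bar>D_coord (\<lambda>x. a * \<phi> x) U \<psi> p w\<bar> | U \<psi> p w. (U, \<psi>) \<in> A \<and> p \<in> U \<and> G (U, \<psi>) p w w \<le> 1} \<noteq> {}"
      by (rule derivative_values_nonempty)
    fix d assume "d \<in> {\<bar>D_coord (\<lambda>x. a * \<phi> x) U \<psi> p w\<bar> | U \<psi> p w. (U, \<psi>) \<in> A \<and> p \<in> U \<and> G (U, \<psi>) p w w \<le> 1}"
    then obtain U \<psi> p w where d: "d = \<bar>D_coord (\<lambda>x. a * \<phi> x) U \<psi> p w\<bar>"
      and c: "(U, \<psi>) \<in> A" "p \<in> U" and w: "G (U, \<psi>) p w w \<le> 1" by blast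
    have "D_coord (\<lambda>x. a * \<phi> x) U \<psi> p = (\<lambda>v. a * D_coord \<phi> U \<psi> p v)"
      unfolding comp by (rule frechet_derivative_at[symmetric, OF has_derivative_mult_right[OF has_derivative_coord[OF \<phi> c]]])
    then have "d = \<bar>a\<bar> * \<bar>D_coord \<phi> U \<psi> p w\<bar>" by (simp add: d abs_mult)
    moreover have "D_sup_norm A G \<phi> * sqrt (G (U, \<psi>) p w w) \<le> D_sup_norm A G \<phi>"
      using w D_sup_norm_nonneg[OF \<phi>] by (simp add: mult_left_le)
    ultimately show "d \<le> \<bar>a\<bar> * D_sup_norm A G \<phi>"
      using D_sup_norm_upper[OF \<phi> c, of w] by (metis abs_ge_zero mult_left_mono order_trans)
  qed
qed

text \<open>On each piece the speed agrees off the end points with a continuous function, so that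
  the integral defining the length is not a junk value.\<close>

lemma C1_piece:
  assumes \<phi>: "\<phi> \<in> C1_functions A" and \<gamma>: "C1_curve_on A a b \<gamma>" and ab: "a < b"
  shows "curve_speed A G \<gamma> integrable_on {a..b}"
    "\<bar>\<phi> (\<gamma> b) - \<phi> (\<gamma> a)\<bar> \<le> D_sup_norm A G \<phi> * integral {a..b} (curve_speed A G \<gamma>)"
proof -
  have cont_\<gamma>: "continuous_on {a..b} \<gamma>" using \<gamma> by (simp add: C1_curve_on_def)
  define Dom where "Dom c = {t\<in>{a..b}. \<gamma> t \<in> fst c}" for c :: "('m, 'b) chart"
  have "\<forall>c\<in>A. \<exists>D. continuous_on (Dom c) D \<and>
      (\<forall>t\<in>Dom c. ((snd c \<circ> \<gamma>) has_vector_derivative D t) (at t within {a..b}))"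
    using \<gamma> unfolding C1_curve_on_def Dom_def by (simp add: case_prod_beta)
  \<comment> \<open>\<open>V c\<close> is the velocity in the chart \<open>c\<close>; at the end
    points of the interval it is one-sided.\<close>
  then obtain V where V: "\<And>c. c \<in> A \<Longrightarrow> continuous_on (Dom c) (V c)"
    "\<And>c t. c \<in> A \<Longrightarrow> t \<in> Dom c \<Longrightarrow> ((snd c \<circ> \<gamma>) has_vector_derivative V c t) (at t within {a..b})"
    by metis
  \<comment> \<open>The same choice as in \<open>curve_speed\<close>; the selected chart may jump as
    \<open>t\<close> varies.\<close>
  define C where "C t = (SOME c. c \<in> A \<and> \<gamma> t \<in> fst c)" for t
  have C: "C t \<in> A" "\<gamma> t \<in> fst (C t)" for t
  proof -
    have "\<exists>c. c \<in> A \<and> \<gamma> t \<in> fst c" using chart_at[of "\<gamma> t"] by auto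
    from someI_ex[OF this] show "C t \<in> A" "\<gamma> t \<in> fst (C t)" by (simp_all add: C_def)
  qed
  define s where "s t = sqrt (G (C t) (\<gamma> t) (V (C t) t) (V (C t) t))" for t
  have nhd: "\<exists>T. open T \<and> t \<in> T \<and> T \<inter> {a..b} = \<gamma> -` N \<inter> {a..b}"
    if "open N" "t \<in> {a..b}" "\<gamma> t \<in> N" for N t
    using cont_\<gamma> that unfolding continuous_on_open_invariant by (metis Int_iff vimage_eq)
  have V_transition: "V (W, \<eta>) t = D_transition U \<psi> \<eta> (\<gamma> t) (V (U, \<psi>) t)"
    if c: "(U, \<psi>) \<in> A" "(W, \<eta>) \<in> A" and t: "t \<in> {a..b}" "\<gamma> t \<in> U" "\<gamma> t \<in> W" for U \<psi> W \<eta> t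
  proof -
    have V': "((\<psi> \<circ> \<gamma>) has_derivative (\<lambda>x. x *\<^sub>R V (U, \<psi>) t)) (at t within {a..b})"
      using V(2)[OF c(1), of t] t by (simp add: Dom_def has_vector_derivative_def)
    have lin: "linear (D_transition U \<psi> \<eta> (\<gamma> t))"
      by (rule has_derivative_linear[OF has_derivative_transition[OF c t(2,3)]])
    have "(\<eta> \<circ> inv_into U \<psi> has_derivative D_transition U \<psi> \<eta> (\<gamma> t)) (at ((\<psi> \<circ> \<gamma>) t))"
      using has_derivative_transition[OF c t(2,3)] by simp
    from diff_chain_within[OF V' has_derivative_at_withinI[OF this]]
    have "((\<eta> \<circ> inv_into U \<psi>) \<circ> (\<psi> \<circ> \<gamma>) has_derivative
        D_transition U \<psi> \<eta> (\<gamma> t) \<circ> (\<lambda>x. x *\<^sub>R V (U, \<psi>) t)) (at t within {a..b})"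
      .
    moreover have "\<forall>\<^sub>F x in at t within {a..b}. ((\<eta> \<circ> inv_into U \<psi>) \<circ> (\<psi> \<circ> \<gamma>)) x = (\<eta> \<circ> \<gamma>) x"
    proof -
      obtain T where T: "open T" "t \<in> T" "T \<inter> {a..b} = \<gamma> -` U \<inter> {a..b}"
        using nhd[OF chart(1)[OF c(1)] t(1,2)] by blast
      have "((\<eta> \<circ> inv_into U \<psi>) \<circ> (\<psi> \<circ> \<gamma>)) x = (\<eta> \<circ> \<gamma>) x" if "x \<in> T" "x \<in> {a..b}" for x
      proof -
        have "\<gamma> x \<in> U" using T(3) that by blast
        then show ?thesis using chart(5)[OF c(1)] by simp
      qed
      then show ?thesis using T(1,2) unfolding eventually_at_topological by blast
    qed
    ultimately have "((\<eta> \<circ> \<gamma>) has_derivative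
        D_transition U \<psi> \<eta> (\<gamma> t) \<circ> (\<lambda>x. x *\<^sub>R V (U, \<psi>) t)) (at t within {a..b})"
      by (rule has_derivative_transform_eventually) (use t chart(5)[OF c(1)] in auto)
    then have "((\<eta> \<circ> \<gamma>) has_vector_derivative D_transition U \<psi> \<eta> (\<gamma> t) (V (U, \<psi>) t)) (at t within {a..b})"
      unfolding has_vector_derivative_def by (simp only: comp_apply linear_scale[OF lin] o_def[of "D_transition U \<psi> \<eta> (\<gamma> t)"])
    moreover have "((\<eta> \<circ> \<gamma>) has_vector_derivative V (W, \<eta>) t) (at t within {a..b})"
      using V(2)[OF c(2), of t] t by (simp add: Dom_def)
    ultimately show ?thesis
      using vector_derivative_unique_within_closed_interval[OF ab, of t] t(1)
      by (metis box_real(2))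
  qed
  \<comment> \<open>Near each time \<open>s\<close> equals its expression in one fixed chart, since
    velocity and metric transform consistently. The jumps of \<open>C\<close> therefore do not
    show.\<close>
  have "continuous_on {a..b} s"
    unfolding continuous_on_eq_continuous_within
  proof
    fix t0 assume t0: "t0 \<in> {a..b}"
    obtain U \<psi> where c: "(U, \<psi>) \<in> A" "\<gamma> t0 \<in> U" using chart_at by blast
    have "continuous_on (Dom (U, \<psi>)) (\<lambda>t. sqrt (G (U, \<psi>) (\<gamma> t) (V (U, \<psi>) t) (V (U, \<psi>) t)))"
      by (intro continuous_on_real_sqrt continuous_on_metric_compose[OF c(1)] V(1)[OF c(1)])
        (auto simp: Dom_def intro: continuous_on_subset[OF cont_\<gamma>])
    then have "continuous_on (Dom (U, \<psi>)) s"
    proof (rule continuous_on_eq)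
      fix t assume t: "t \<in> Dom (U, \<psi>)"
      obtain W \<eta> where W: "C t = (W, \<eta>)" by fastforce
      show "sqrt (G (U, \<psi>) (\<gamma> t) (V (U, \<psi>) t) (V (U, \<psi>) t)) = s t"
        using metric_transition[OF c(1), of W \<eta> "\<gamma> t"] V_transition[OF c(1), of W \<eta> t] C[of t] t
        by (simp add: s_def W Dom_def)
    qed
    moreover obtain T where T: "open T" "t0 \<in> T" "T \<inter> {a..b} = \<gamma> -` U \<inter> {a..b}"
      using nhd[OF chart(1)[OF c(1)] t0 c(2)] by blast
    have "Dom (U, \<psi>) = \<gamma> -` U \<inter> {a..b}" unfolding Dom_def fst_conv by blast
    then have "Dom (U, \<psi>) = T \<inter> {a..b}" using T(3) by simp
    then have "Dom (U, \<psi>) \<inter> T - {t0} = {a..b} \<inter> T - {t0}" by blast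
    from at_within_nhd[OF T(2,1) this]
    have "at t0 within Dom (U, \<psi>) = at t0 within {a..b}" .
    moreover have "t0 \<in> Dom (U, \<psi>)" using t0 c(2) by (simp add: Dom_def)
    ultimately show "continuous (at t0 within {a..b}) s"
      unfolding continuous_on_eq_continuous_within by metis
  qed
  then have s_int: "s integrable_on {a..b}" by (rule integrable_continuous_interval)
  have V_at: "((snd (C t) \<circ> \<gamma>) has_vector_derivative V (C t) t) (at t)" if "t \<in> {a<..<b}" for t
    using V(2)[of "C t" t] C[of t] that by (simp add: Dom_def at_within_Icc_at)
  have speed: "curve_speed A G \<gamma> t = s t" if "t \<in> {a<..<b}" for t
    using vector_derivative_at[OF V_at[OF that]]
    by (simp add: curve_speed_def s_def Let_def flip: C_def)
  have spike: "curve_speed A G \<gamma> t = s t" if "t \<in> {a..b} - {a, b}" for t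
    using that by (intro speed) auto
  show "curve_speed A G \<gamma> integrable_on {a..b}"
    by (rule integrable_spike_finite[OF _ _ s_int, of "{a, b}"]) (simp, rule spike)
  have "integral {a..b} (curve_speed A G \<gamma>) = integral {a..b} s"
    by (rule integral_spike[of "{a, b}"]) (use spike in auto)
  have lin: "\<bar>D_coord \<phi> (fst (C t)) (snd (C t)) (\<gamma> t) v\<bar>
      \<le> D_sup_norm A G \<phi> * sqrt (G (C t) (\<gamma> t) v v)" for t v
    using D_sup_norm_upper[OF \<phi>, of "fst (C t)" "snd (C t)" "\<gamma> t" v] C[of t] by simp
  define d where "d t = D_coord \<phi> (fst (C t)) (snd (C t)) (\<gamma> t) (V (C t) t)" for t
  \<comment> \<open>Two-sided derivatives are available only inside the interval, hence the
    fundamental theorem in its form for interior points.\<close>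
  have "(d has_integral (\<phi> \<circ> \<gamma>) b - (\<phi> \<circ> \<gamma>) a) {a..b}"
  proof (rule fundamental_theorem_of_calculus_interior)
    show "continuous_on {a..b} (\<phi> \<circ> \<gamma>)"
      by (intro continuous_on_compose cont_\<gamma> continuous_on_subset[OF C1_functions_continuous[OF \<phi>]]) simp
    fix t assume t: "t \<in> {a<..<b}"
    obtain U \<psi> where C_t: "C t = (U, \<psi>)" by fastforce
    have c: "(U, \<psi>) \<in> A" "\<gamma> t \<in> U" using C[of t] by (simp_all add: C_t)
    have "((\<phi> \<circ> inv_into U \<psi>) has_derivative D_coord \<phi> U \<psi> (\<gamma> t)) (at ((\<psi> \<circ> \<gamma>) t))"
      using has_derivative_coord[OF \<phi> c] by simp
    moreover have "((\<psi> \<circ> \<gamma>) has_derivative (\<lambda>x. x *\<^sub>R V (C t) t)) (at t)"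
      using V_at[OF t] by (simp add: C_t has_vector_derivative_def)
    ultimately have "((\<phi> \<circ> inv_into U \<psi>) \<circ> (\<psi> \<circ> \<gamma>) has_derivative
        D_coord \<phi> U \<psi> (\<gamma> t) \<circ> (\<lambda>x. x *\<^sub>R V (C t) t)) (at t)"
      by (rule diff_chain_at[rotated])
    then have "((\<phi> \<circ> \<gamma>) has_derivative D_coord \<phi> U \<psi> (\<gamma> t) \<circ> (\<lambda>x. x *\<^sub>R V (C t) t)) (at t)"
    proof -
      assume *: "((\<phi> \<circ> inv_into U \<psi>) \<circ> (\<psi> \<circ> \<gamma>) has_derivative
        D_coord \<phi> U \<psi> (\<gamma> t) \<circ> (\<lambda>x. x *\<^sub>R V (C t) t)) (at t)"
      obtain T where T: "open T" "t \<in> T" "T \<inter> {a..b} = \<gamma> -` U \<inter> {a..b}"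
        using nhd[OF chart(1)[OF c(1)] _ c(2)] t by auto
      have "((\<phi> \<circ> inv_into U \<psi>) \<circ> (\<psi> \<circ> \<gamma>)) x = (\<phi> \<circ> \<gamma>) x" if "x \<in> T \<inter> {a<..<b}" for x
      proof -
        have "x \<in> T \<inter> {a..b}" using that by auto
        then have "\<gamma> x \<in> U" using T(3) by blast
        then show ?thesis using chart(5)[OF c(1)] by simp
      qed
      moreover have "open (T \<inter> {a<..<b})" "t \<in> T \<inter> {a<..<b}" using T(1,2) t by auto
      ultimately show ?thesis
        using has_derivative_transform_within_open[OF *, of "T \<inter> {a<..<b}" "\<phi> \<circ> \<gamma>"] by metis
    qed
    then show "((\<phi> \<circ> \<gamma>) has_vector_derivative d t) (at t)"
      unfolding has_vector_derivative_def d_def C_t fst_conv snd_conv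
      by (simp only: linear_scale[OF has_derivative_linear[OF has_derivative_coord[OF \<phi> c]]]
          o_def[of "D_coord \<phi> U \<psi> (\<gamma> t)"] real_scaleR_def)
  qed (use ab in simp)
  then have d: "d integrable_on {a..b}" "integral {a..b} d = \<phi> (\<gamma> b) - \<phi> (\<gamma> a)"
    by (auto simp: has_integral_iff)
  have "norm (integral {a..b} d) \<le> integral {a..b} (\<lambda>t. D_sup_norm A G \<phi> * s t)"
    by (rule integral_norm_bound_integral[OF d(1) integrable_on_cmult_left[OF s_int, simplified]])
      (use lin in \<open>auto simp: d_def s_def\<close>)
  then show "\<bar>\<phi> (\<gamma> b) - \<phi> (\<gamma> a)\<bar> \<le> D_sup_norm A G \<phi> * integral {a..b} (curve_speed A G \<gamma>)"
    using d(2) \<open>integral {a..b} (curve_speed A G \<gamma>) = integral {a..b} s\<close> by simp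
qed

text \<open>Induction on the number of break points before \<open>c\<close>; the last of them starts
  the piece that ends at \<open>c\<close>.\<close>

lemma C1_curve_le_length:
  assumes \<phi>: "\<phi> \<in> C1_functions A" and \<gamma>: "piecewise_C1_curve A \<gamma>"
  shows "\<bar>\<phi> (\<gamma> 1) - \<phi> (\<gamma> 0)\<bar> \<le> D_sup_norm A G \<phi> * curve_length A G \<gamma>"
proof -
  let ?s = "curve_speed A G \<gamma>" and ?N = "D_sup_norm A G \<phi>"
  from \<gamma>[unfolded piecewise_C1_curve_def] obtain S where "finite S \<and> {0, 1} \<subseteq> S \<and> S \<subseteq> {0..1} \<and>
      (\<forall>a\<in>S. \<forall>b\<in>S. a < b \<and> {a<..<b} \<inter> S = {} \<longrightarrow> C1_curve_on A a b \<gamma>)"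
    by (rule exE)
  then have S: "finite S" "{0, 1} \<subseteq> S" "S \<subseteq> {0..1}"
    and pieces: "\<And>a b. a \<in> S \<Longrightarrow> b \<in> S \<Longrightarrow> a < b \<Longrightarrow> {a<..<b} \<inter> S = {} \<Longrightarrow> C1_curve_on A a b \<gamma>"
    by simp_all
  have "?s integrable_on {0..c} \<and> \<bar>\<phi> (\<gamma> c) - \<phi> (\<gamma> 0)\<bar> \<le> ?N * integral {0..c} ?s" if "c \<in> S" for c
    using that
  proof (induction "card {t\<in>S. t < c}" arbitrary: c rule: less_induct)
    case less
    show ?case
    proof (cases "c = 0")
      case False
      then have c: "0 < c" using less.prems S(3) by force
      define a where "a = Max {t\<in>S. t < c}"
      have fin: "finite {t\<in>S. t < c}" and ne: "{t\<in>S. t < c} \<noteq> {}" using S c by auto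
      have a: "a \<in> S" "a < c" using Max_in[OF fin ne] unfolding a_def by auto
      have between: "{a<..<c} \<inter> S = {}"
      proof -
        have "t \<le> a" if "t \<in> S" "t < c" for t using that fin by (simp add: a_def)
        then show ?thesis by force
      qed
      have "card {t\<in>S. t < a} < card {t\<in>S. t < c}"
        using a by (intro psubset_card_mono fin) auto
      from less.hyps[OF this a(1)]
      have IH: "?s integrable_on {0..a}" "\<bar>\<phi> (\<gamma> a) - \<phi> (\<gamma> 0)\<bar> \<le> ?N * integral {0..a} ?s" by auto
      note piece = C1_piece[OF \<phi> pieces[OF a(1) less.prems a(2) between] a(2)]
      have a0: "0 \<le> a" using a(1) S(3) by auto
      have int: "?s integrable_on {0..c}"
        by (rule Henstock_Kurzweil_Integration.integrable_combine[OF a0 _ IH(1) piece(1)]) (use a in simp)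
      have "integral {0..c} ?s = integral {0..a} ?s + integral {a..c} ?s"
        by (rule Henstock_Kurzweil_Integration.integral_combine[symmetric, OF a0 _ int]) (use a in simp)
      then have "?N * integral {0..c} ?s = ?N * integral {0..a} ?s + ?N * integral {a..c} ?s"
        by (simp add: distrib_left)
      then show ?thesis using int IH(2) piece(2) by linarith
    qed (use integrable_on_refl[of ?s 0] in simp)
  qed
  then show ?thesis using S(2) unfolding curve_length_def by blast
qed

text \<open>An almost shortest curve gives the estimate up to any positive error. Such a curve
  exists because the infimum defining the distance is finite.\<close>

lemma C1_functions_lipschitz:
  assumes \<phi>: "\<phi> \<in> C1_functions A"
  shows "\<bar>\<phi> x - \<phi> y\<bar> \<le> D_sup_norm A G \<phi> * dist x y"
proof (rule field_le_epsilon)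
  fix e :: real assume e: "e > 0"
  let ?N = "D_sup_norm A G \<phi>"
  note N = D_sup_norm_nonneg[OF \<phi>]
  \<comment> \<open>The norm may be 0, hence the added 1.\<close>
  define \<epsilon> where "\<epsilon> = e / (?N + 1)"
  have \<epsilon>: "\<epsilon> > 0" "?N * \<epsilon> \<le> e" using e N by (auto simp: \<epsilon>_def field_simps)
  have "ereal (dist x y) = (INF \<gamma>\<in>{\<gamma>. piecewise_C1_curve A \<gamma> \<and> \<gamma> 0 = x \<and> \<gamma> 1 = y}. ereal (curve_length A G \<gamma>))"
    using manifold unfolding compact_riemannian_manifold_def induced_distance_def by blast
  moreover have "ereal (dist x y) < ereal (dist x y + \<epsilon>)" using \<epsilon> by simp
  ultimately have "(INF \<gamma>\<in>{\<gamma>. piecewise_C1_curve A \<gamma> \<and> \<gamma> 0 = x \<and> \<gamma> 1 = y}. ereal (curve_length A G \<gamma>))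
      < ereal (dist x y + \<epsilon>)" by simp
  then obtain \<gamma> where \<gamma>: "piecewise_C1_curve A \<gamma>" "\<gamma> 0 = x" "\<gamma> 1 = y"
    and len: "curve_length A G \<gamma> < dist x y + \<epsilon>"
    unfolding INF_less_iff by auto
  have "\<bar>\<phi> x - \<phi> y\<bar> \<le> ?N * curve_length A G \<gamma>"
    using C1_curve_le_length[OF \<phi> \<gamma>(1)] \<gamma> by (simp add: abs_minus_commute)
  also have "\<dots> \<le> ?N * (dist x y + \<epsilon>)" using N len by (intro mult_left_mono) auto
  also have "\<dots> \<le> ?N * dist x y + e" using \<epsilon> by (simp add: distrib_left)
  finally show "\<bar>\<phi> x - \<phi> y\<bar> \<le> ?N * dist x y + e" .
qed

section \<open>Bump functions\<close>

lemma bump_at_point: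
  assumes N: "open N" "p \<in> N"
  obtains k where "k \<in> C1_functions A" "\<And>x. 0 \<le> k x" "\<And>x. x \<notin> N \<Longrightarrow> k x = 0" "1 < k p"
proof -
  obtain U \<psi> where c: "(U, \<psi>) \<in> A" and p: "p \<in> U" using chart_at by blast
  note inv = inv_into_f_f[OF chart(5)[OF c]]
  obtain e where e: "e > 0" "cball (\<psi> p) e \<subseteq> \<psi> ` (U \<inter> N)"
    using open_contains_cball_eq[OF open_chart_image[OF c N(1)]] p N(2) by blast
  \<comment> \<open>The factor makes the value at \<open>p\<close> equal to 2. The argument is the
    squared coordinate distance, so that no norm has to be differentiated.\<close>
  define \<beta> where "\<beta> t = 2 / e ^ 4 * (max 0 (e\<^sup>2 - t))\<^sup>2" for t :: real
  define k where "k x = (if x \<in> U then \<beta> ((\<psi> x - \<psi> p) \<bullet> (\<psi> x - \<psi> p)) else 0)" for x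
  have \<beta>_deriv: "(\<beta> has_real_derivative 2 / e ^ 4 * (2 * max 0 (e\<^sup>2 - t) * (- 1))) (at t)" for t
    unfolding \<beta>_def
    by (rule DERIV_cmult DERIV_chain2[OF has_real_derivative_max_0_sq])+ (auto intro!: derivative_eq_intros)
  have \<beta>_cont: "continuous_on UNIV (\<lambda>t. 2 / e ^ 4 * (2 * max 0 (e\<^sup>2 - t) * (- 1)))"
    by (intro continuous_intros)
  have zero: "k x = 0" if "x \<in> U \<Longrightarrow> \<psi> x \<notin> cball (\<psi> p) e" for x
  proof (cases "x \<in> U")
    case True
    then have "e \<le> norm (\<psi> x - \<psi> p)" using that by (simp add: dist_norm norm_minus_commute)
    then have "e\<^sup>2 \<le> (\<psi> x - \<psi> p) \<bullet> (\<psi> x - \<psi> p)"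
      using e(1) by (metis less_imp_le power2_norm_eq_inner power_mono)
    then show ?thesis by (simp add: k_def \<beta>_def)
  qed (simp add: k_def)
  \<comment> \<open>Compact, hence closed in the whole manifold, and \<open>k\<close> vanishes off
    it. A point outside the chart domain therefore has a neighbourhood on which \<open>k\<close> is
    constantly 0.\<close>
  let ?C = "inv_into U \<psi> ` cball (\<psi> p) e"
  have sub: "cball (\<psi> p) e \<subseteq> \<psi> ` U" using e(2) by blast
  have clC: "closed ?C"
    by (intro compact_imp_closed compact_continuous_image compact_cball
        continuous_on_subset[OF chart(4)[OF c] sub])
  have CU: "?C \<subseteq> U" by (intro image_subsetI inv_into_into) (use sub in blast)
  have "k \<in> C1_functions A"
  proof (intro C1_functionsI C1_on_locally)
    fix V \<eta> y assume d: "(V, \<eta>) \<in> A" and y: "y \<in> \<eta> ` V"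
    note inv' = inv_into_f_f[OF chart(5)[OF d]]
    show "\<exists>T. open T \<and> y \<in> T \<and> Ck_on 1 T (k \<circ> inv_into V \<eta>)"
    proof (cases "inv_into V \<eta> y \<in> U")
      case True
      have "Ck_on 1 (\<eta> ` (V \<inter> U)) (\<lambda>y. \<beta> (((\<psi> \<circ> inv_into V \<eta>) y - \<psi> p) \<bullet> ((\<psi> \<circ> inv_into V \<eta>) y - \<psi> p)))"
        by (rule C1_on_compose_real[OF C1_on_norm_diff_sq[OF C1_transition[OF d c]] \<beta>_deriv \<beta>_cont])
      then have "Ck_on 1 (\<eta> ` (V \<inter> U)) (k \<circ> inv_into V \<eta>)"
        by (rule C1_on_cong[OF open_chart_image[OF d chart(1)[OF c]], rotated]) (auto simp: k_def inv')
      moreover have "y \<in> \<eta> ` (V \<inter> U)" using y True inv' by auto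
      ultimately show ?thesis using open_chart_image[OF d chart(1)[OF c]] by blast
    next
      case False
      have op: "open (\<eta> ` (V \<inter> - ?C))" using open_chart_image[OF d] clC by blast
      have "Ck_on 1 (\<eta> ` (V \<inter> - ?C)) (k \<circ> inv_into V \<eta>)"
      proof (rule C1_on_cong[OF op _ C1_on_const[of _ 0]])
        fix y assume "y \<in> \<eta> ` (V \<inter> - ?C)"
        then obtain x where x: "x \<in> V" "x \<notin> ?C" "y = \<eta> x" by blast
        have "k x = 0"
        proof (rule zero)
          assume "x \<in> U"
          then show "\<psi> x \<notin> cball (\<psi> p) e" using x(2) inv by (metis imageI)
        qed
        then show "0 = (k \<circ> inv_into V \<eta>) y" using x inv' by simp
      qed
      moreover have "y \<in> \<eta> ` (V \<inter> - ?C)"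
      proof -
        obtain x where x: "x \<in> V" "y = \<eta> x" using y by blast
        then have "x \<notin> U" using False inv' by simp
        then have "x \<in> V \<inter> - ?C" using x(1) CU by blast
        then show ?thesis using x(2) by blast
      qed
      ultimately show ?thesis using op by blast
    qed
  qed
  moreover have "0 \<le> k x" for x by (simp add: k_def \<beta>_def)
  moreover have "k x = 0" if "x \<notin> N" for x
  proof (rule zero)
    assume "x \<in> U"
    then show "\<psi> x \<notin> cball (\<psi> p) e"
      using e(2) that chart(5)[OF c] by (metis Int_iff image_iff inj_onD subsetD)
  qed
  moreover have "1 < k p"
  proof -
    have "(e\<^sup>2)\<^sup>2 = e ^ 4" by (simp flip: power_mult)
    then have "k p = 2" using p e(1) by (simp add: k_def \<beta>_def)
    then show ?thesis by simp
  qed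
  ultimately show thesis using that by blast
qed

text \<open>\<open>w\<close> is 0 where some bump exceeds 1, which includes a whole neighbourhood of
  the cycle, and 1 off the balls, where all bumps vanish. Thus \<open>w\<close> does not depend on
  the perturbation and still vanishes on every perturbed cycle with displacement below
  \<open>\<epsilon>\<close>.\<close>

lemma bump_off_finite_set:
  assumes "finite \<O>" "r > 0"
  obtains w \<epsilon> where "w \<in> C1_functions A" "\<And>x. 0 \<le> w x" "\<And>x. w x < 1 \<Longrightarrow> \<exists>y\<in>\<O>. dist x y < r"
    "\<epsilon> > 0" "\<And>x y. y \<in> \<O> \<Longrightarrow> dist x y < \<epsilon> \<Longrightarrow> w x = 0"
proof -
  have "\<exists>k. k \<in> C1_functions A \<and> (\<forall>x. 0 \<le> k x) \<and> (\<forall>x. x \<notin> ball p r \<longrightarrow> k x = 0) \<and> 1 < k p" for p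
    by (rule bump_at_point[of "ball p r" p]) (use assms(2) in auto)
  then obtain k where k: "\<And>p. k p \<in> C1_functions A" "\<And>p x. 0 \<le> k p x"
    "\<And>p x. x \<notin> ball p r \<Longrightarrow> k p x = 0" "\<And>p. 1 < k p p" by metis
  define w where "w x = (max 0 (1 - (\<Sum>p\<in>\<O>. k p x)))\<^sup>2" for x
  have "w \<in> C1_functions A"
  proof -
    have "((\<lambda>t. (max 0 (1 - t))\<^sup>2) has_real_derivative 2 * max 0 (1 - t) * (- 1)) (at t)" for t :: real
      by (rule DERIV_chain2[OF has_real_derivative_max_0_sq]) (auto intro!: derivative_eq_intros)
    then show ?thesis
      unfolding w_def
      by (rule C1_functions_compose_real[OF C1_functions_sum[OF assms(1) k(1)]]) (intro continuous_intros)
  qed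
  moreover have "\<exists>y\<in>\<O>. dist x y < r" if "w x < 1" for x
  proof (rule ccontr)
    assume "\<not> ?thesis"
    then have "(\<Sum>p\<in>\<O>. k p x) = 0" using k(3) by (intro sum.neutral) (auto simp: dist_commute)
    then show False using that by (simp add: w_def)
  qed
  moreover have "\<exists>\<epsilon>>0. \<forall>x. \<forall>y\<in>\<O>. dist x y < \<epsilon> \<longrightarrow> w x = 0"
  proof -
    have "\<exists>\<epsilon>>0. \<forall>x. dist x y < \<epsilon> \<longrightarrow> 1 < k y x" for y
    proof -
      have "open {x. 1 < k y x}"
        by (intro open_Collect_less continuous_on_const C1_functions_continuous k(1))
      then show ?thesis using k(4)[of y] unfolding open_dist by blast
    qed
    then obtain \<epsilon> where \<epsilon>: "\<And>y. \<epsilon> y > 0" "\<And>y x. dist x y < \<epsilon> y \<Longrightarrow> 1 < k y x" by metis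
    define e where "e = Min (insert 1 (\<epsilon> ` \<O>))"
    have "e > 0" using assms(1) \<epsilon>(1) by (simp add: e_def)
    moreover have "w x = 0" if "y \<in> \<O>" "dist x y < e" for x y
    proof -
      have "e \<le> \<epsilon> y" using assms(1) that(1) by (simp add: e_def)
      then have "1 < k y x" using \<epsilon>(2) that(2) by force
      also have "\<dots> \<le> (\<Sum>p\<in>\<O>. k p x)" using assms(1) that(1) k(2) by (intro member_le_sum) auto
      finally show ?thesis by (simp add: w_def)
    qed
    ultimately show ?thesis by blast
  qed
  moreover have "0 \<le> w x" for x by (simp add: w_def)
  ultimately show thesis using that by blast
qed

end

section \<open>The theorem\<close>

theorem theorem2p4:
  fixes A :: "('m::metric_space, 'b::euclidean_space) chart set"
    and G :: "('m, 'b) metric_coords"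
    and F :: "('m \<Rightarrow> 'm) topology"
    and f :: "'m \<Rightarrow> 'm"
    and \<O> :: "'m set"
  assumes "compact_riemannian_manifold A G"
    and "\<And>g. g \<in> topspace F \<Longrightarrow> \<exists>L. L-lipschitz_on UNIV g"
    and "stably_hyperbolic F f"
    and "periodic_orbit f \<O>"
  shows "\<exists>U C h i. openin F U \<and> f \<in> U \<and> C > 0 \<and>
    (\<forall>g\<in>U. intertwines f g (h g) \<and> intertwines g f (i g)) \<and>
    (\<forall>\<epsilon>>0. \<exists>W. openin F W \<and> f \<in> W \<and> W \<subseteq> U \<and>
       (\<forall>g\<in>W. d_inf_id (nonwandering f) (h g) < \<epsilon> \<and> d_inf_id (nonwandering g) (i g) < \<epsilon>)) \<and>
    (\<forall>g\<in>U.
       let \<O>\<^sub>g = h g ` \<O>;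
           d\<^sub>g = max (d_inf_id (nonwandering f) (h g)) (d_inf_id (nonwandering g) (i g))
       in \<exists>v\<in>C1_functions A.
            D_sup_norm A G v \<le> 3 * C * sqrt d\<^sub>g \<and>
            orbit_measure \<O>\<^sub>g \<in> maximizing_measures g v \<and>
            (\<forall>\<phi>\<in>C1_functions A. maximizing_measures f \<phi> = {orbit_measure \<O>} \<longrightarrow>
               maximizing_measures g (\<lambda>x. \<phi> x + D_sup_norm A G \<phi> * v x) = {orbit_measure \<O>\<^sub>g}))"
proof -
  interpret riemannian_manifold A G using assms(1) by unfold_locales
  note comp = compact_UNIV
  have f_top: "f \<in> topspace F" and IS: "cond_IS F f" and rhe: "cond_RHE F f" and ml: "cond_ML f"
    using assms(3) by (simp_all add: stably_hyperbolic_def)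
  have cont: "continuous_on UNIV g" if "g \<in> topspace F" for g
    using assms(2)[OF that] lipschitz_on_continuous_on by blast
  note cont_f = cont[OF f_top]
  obtain P where P: "P \<ge> 1" "\<And>y. y \<in> \<O> \<Longrightarrow> (f ^^ P) y = y"
    and orbit: "finite \<O>" "\<O> \<noteq> {}" "f ` \<O> = \<O>" "\<O> \<subseteq> nonwandering f"
      "\<And>x y. x \<in> \<O> \<Longrightarrow> y \<in> \<O> \<Longrightarrow> \<exists>n. y = (f ^^ n) x"
    using periodic_orbitE[OF assms(4)] by metis
  have ne: "nonwandering f \<noteq> {}" using orbit(2,4) by auto
  obtain L where L: "0 < L" "\<And>\<phi> D. 0 \<le> D \<Longrightarrow> (\<And>x y. \<bar>\<phi> x - \<phi> y\<bar> \<le> D * dist x y) \<Longrightarrow>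
      \<exists>u. (\<forall>x\<in>nonwandering f. \<forall>y\<in>nonwandering f. \<bar>u x - u y\<bar> \<le> L * D * dist x y) \<and>
        (\<forall>x\<in>nonwandering f. \<phi> x + u x - u (f x) \<le> max_integral f \<phi>)"
    using lipschitz_subaction[OF ml ne] by auto
  from rhe[unfolded cond_RHE_def] obtain U1 K \<delta> \<Lambda> where U1: "openin F U1" "f \<in> U1"
    and K: "K > 0" and \<delta>: "\<delta> > 0" and \<Lambda>: "\<Lambda> > 1"
    and hyp: "\<And>g x y n m. \<lbrakk>g \<in> U1; x \<in> nonwandering g; y \<in> nonwandering g;
      \<forall>m\<le>n. dist ((g ^^ m) x) ((g ^^ m) y) < \<delta>; m \<le> n\<rbrakk> \<Longrightarrow>
      dist ((g ^^ m) x) ((g ^^ m) y)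
        \<le> K * \<Lambda> powr (- real (min m (n - m))) * (dist x y + dist ((g ^^ n) x) ((g ^^ n) y))"
    by (elim exE conjE) metis
  define B where "B = 2 * LIP f"
  have B: "0 \<le> B" using assms(2)[OF f_top] LIP_nonneg by (auto simp: B_def)
  obtain s where s: "s > 0" "\<And>x y. x \<in> \<O> \<Longrightarrow> y \<in> \<O> \<Longrightarrow> dist x y < s \<Longrightarrow> x = y"
    using finite_set_separated[OF orbit(1)] by metis
  \<comment> \<open>The first bound gives \<open>2 * r \<le> \<delta>\<close>, the threshold of
    (RHE); the second gives \<open>2 * r + 2 * B * r \<le> s / 2\<close>.\<close>
  define r where "r = min (\<delta> / 2) (s / (4 + 4 * B))"
  have r: "0 < r" "2 * r \<le> \<delta>" using \<delta> s(1) B by (auto simp: r_def)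
  have "r * (4 + 4 * B) \<le> s" using B by (simp add: r_def pos_le_divide_eq[symmetric])
  moreover have "0 \<le> r * B" using r B by simp
  ultimately have rs: "2 * r + 2 * B * r < s" using r(1) by (simp add: algebra_simps)
  obtain w \<epsilon> where w: "w \<in> C1_functions A" "\<And>x. 0 \<le> w x" "\<And>x. w x < 1 \<Longrightarrow> \<exists>y\<in>\<O>. dist x y < r"
    and \<epsilon>: "\<epsilon> > 0" "\<And>x y. y \<in> \<O> \<Longrightarrow> dist x y < \<epsilon> \<Longrightarrow> w x = 0"
    using bump_off_finite_set[OF orbit(1) r(1)] by metis
  define D' where "D' = D_sup_norm A G w"
  have D': "0 \<le> D'" using D_sup_norm_nonneg[OF w(1)] by (simp add: D'_def)
  define \<kappa> where "\<kappa> = penalty K r \<Lambda> P L"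
  have \<kappa>: "0 < \<kappa>" using penalty_pos K r(1) \<Lambda> L(1) by (simp add: \<kappa>_def)
  \<comment> \<open>In turn: \<open>\<rho> \<le> r\<close> for shadowing; \<open>w\<close> vanishes
    on the perturbed cycle; \<open>\<rho> \<le> sqrt \<rho>\<close>; and
    \<open>\<kappa> * D' * sqrt \<rho> < 1\<close>, for potentials with zero derivative.\<close>
  define \<rho>0 where "\<rho>0 = min (min r \<epsilon>) (min 1 ((1 / (\<kappa> * (D' + 1)))\<^sup>2))"
  have \<kappa>D': "0 < \<kappa> * (D' + 1)" using \<kappa> D' by simp
  have "0 < (1 / (\<kappa> * (D' + 1)))\<^sup>2" using \<kappa>D' by (intro zero_less_power divide_pos_pos) auto
  then have \<rho>0: "0 < \<rho>0" using r(1) \<epsilon>(1) by (simp add: \<rho>0_def)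
  define d where "d g h i = max (d_inf_id (nonwandering f) h) (d_inf_id (nonwandering g) i)"
    for g h i :: "'m \<Rightarrow> 'm"
  have close: "\<exists>U. openin F U \<and> f \<in> U \<and> (\<forall>g\<in>U. LIP g < B \<and>
      (\<exists>h i. intertwines f g h \<and> intertwines g f i \<and> d g h i < e))" if "e > 0" for e
    using IS that unfolding cond_IS_def d_def B_def by (simp add: conj_assoc)
  \<comment> \<open>Half of \<open>\<rho>0\<close>, since the selected pair may be displaced twice
    as far as the best one.\<close>
  obtain U2 where U2: "openin F U2" "f \<in> U2" and U2': "\<And>g. g \<in> U2 \<Longrightarrow> LIP g < B \<and>
      (\<exists>h i. intertwines f g h \<and> intertwines g f i \<and> d g h i < \<rho>0 / 2)"
    using close[of "\<rho>0 / 2"] \<rho>0 by auto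
  define U where "U = U1 \<inter> U2"
  have U: "openin F U" "f \<in> U" using U1 U2 by (auto simp: U_def)
  have U_top: "g \<in> topspace F" if "g \<in> U" for g using openin_subset[OF U(1)] that by blast
  have "\<forall>g. \<exists>h i. g \<in> U \<longrightarrow> intertwines f g h \<and> intertwines g f i \<and>
      (\<forall>h' i'. intertwines f g h' \<longrightarrow> intertwines g f i' \<longrightarrow> d g h i \<le> 2 * d g h' i')"
  proof
    fix g
    show "\<exists>h i. g \<in> U \<longrightarrow> intertwines f g h \<and> intertwines g f i \<and>
      (\<forall>h' i'. intertwines f g h' \<longrightarrow> intertwines g f i' \<longrightarrow> d g h i \<le> 2 * d g h' i')"
    proof (cases "g \<in> U")
      case True
      then obtain h0 i0 where "intertwines f g h0" "intertwines g f i0"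
        using U2'[of g] by (auto simp: U_def)
      from near_optimal_intertwining[OF comp cont_f cont[OF U_top[OF True]] ne this]
      show ?thesis unfolding d_def by blast
    qed simp
  qed
  then obtain h i where hi: "\<And>g. g \<in> U \<Longrightarrow> intertwines f g (h g)" "\<And>g. g \<in> U \<Longrightarrow> intertwines g f (i g)"
    and opt: "\<And>g h' i'. g \<in> U \<Longrightarrow> intertwines f g h' \<Longrightarrow> intertwines g f i' \<Longrightarrow> d g (h g) (i g) \<le> 2 * d g h' i'"
    by metis
  have W: "\<exists>W. openin F W \<and> f \<in> W \<and> W \<subseteq> U \<and>
       (\<forall>g\<in>W. d_inf_id (nonwandering f) (h g) < e \<and> d_inf_id (nonwandering g) (i g) < e)" if "e > 0" for e
  proof -
    obtain W where W: "openin F W" "f \<in> W" "\<And>g. g \<in> W \<Longrightarrow>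
        \<exists>h i. intertwines f g h \<and> intertwines g f i \<and> d g h i < e / 2"
      using close[of "e / 2"] \<open>e > 0\<close> by auto
    have "d g (h g) (i g) < e" if g: "g \<in> W \<inter> U" for g
    proof -
      obtain h' i' where "intertwines f g h'" "intertwines g f i'" "d g h' i' < e / 2"
        using W(3)[of g] g by blast
      then show ?thesis using opt[of g h' i'] g by simp
    qed
    then show ?thesis
      using W(1,2) U by (intro exI[of _ "W \<inter> U"]) (auto simp: d_def)
  qed
  \<comment> \<open>The added 1 keeps \<open>C\<close> positive even if the derivative of
    \<open>w\<close> vanishes everywhere.\<close>
  define C where "C = \<kappa> * (D' + 1)"
  have "\<exists>v\<in>C1_functions A. D_sup_norm A G v \<le> 3 * C * sqrt (d g (h g) (i g)) \<and>
      orbit_measure (h g ` \<O>) \<in> maximizing_measures g v \<and>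
      (\<forall>\<phi>\<in>C1_functions A. maximizing_measures f \<phi> = {orbit_measure \<O>} \<longrightarrow>
         maximizing_measures g (\<lambda>x. \<phi> x + D_sup_norm A G \<phi> * v x) = {orbit_measure (h g ` \<O>)})"
    if g: "g \<in> U" for g
  proof -
    define \<rho> where "\<rho> = d g (h g) (i g)"
    have \<rho>_nonneg: "0 \<le> \<rho>"
      using d_inf_id_nonneg[OF comp ne, of "h g"] by (simp add: \<rho>_def d_def le_max_iff_disj)
    have "\<rho> < \<rho>0"
    proof -
      obtain h' i' where "intertwines f g h'" "intertwines g f i'" "d g h' i' < \<rho>0 / 2"
        using U2'[of g] g by (auto simp: U_def)
      then show ?thesis using opt[OF g, of h' i'] by (simp add: \<rho>_def)
    qed
    then have \<rho>: "\<rho> < r" "\<rho> < \<epsilon>" "\<rho> < 1" "\<rho> < (1 / (\<kappa> * (D' + 1)))\<^sup>2" by (simp_all add: \<rho>0_def)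
    have cont_g: "continuous_on UNIV g" by (rule cont[OF U_top[OF g]])
    have dist_h: "dist (h g x) x \<le> \<rho>" if "x \<in> nonwandering f" for x
      using dist_le_d_inf_id[OF comp that, of "h g"] by (simp add: \<rho>_def d_def)
    have dist_i: "dist (i g x) x \<le> \<rho>" if "x \<in> nonwandering g" for x
      using dist_le_d_inf_id[OF comp that, of "i g"] by (simp add: \<rho>_def d_def)
    interpret perturbed_orbit f g "h g" "i g" \<O> w \<rho> r B s K \<Lambda> P
    proof
      show "B-lipschitz_on UNIV g"
        using LIP_less_imp_lipschitz assms(2)[OF U_top[OF g]] U2'[of g] g by (auto simp: U_def)
      show "dist ((g ^^ m) x) ((g ^^ m) y)
          \<le> K * \<Lambda> powr (- real (min m (n - m))) * (dist x y + dist ((g ^^ n) x) ((g ^^ n) y))"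
        if "x \<in> nonwandering g" "y \<in> nonwandering g"
          "\<And>m. m \<le> n \<Longrightarrow> dist ((g ^^ m) x) ((g ^^ m) y) < 2 * r" "m \<le> n" for x y n m
      proof (rule hyp)
        show "\<forall>m\<le>n. dist ((g ^^ m) x) ((g ^^ m) y) < \<delta>" using that(3) r(2) by force
      qed (use g that in \<open>auto simp: U_def\<close>)
      show "w (h g y) = 0" if "y \<in> \<O>" for y
        using \<epsilon>(2)[OF that] dist_h[of y] orbit(4) that \<rho>(2) by force
      show "\<exists>n. y = (f ^^ n) x" if "x \<in> \<O>" "y \<in> \<O>" for x y by (rule orbit(5)[OF that])
    qed (use comp cont_g orbit P hi[OF g] dist_h dist_i s(2) \<rho>(1) r(1) rs K \<Lambda> w(2,3)
        C1_functions_continuous[OF w(1)] in auto)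
    \<comment> \<open>The factor \<open>D_sup_norm A G \<phi>\<close> in front of \<open>v\<close>
      supplies the Lipschitz constant of \<open>\<phi>\<close>, so that \<open>c\<close> itself does
      not involve \<open>\<phi>\<close>.\<close>
    define c where "c = 2 * \<kappa> * sqrt \<rho>"
    have c: "0 \<le> c" using \<kappa> \<rho>_nonneg by (simp add: c_def)
    define v where "v x = - c * w x" for x
    have v: "v \<in> C1_functions A" using D_sup_norm_scale(1)[OF w(1), of "- c"] by (simp add: v_def[abs_def])
    have "D_sup_norm A G v \<le> c * D'"
      using D_sup_norm_scale(2)[OF w(1), of "- c"] c by (simp add: v_def[abs_def] D'_def)
    also have "\<dots> \<le> 3 * C * sqrt \<rho>"
    proof -
      have "2 * \<kappa> * D' \<le> 3 * (\<kappa> * (D' + 1))" using \<kappa> D' by (simp add: algebra_simps)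
      from mult_right_mono[OF this, of "sqrt \<rho>"] show ?thesis
        using \<rho>_nonneg by (simp add: c_def C_def mult_ac)
    qed
    finally have v_norm: "D_sup_norm A G v \<le> 3 * C * sqrt \<rho>" .
    have "maximizing_measures g (\<lambda>x. \<phi> x + D_sup_norm A G \<phi> * v x) = {orbit_measure (h g ` \<O>)}"
      if \<phi>: "\<phi> \<in> C1_functions A" and max: "maximizing_measures f \<phi> = {orbit_measure \<O>}" for \<phi>
    proof (cases "\<rho> = 0")
      case True
      \<comment> \<open>With displacement 0 the map \<open>h g\<close> fixes the cycle pointwise and
        \<open>v\<close> is 0, so the claim reduces to the equality of the invariant
        measures.\<close>
      have "h g ` \<O> = \<O>" using dist_h orbit(4) True by force
      moreover have "invariant_measures f = invariant_measures g"
        by (rule invariant_measures_eq_if_dist_0[OF comp cont_f cont_g ne hi])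
          (use True in \<open>simp_all add: \<rho>_def d_def\<close>)
      then have "maximizing_measures g \<phi> = maximizing_measures f \<phi>"
        by (simp add: maximizing_measures_def max_integral_def)
      ultimately show ?thesis using max True by (simp add: v_def c_def)
    next
      case False
      then have \<rho>_pos: "0 < \<rho>" using \<rho>_nonneg by simp
      have small: "penalty K r \<Lambda> P L * D' * sqrt \<rho> < 1"
      proof -
        have "sqrt \<rho> < 1 / (\<kappa> * (D' + 1))"
          using \<rho>(4) \<kappa>D' by (intro real_less_lsqrt) auto
        then have "\<kappa> * (D' + 1) * sqrt \<rho> < 1" using \<kappa>D' by (simp add: field_simps)
        moreover have "\<kappa> * D' * sqrt \<rho> \<le> \<kappa> * (D' + 1) * sqrt \<rho>"
          using \<kappa> \<rho>_nonneg by (intro mult_right_mono mult_left_mono) auto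
        ultimately show ?thesis by (simp add: \<kappa>_def)
      qed
      have "maximizing_measures g
          (\<lambda>x. \<phi> x + D_sup_norm A G \<phi> * (- 2 * penalty K r \<Lambda> P L * sqrt \<rho> * w x)) =
          {orbit_measure (h g ` \<O>)}"
        by (rule maximizing_penalized[OF \<rho>_pos _ _ L(2) cont_f D' _ small D_sup_norm_nonneg[OF \<phi>]
              C1_functions_lipschitz[OF \<phi>] max])
          (use \<rho>(3) L(1) C1_functions_lipschitz[OF w(1)] in \<open>auto simp: D'_def\<close>)
      then show ?thesis by (simp add: v_def c_def \<kappa>_def)
    qed
    moreover have "orbit_measure (h g ` \<O>) \<in> maximizing_measures g v"
      using orbit_maximizing_nonpos_multiple[OF c] by (simp add: v_def[abs_def])
    ultimately show ?thesis using v v_norm unfolding \<rho>_def by blast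
  qed
  then have "\<forall>g\<in>U.
       let \<O>\<^sub>g = h g ` \<O>;
           d\<^sub>g = max (d_inf_id (nonwandering f) (h g)) (d_inf_id (nonwandering g) (i g))
       in \<exists>v\<in>C1_functions A.
            D_sup_norm A G v \<le> 3 * C * sqrt d\<^sub>g \<and>
            orbit_measure \<O>\<^sub>g \<in> maximizing_measures g v \<and>
            (\<forall>\<phi>\<in>C1_functions A. maximizing_measures f \<phi> = {orbit_measure \<O>} \<longrightarrow>
               maximizing_measures g (\<lambda>x. \<phi> x + D_sup_norm A G \<phi> * v x) = {orbit_measure \<O>\<^sub>g})"
    unfolding Let_def d_def by blast
  moreover have "0 < C" using \<kappa>D' by (simp add: C_def)
  moreover have "\<forall>g\<in>U. intertwines f g (h g) \<and> intertwines g f (i g)" using hi by simp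
  moreover have "\<forall>\<epsilon>>0. \<exists>W. openin F W \<and> f \<in> W \<and> W \<subseteq> U \<and>
       (\<forall>g\<in>W. d_inf_id (nonwandering f) (h g) < \<epsilon> \<and> d_inf_id (nonwandering g) (i g) < \<epsilon>)"
    using W by simp
  ultimately show ?thesis
    by - (rule exI[of _ U], rule exI[of _ C], rule exI[of _ h], rule exI[of _ i], intro conjI U)
qed

end
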